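(* Let $m\in\{0,1,2,\ldots\}$ and let $a,b\in\mathbb{C}$. Put $$S_2(a,b)=\sum_{j=0}^\infty\sum_{k=0}^\infty \frac{(a)_j\,(b)_k}{j!\,k!\,(j+k+1)}\,\zeta(a+j)\,\zeta(b+k).$$ (i) If $a+b=-2m$ and $-2m-1<\Re(a)<1$, then $$S_2(a,b)=-\frac{\Gamma(1-a)\,\Gamma(2m+1+a)}{(2m+1)!}\,\cos(\pi a)\;\zeta(-2m-1).$$ (ii) If $a+b=-2m-1$ and $-2m-2<\Re(a)<1$, then $$S_2(a,b)=\frac{2\,(a)_{2m+2}}{(2m+2)!}\,\zeta'(-2m-2).$$
   Context: $\zeta$ is the Riemann zeta function (analytically continued) and $\zeta'$ its derivative; $(a)_j=a(a+1)\cdots(a+j-1)$ is the Pochhammer symbol with $(a)_0=1$ (in particular $(0)_0=1$). When $a=-p$ with $p=0,1,2,\ldots$, the product $(a)_j\,\zeta(a+j)$ is understood by its limiting value: for $j=p+1$ it equals $(-1)^p p!$, and for $j\ge p+2$ it equals $0$; likewise for $(b)_k\,\zeta(b+k)$ when $b$ is a non-positive integer. *)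

theory Defs
  imports "HOL-Complex_Analysis.Complex_Analysis"
begin

text \<open>
  The Riemann zeta function is introduced as the analytic continuation of its Dirichlet series
  to the plane punctured at 1. Without the (arbitrary) normalisation at the pole, the
  continuation would be determined only away from 1.
\<close>

definition is_zeta :: "(complex \<Rightarrow> complex) \<Rightarrow> bool" where
  "is_zeta f \<longleftrightarrow>
     f holomorphic_on (- {1}) \<and>
     (\<forall>s. Re s > 1 \<longrightarrow> (\<lambda>n. 1 / of_nat (Suc n) powr s) sums f s) \<and>
     f 1 = 0"

definition zeta :: "complex \<Rightarrow> complex" where
  "zeta = (THE f. is_zeta f)"

lemma is_zeta_unique:
  assumes f: "is_zeta f" and g: "is_zeta g"
  shows "f = g"
proof
  fix z
  show "f z = g z"
  proof (cases "z = 1")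
    case True
    then show ?thesis using f g by (simp add: is_zeta_def)
  next
    case False
    show ?thesis
    proof (rule analytic_continuation_open[of "{s. Re s > 1}" "- {1}" f g])
      show "open {s. Re s > 1}" by (rule open_halfspace_Re_gt)
      show "{s. Re s > 1} \<noteq> {}" by (auto intro!: exI[of _ 2])
      show "connected (- {1 :: complex})" by (intro connected_punctured_universe) simp
      show "f s = g s" if "s \<in> {s. Re s > 1}" for s
        using f g that by (auto simp: is_zeta_def intro: sums_unique2)
    qed (use f g False in \<open>auto simp: is_zeta_def\<close>)
  qed
qed

text \<open>
  The product of \<open>pochhammer a j\<close> and \<open>zeta (a + j)\<close>. For a non-positive integer \<open>a = -p\<close> it is
  the limiting value: this matters for \<open>j = p + 1\<close>, where the zero of the Pochhammer symbol
  meets the pole of zeta.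
\<close>

definition poch_zeta :: "complex \<Rightarrow> nat \<Rightarrow> complex" where
  "poch_zeta a j =
     (if a \<in> \<int>\<^sub>\<le>\<^sub>0 then Lim (at a) (\<lambda>z. pochhammer z j * zeta (z + of_nat j))
      else pochhammer a j * zeta (a + of_nat j))"

definition S2_term :: "complex \<Rightarrow> complex \<Rightarrow> nat \<Rightarrow> nat \<Rightarrow> complex" where
  "S2_term a b j k =
     poch_zeta a j * poch_zeta b k / (fact j * fact k * of_nat (j + k + 1))"

definition S2 :: "complex \<Rightarrow> complex \<Rightarrow> complex" where
  "S2 a b = (\<Sum>j. \<Sum>k. S2_term a b j k)"

definition S2_convergent :: "complex \<Rightarrow> complex \<Rightarrow> bool" where
  "S2_convergent a b \<longleftrightarrow>
     (\<forall>j. summable (\<lambda>k. S2_term a b j k)) \<and> summable (\<lambda>j. \<Sum>k. S2_term a b j k)"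

end

theory Submission
  imports Defs
begin

text \<open>
  The Taylor coefficients \<open>c\<^sub>j(a) = (a)\<^sub>j \<zeta>(a + j) / j!\<close> belong to \<open>\<zeta>(a, 1 - x)\<close>, so that \<open>S\<^sub>2(a, b)\<close> is
  the integral over \<open>[0, 1]\<close> of \<open>\<zeta>(a, x) \<zeta>(b, x)\<close>. The proof works with the series only. From
  \<open>(j + 1) c\<^sub>j\<^sub>+\<^sub>1(a) = a c\<^sub>j(a + 1)\<close> and \<open>\<Sum>j\<ge>1. c\<^sub>j(a) = 0\<close> for \<open>Re a < 0\<close> one obtains
  \<open>a S\<^sub>2(a + 1, b) + b S\<^sub>2(a, b + 1) = 0\<close>. Hence, on the line \<open>a + b = -N\<close>, the quotient of
  \<open>g(a) = S\<^sub>2(a, -N - a)\<close> by \<open>(a)\<^sub>N\<^sub>+\<^sub>1\<close> is 1-periodic in \<open>a\<close>, and so is that of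
  \<open>T(a) = g(0) / N! \<Gamma>(1 - a) \<Gamma>(N + 1 + a) cos(\<pi> a)\<close>. The difference of the two quotients has no pole
  at 0 and grows at most like \<open>exp(6 \<bar>Im a\<bar>)\<close>; since \<open>6 < 2\<pi>\<close>, it is a constant \<open>B\<close>, whence
  \<open>g(a) = T(a) + B (a)\<^sub>N\<^sub>+\<^sub>1\<close>. The symmetry \<open>g(a) = g(-N - a)\<close> gives \<open>B = 0\<close> for even \<open>N\<close> and
  \<open>g(0) = 0\<close> for odd \<open>N\<close>; in the odd case \<open>B\<close> is found from \<open>g'(0)\<close>, because \<open>S\<^sub>2(0, b)\<close> and
  \<open>S\<^sub>2(a, -N)\<close> are explicit.
\<close>

section \<open>Double series and the binomial series\<close>

text \<open>The admissible growth shapes the analytic part. After division by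
  \<open>(a)\<^sub>N\<^sub>+\<^sub>1\<close> the function T is a multiple of
  \<open>\<pi> cot(\<pi> a)\<close>, and a periodic entire function is forced to be constant only if
  its rate stays below \<open>2\<pi>\<close>. Each coefficient contains a Pochhammer symbol, of rate
  \<open>\<pi> / 2\<close> on vertical lines, and a value of zeta. Since \<open>zeta\<close> is
  given only by its characterisation, its continuation is constructed from binomial series in a way
  that also yields the rate \<delta> for every \<open>\<delta> > 0\<close>. With
  \<open>\<pi> / 2 < 2\<close>, \<open>\<delta> = 1 / 2\<close> and another \<open>1 / 2\<close> for
  polynomial factors, a coefficient costs rate 3; two of them give the 6. In the odd case,
  \<open>g(0) = 0\<close> says that zeta vanishes at \<open>-N - 1\<close>. The derivative
  \<open>g'(0)\<close> is taken along a line on which both arguments move; it is the sum of the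
  derivatives of \<open>S\<^sub>2(0, -N - a)\<close> and \<open>S\<^sub>2(a, -N)\<close>, because
  the mixed difference left over is quadratically small.\<close>

lemma holomorphic_on_suminf:
  fixes f :: "nat \<Rightarrow> complex \<Rightarrow> complex"
  assumes S: "open S" and hol: "\<And>n. f n holomorphic_on S"
    and bd: "\<And>x. x \<in> S \<Longrightarrow> \<exists>d>0. \<exists>M. cball x d \<subseteq> S \<and> summable M \<and> (\<forall>n. \<forall>z\<in>cball x d. norm (f n z) \<le> M n)"
  shows "(\<lambda>z. \<Sum>n. f n z) holomorphic_on S"
proof (rule holomorphic_uniform_sequence[OF S])
  show "(\<lambda>z. \<Sum>i<n. f i z) holomorphic_on S" for n
    using hol by (intro holomorphic_intros)
  fix x assume "x \<in> S"
  then obtain d M where d: "d > 0" "cball x d \<subseteq> S" "summable M"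
    and M: "\<And>n z. z \<in> cball x d \<Longrightarrow> norm (f n z) \<le> M n"
    using bd[OF \<open>x \<in> S\<close>] by metis
  have "uniform_limit (cball x d) (\<lambda>n z. \<Sum>i<n. f i z) (\<lambda>z. \<Sum>i. f i z) sequentially"
    by (rule Weierstrass_m_test[OF M d(3)])
  with d(1,2) show "\<exists>d>0. cball x d \<subseteq> S \<and>
      uniform_limit (cball x d) (\<lambda>n z. \<Sum>i<n. f i z) (\<lambda>z. \<Sum>n. f n z) sequentially"
    by blast
qed

text \<open>A majorant of product form gives at once summability over pairs, convergence of the
  iterated series and the exchange of its order; every double series below has one.\<close>

locale product_bounded_double_series =
  fixes f :: "nat \<Rightarrow> nat \<Rightarrow> complex" and u v :: "nat \<Rightarrow> real"
  assumes bound: "\<And>j k. norm (f j k) \<le> u j * v k"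
    and summable_u: "summable u" and summable_v: "summable v"
    and u_nonneg: "\<And>j. u j \<ge> 0" and v_nonneg: "\<And>k. v k \<ge> 0"
begin

lemma summable_on: "(\<lambda>(j,k). f j k) summable_on UNIV"
proof -
  have U: "u summable_on UNIV" and V: "v summable_on UNIV"
    by (rule norm_summable_imp_summable_on, simp add: u_nonneg v_nonneg summable_u summable_v)+
  have "(\<lambda>(j,k). u j * v k) summable_on (UNIV \<times> UNIV)"
  proof (rule summable_on_SigmaI)
    show "((\<lambda>k. case (j, k) of (j, k) \<Rightarrow> u j * v k) has_sum (u j * infsum v UNIV)) UNIV" for j
      using has_sum_cmult_right[OF has_sum_infsum[OF V]] by simp
    show "(\<lambda>j. u j * infsum v UNIV) summable_on UNIV"
      using U by (rule summable_on_cmult_left)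
  qed (auto simp: u_nonneg v_nonneg)
  then have "(\<lambda>p. norm ((\<lambda>(j,k). f j k) p)) summable_on UNIV"
    using bound by (intro Infinite_Sum.abs_summable_on_comparison_test'[where g = "\<lambda>(j,k). u j * v k"]) auto
  then show ?thesis
    by (rule abs_summable_summable)
qed

lemma summable_inner: "summable (f j)"
  by (rule summable_comparison_test'[OF summable_mult[OF summable_v, of "u j"] bound])

lemma norm_inner_le: "norm (\<Sum>k. f j k) \<le> u j * suminf v"
proof -
  have "norm (\<Sum>k. f j k) \<le> (\<Sum>k. u j * v k)"
    by (rule norm_suminf_le[OF bound summable_mult[OF summable_v]])
  then show ?thesis by (simp add: suminf_mult[OF summable_v])
qed

lemma summable_outer: "summable (\<lambda>j. \<Sum>k. f j k)"
  by (rule summable_comparison_test'[OF summable_mult2[OF summable_u, of "suminf v"] norm_inner_le])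

lemma norm_le: "norm (\<Sum>j. \<Sum>k. f j k) \<le> suminf u * suminf v"
proof -
  have "norm (\<Sum>j. \<Sum>k. f j k) \<le> (\<Sum>j. u j * suminf v)"
    by (rule norm_suminf_le[OF norm_inner_le summable_mult2[OF summable_u]])
  then show ?thesis by (simp add: suminf_mult2[OF summable_u])
qed

lemma has_sum: "((\<lambda>(j,k). f j k) has_sum (\<Sum>j. \<Sum>k. f j k)) UNIV"
proof -
  have inner: "(f j has_sum (\<Sum>k. f j k)) UNIV" for j
  proof (rule norm_summable_imp_has_sum)
    show "summable (\<lambda>k. norm (f j k))"
      by (rule summable_comparison_test'[OF summable_mult[OF summable_v, of "u j"], of 0]) (simp add: bound)
  qed (rule summable_sums[OF summable_inner])
  have outer: "((\<lambda>j. \<Sum>k. f j k) has_sum (\<Sum>j. \<Sum>k. f j k)) UNIV"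
  proof (rule norm_summable_imp_has_sum)
    show "summable (\<lambda>j. norm (\<Sum>k. f j k))"
      by (rule summable_comparison_test'[OF summable_mult2[OF summable_u, of "suminf v"], of 0])
         (simp add: norm_inner_le)
  qed (rule summable_sums[OF summable_outer])
  have "((\<lambda>(j,k). f j k) has_sum (\<Sum>j. \<Sum>k. f j k)) (UNIV \<times> UNIV)"
    by (rule has_sum_SigmaI[where g = "\<lambda>j. \<Sum>k. f j k"])
       (use inner outer summable_on in \<open>auto\<close>)
  then show ?thesis by simp
qed

lemma flipped: "product_bounded_double_series (\<lambda>k j. f j k) v u"
  using bound summable_u summable_v u_nonneg v_nonneg
  by unfold_locales (auto simp: mult.commute)

lemma suminf_swap: "(\<Sum>j. \<Sum>k. f j k) = (\<Sum>k. \<Sum>j. f j k)"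
proof -
  have "((\<lambda>(k,j). f j k) has_sum (\<Sum>k. \<Sum>j. f j k)) (prod.swap ` UNIV)"
    using product_bounded_double_series.has_sum[OF flipped] by simp
  then have "((\<lambda>(j,k). f j k) has_sum (\<Sum>k. \<Sum>j. f j k)) UNIV"
    by (subst (asm) has_sum_reindex) (auto simp: o_def case_prod_unfold)
  then show ?thesis
    using has_sum has_sum_unique by blast
qed

end

section \<open>Pochhammer symbols and the binomial series\<close>

lemma norm_pochhammer_le:
  fixes s :: complex
  shows "norm (pochhammer s n) \<le> pochhammer (norm s) n"
proof -
  have "norm (pochhammer s n) = (\<Prod>i<n. norm (s + of_nat i))"
    by (simp add: pochhammer_prod prod_norm atLeast0LessThan)
  also have "\<dots> \<le> (\<Prod>i<n. norm s + of_nat i)"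
    by (intro prod_mono) (metis norm_ge_zero norm_of_nat norm_triangle_ineq)
  finally show ?thesis by (simp add: pochhammer_prod atLeast0LessThan)
qed

lemma pochhammer_mono_real:
  fixes x y :: real
  assumes "0 \<le> x" "x \<le> y"
  shows "pochhammer x n \<le> pochhammer y n"
  unfolding pochhammer_prod using assms by (intro prod_mono) auto

lemma pochhammer_nonneg_real: "0 \<le> x \<Longrightarrow> 0 \<le> pochhammer (x::real) n"
  by (simp add: pochhammer_prod prod_nonneg)

lemma sums_pochhammer_real:
  fixes r x :: real
  assumes "0 \<le> x" "x < 1"
  shows "(\<lambda>j. pochhammer r j / fact j * x ^ j) sums (1 - x) powr (- r)"
proof -
  have "(\<lambda>n. ((- r) gchoose n) * (-x)^n) sums (1 + (-x)) powr (- r)"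
    using assms by (intro gen_binomial_real) auto
  moreover have "((- r) gchoose n) * (-x)^n = pochhammer r n / fact n * x ^ n" for n
    by (subst power_minus) (simp add: gbinomial_pochhammer minus_one_power_iff)
  ultimately show ?thesis by simp
qed

lemma sums_pochhammer_complex:
  fixes s z :: complex
  assumes "norm z < 1"
  shows "(\<lambda>j. pochhammer s j / fact j * z ^ j) sums (1 - z) powr (- s)"
proof -
  have "(\<lambda>n. ((- s) gchoose n) * (-z)^n) sums (1 + (-z)) powr (- s)"
    using assms by (intro gen_binomial_complex) auto
  moreover have "((- s) gchoose n) * (-z)^n = pochhammer s n / fact n * z ^ n" for n
    by (subst power_minus) (simp add: gbinomial_pochhammer minus_one_power_iff)
  ultimately show ?thesis by simp
qed

section \<open>Analytic continuation and growth of the zeta function\<close>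

lemma norm_of_nat_powr: "norm (of_nat n powr s :: complex) = real n powr Re s"
  by (cases "n = 0") (auto simp: norm_powr_real_powr)

lemma summable_shifted_powr:
  fixes \<sigma> :: real
  assumes "\<sigma> > 1"
  shows "summable (\<lambda>k. real (M + k) powr (- \<sigma>))"
proof -
  have "summable (\<lambda>k. real (k + M) powr (- \<sigma>))"
    using assms by (subst summable_iff_shift) (simp add: summable_real_powr_iff)
  then show ?thesis by (simp add: add.commute)
qed

definition zeta_tail_series :: "nat \<Rightarrow> complex \<Rightarrow> complex" where
  "zeta_tail_series M s = (\<Sum>k. of_nat (M + k) powr (- s))"

lemma summable_zeta_tail:
  assumes "Re s > 1"
  shows "summable (\<lambda>k. of_nat (M + k) powr (- s) :: complex)"
proof (rule summable_norm_cancel)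
  show "summable (\<lambda>k. norm (of_nat (M + k) powr (- s) :: complex))"
    using summable_shifted_powr[OF assms, of M] unfolding norm_of_nat_powr by simp
qed

text \<open>For \<open>Re s \<ge> 2\<close> the factor \<open>(M + k) powr (2 - Re s)\<close> is
  largest at \<open>k = 0\<close>, so \<open>s\<close> enters only through
  \<open>M powr (- Re s)\<close>. This decay turns the recursion for the continuation into a
  binomial series in \<open>1 / M\<close>.\<close>

lemma norm_zeta_tail_series_le:
  assumes M: "M \<ge> 1" and s: "Re s \<ge> 2"
  shows "norm (zeta_tail_series M s)
     \<le> real M powr 2 * (\<Sum>k. real (M + k) powr (- 2)) * real M powr (- Re s)"
proof -
  have "norm (of_nat (M + k) powr (- s) :: complex)
      \<le> real M powr (2 - Re s) * real (M + k) powr (- 2)" for k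
  proof -
    have "norm (of_nat (M + k) powr (- s) :: complex) = real (M + k) powr (2 - Re s) * real (M + k) powr (- 2)"
      unfolding norm_of_nat_powr by (simp flip: powr_add)
    also have "\<dots> \<le> real M powr (2 - Re s) * real (M + k) powr (- 2)"
      using M s by (intro mult_right_mono powr_mono2') auto
    finally show ?thesis .
  qed
  then have "norm (zeta_tail_series M s) \<le> (\<Sum>k. real M powr (2 - Re s) * real (M + k) powr (- 2))"
    unfolding zeta_tail_series_def
    by (rule norm_suminf_le) (intro summable_mult summable_shifted_powr, simp)
  also have "\<dots> = real M powr (2 - Re s) * (\<Sum>k. real (M + k) powr (- 2))"
    by (rule suminf_mult) (rule summable_shifted_powr, simp)
  also have "real M powr (2 - Re s) = real M powr 2 * real M powr (- Re s)"
    using powr_add[of "real M" 2 "- Re s"] by simp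
  finally show ?thesis by (simp add: mult_ac)
qed

lemma holomorphic_zeta_tail_series:
  assumes M: "M \<ge> 1"
  shows "zeta_tail_series M holomorphic_on {s. Re s > 1}"
  unfolding zeta_tail_series_def
proof (rule holomorphic_on_suminf)
  show "open {s. Re s > 1}" by (rule open_halfspace_Re_gt)
  show "(\<lambda>s. of_nat (M + k) powr - s) holomorphic_on {s. 1 < Re s}" for k
    using M by (auto intro!: holomorphic_intros)
  fix x assume x: "x \<in> {s. 1 < Re s}"
  define d where "d = (Re x - 1) / 2"
  have d: "d > 0" using x by (simp add: d_def)
  have Re: "Re z \<ge> 1 + d" if "z \<in> cball x d" for z
  proof -
    have "Re x - Re z \<le> d"
      using that abs_Re_le_cmod[of "x - z"] by (simp add: dist_norm)
    moreover have "Re x = 1 + 2 * d"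
      by (simp add: d_def field_simps)
    ultimately show ?thesis by simp
  qed
  have "norm (of_nat (M + n) powr - z :: complex) \<le> real (M + n) powr (- (1 + d))"
    if "z \<in> cball x d" for n z
    unfolding norm_of_nat_powr using Re[OF that] M by (intro powr_mono) auto
  moreover have "cball x d \<subseteq> {s. 1 < Re s}"
    using Re d by (fastforce simp del: mem_cball)
  moreover have "summable (\<lambda>n. real (M + n) powr (- (1 + d)))"
    by (rule summable_shifted_powr) (use d in simp)
  ultimately show "\<exists>d>0. \<exists>K. cball x d \<subseteq> {s. 1 < Re s} \<and> summable K \<and>
      (\<forall>n. \<forall>z\<in>cball x d. norm (of_nat (M + n) powr - z :: complex) \<le> K n)"
    using d by blast
qed

text \<open>The binomial series of \<open>(1 - 1 / M) powr (- R)\<close> without its first term. Its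
  value is the origin of the base \<open>M / (M - 1)\<close> in all later bounds, which tends to 1
  as \<open>M\<close> grows.\<close>

lemma sums_pochhammer_pow:
  fixes R :: real
  assumes "M \<ge> (2::nat)" "R \<ge> 0"
  shows "summable (\<lambda>j. pochhammer R (Suc j) / fact (Suc j) * (1 / real M) ^ Suc j)"
    and "(\<Sum>j. pochhammer R (Suc j) / fact (Suc j) * (1 / real M) ^ Suc j)
           \<le> (real M / real (M - 1)) powr R"
proof -
  let ?g = "\<lambda>j. pochhammer R j / fact j * (1 / real M) ^ j"
  have s: "?g sums (1 - 1 / real M) powr (- R)"
    using assms by (intro sums_pochhammer_real) auto
  have eq: "(1 - 1 / real M) powr (- R) = (real M / real (M - 1)) powr R"
  proof -
    have "1 - 1 / real M = inverse (real M / real (M - 1))"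
      using assms by (simp add: field_simps of_nat_diff)
    moreover have "real M / real (M - 1) > 0" using assms by auto
    ultimately show ?thesis using assms by (simp add: powr_minus powr_divide)
  qed
  have "(\<lambda>j. ?g (Suc j)) sums ((1 - 1 / real M) powr (- R) - ?g 0)"
    using s by (subst sums_Suc_iff) simp
  then show "summable (\<lambda>j. ?g (Suc j))" "(\<Sum>j. ?g (Suc j)) \<le> (real M / real (M - 1)) powr R"
    using eq by (auto simp: sums_iff)
qed

text \<open>For fixed \<open>n = M + k\<close> the sum over \<open>j\<close> is the binomial
  expansion of \<open>(n - 1) powr (- w) - n powr (- w)\<close>, and these differences telescope in
  \<open>k\<close>.\<close>

lemma zeta_tail_series_functional:
  assumes M: "M \<ge> 2" and w: "Re w > 0"
  shows "(\<lambda>j. pochhammer w (Suc j) / fact (Suc j) * zeta_tail_series M (w + of_nat (Suc j)))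
           sums (of_nat (M - 1) powr (- w))"
proof -
  define f where "f = (\<lambda>j k. pochhammer w (Suc j) / fact (Suc j) * (of_nat (M + k) powr (- (w + of_nat (Suc j))) :: complex))"
  \<comment> \<open>The power \<open>Re w + 1\<close> is kept in \<open>v\<close> for convergence in
    \<open>k\<close>, so only \<open>j\<close> powers of \<open>1 / M\<close> remain for
    \<open>u\<close>; the factor \<open>real M\<close> compensates for the exponent
    \<open>Suc j\<close>.\<close>
  define u where "u = (\<lambda>j. real M * (pochhammer (norm w) (Suc j) / fact (Suc j) * (1 / real M) ^ Suc j))"
  define v where "v = (\<lambda>k. real (M + k) powr (- (Re w + 1)))"
  interpret product_bounded_double_series f u v
  proof
    show "summable u" unfolding u_def
      by (intro summable_mult sums_pochhammer_pow) (use M in auto)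
    show "summable v" unfolding v_def
      by (rule summable_shifted_powr) (use w in auto)
    show "u j \<ge> 0" "v k \<ge> 0" for j k
      by (auto simp: u_def v_def pochhammer_nonneg_real)
    fix j k
    have "real (M + k) powr (- (Re w + real (Suc j))) = v k * real (M + k) powr (- real j)"
      using powr_add[of "real (M + k)" "- (Re w + 1)" "- real j"] by (simp add: v_def algebra_simps)
    also have "real (M + k) powr (- real j) \<le> real M powr (- real j)"
      using M by (intro powr_mono2') auto
    also have "real M powr (- real j) = real M * (1 / real M) ^ Suc j"
      using M by (simp add: powr_minus powr_realpow field_simps)
    finally have "real (M + k) powr (- (Re w + real (Suc j))) \<le> v k * (real M * (1 / real M) ^ Suc j)"
      by (auto simp: v_def mult_left_mono)
    moreover have "norm (pochhammer w (Suc j) / fact (Suc j)) \<le> pochhammer (norm w) (Suc j) / fact (Suc j)"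
      by (simp only: norm_divide norm_fact divide_right_mono norm_pochhammer_le fact_ge_zero)
    ultimately have "norm (pochhammer w (Suc j) / fact (Suc j)) * real (M + k) powr (- (Re w + real (Suc j)))
        \<le> (pochhammer (norm w) (Suc j) / fact (Suc j)) * (v k * (real M * (1 / real M) ^ Suc j))"
      by (intro mult_mono) (auto simp: pochhammer_nonneg_real)
    moreover have "norm (f j k) = norm (pochhammer w (Suc j) / fact (Suc j)) * real (M + k) powr (- (Re w + real (Suc j)))"
      by (simp only: f_def norm_mult norm_of_nat_powr uminus_complex.simps plus_complex.simps complex_Re_of_nat)
    ultimately show "norm (f j k) \<le> u j * v k"
      by (simp only: u_def mult_ac)
  qed
  have inner: "(\<Sum>k. f j k) = pochhammer w (Suc j) / fact (Suc j) * zeta_tail_series M (w + of_nat (Suc j))" for j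
    unfolding f_def zeta_tail_series_def
    by (rule suminf_mult) (rule summable_zeta_tail, use w in simp)
  have col: "(\<Sum>j. f j k) = of_nat (M + k - 1) powr (- w) - of_nat (M + Suc k - 1) powr (- w)" for k
  proof -
    define n where "n = M + k"
    have n: "n \<ge> 2" using M by (simp add: n_def)
    let ?g = "\<lambda>j. pochhammer w j / fact j * (1 / of_nat n :: complex) ^ j"
    have "?g sums (1 - 1 / of_nat n) powr (- w)"
      using n by (intro sums_pochhammer_complex) (auto simp: norm_divide)
    then have "(\<lambda>j. ?g (Suc j)) sums ((1 - 1 / of_nat n) powr (- w) - ?g 0)"
      by (subst sums_Suc_iff) simp
    then have "(\<lambda>j. of_nat n powr (- w) * ?g (Suc j)) sums (of_nat n powr (- w) * ((1 - 1 / of_nat n) powr (- w) - 1))"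
      by (intro sums_mult) simp
    moreover have "of_nat n powr (- w) * ?g (Suc j) = f j k" for j
    proof -
      have "(of_nat n :: complex) powr (- (w + of_nat (Suc j))) = of_nat n powr (- w) * of_nat n powr (- of_nat (Suc j))"
        by (simp flip: powr_add)
      also have "(of_nat n :: complex) powr (- of_nat (Suc j)) = (1 / of_nat n) ^ Suc j"
      proof -
        have "(of_nat n :: complex) powr of_nat (Suc j) = of_nat n ^ Suc j"
          using n by (subst powr_nat') auto
        then show ?thesis
          by (simp only: powr_minus power_one_over inverse_eq_divide)
      qed
      finally show ?thesis by (simp add: f_def n_def mult_ac)
    qed
    moreover have "of_nat n powr (- w) * ((1 - 1 / of_nat n) powr (- w) - 1) =
        of_nat (n - 1) powr (- w) - (of_nat n powr (- w) :: complex)"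
    proof -
      have "(of_nat (n - 1) :: complex) = of_real (real n * (1 - 1 / real n))"
        using n by (simp add: field_simps of_nat_diff)
      then have "(of_nat (n - 1) :: complex) powr (- w) = of_real (real n) powr (- w) * of_real (1 - 1 / real n) powr (- w)"
        using n by (simp only: of_real_mult) (subst powr_times_real, auto)
      then show ?thesis by (simp add: algebra_simps)
    qed
    ultimately show ?thesis using n by (simp add: sums_iff n_def)
  qed
  have "(\<lambda>k. of_nat (M + k - 1) powr (- w) :: complex) \<longlonglongrightarrow> 0"
  proof (rule tendsto_norm_zero_cancel)
    have "(\<lambda>k. real (k + (M - 1)) powr (- Re w)) \<longlonglongrightarrow> 0"
      using w by (intro LIMSEQ_ignore_initial_segment[where f = "\<lambda>k. real k powr (- Re w)"]
          tendsto_neg_powr filterlim_real_sequentially) auto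
    then show "(\<lambda>k. norm (of_nat (M + k - 1) powr (- w) :: complex)) \<longlonglongrightarrow> 0"
      unfolding norm_of_nat_powr using M by (simp add: add.commute)
  qed
  from telescope_sums'[OF this] have "(\<Sum>k. \<Sum>j. f j k) = of_nat (M - 1) powr (- w)"
    unfolding col by (simp add: sums_iff)
  then show ?thesis
    using summable_outer suminf_swap unfolding inner sums_iff by simp
qed

text \<open>Expanding \<open>(n - 1)\<^sup>-\<^sup>w - n\<^sup>-\<^sup>w\<close> binomially in \<open>1 / n\<close> and summing over \<open>n \<ge> M\<close> expresses
  the regularised tail \<open>(s - 1) \<Sum>n\<ge>M. n\<^sup>-\<^sup>s\<close> by its values at \<open>s + 1, s + 2, \<dots>\<close>; \<open>cont_tail M n\<close>
  uses this \<open>n\<close> times. A large \<open>M\<close> makes the exponential growth in \<open>Im s\<close> as slow as needed.\<close>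

primrec cont_tail :: "nat \<Rightarrow> nat \<Rightarrow> complex \<Rightarrow> complex" where
  "cont_tail M 0 s = (s - 1) * zeta_tail_series M s"
| "cont_tail M (Suc n) s = of_nat (M - 1) powr (1 - s) -
     (\<Sum>j. pochhammer (s - 1) (Suc j) / fact (Suc (Suc j)) * cont_tail M n (s + of_nat (Suc j)))"

text \<open>With \<open>w = s - 1\<close> the term \<open>j = 0\<close> of the functional relation
  is the regularised tail at \<open>s\<close>, and the recursion is the relation solved for it. In
  every later term the last Pochhammer factor is exactly the one that regularises its tail.\<close>

lemma cont_tail_Suc_0:
  assumes M: "M \<ge> 2" and s: "Re s > 1"
  shows "cont_tail M (Suc 0) s = cont_tail M 0 s"
proof -
  let ?g = "\<lambda>j. pochhammer (s - 1) (Suc j) / fact (Suc j) * zeta_tail_series M (s - 1 + of_nat (Suc j))"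
  have g: "?g sums (of_nat (M - 1) powr (- (s - 1)))"
    using s by (intro zeta_tail_series_functional M) auto
  have "(\<lambda>j. ?g (Suc j)) sums (of_nat (M - 1) powr (- (s - 1)) - ?g 0)"
    using g by (subst sums_Suc_iff) simp
  moreover have "?g (Suc j) = pochhammer (s - 1) (Suc j) / fact (Suc (Suc j)) * cont_tail M 0 (s + of_nat (Suc j))" for j
  proof -
    have "pochhammer (s - 1) (Suc (Suc j)) = pochhammer (s - 1) (Suc j) * (s + of_nat (Suc j) - 1)"
      by (subst pochhammer_Suc) (simp add: algebra_simps)
    moreover have "s - 1 + of_nat (Suc (Suc j)) = s + of_nat (Suc j)"
      by simp
    ultimately show ?thesis
      by (simp only: cont_tail.simps times_divide_eq_left mult.assoc)
  qed
  ultimately have "(\<lambda>j. pochhammer (s - 1) (Suc j) / fact (Suc (Suc j)) * cont_tail M 0 (s + of_nat (Suc j)))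
      sums (of_nat (M - 1) powr (- (s - 1)) - ?g 0)"
    by (simp only:)
  from sums_unique[OF this, symmetric] show ?thesis
    by (simp only: cont_tail.simps(2)) simp
qed

text \<open>The recursion reads only arguments whose real part is larger by at least 1, so each step
  widens the half-plane of agreement by 1.\<close>

lemma cont_tail_Suc:
  assumes M: "M \<ge> 2" and s: "Re s > 1 - real n"
  shows "cont_tail M (Suc n) s = cont_tail M n s"
  using s
proof (induction n arbitrary: s)
  case 0
  then show ?case using cont_tail_Suc_0[OF M] by simp
next
  case (Suc n)
  have "cont_tail M (Suc n) (s + of_nat (Suc j)) = cont_tail M n (s + of_nat (Suc j))" for j
    by (rule Suc.IH) (use Suc.prems in simp)
  then show ?case by (simp only: cont_tail.simps(2)[of M "Suc n"] cont_tail.simps(2)[of M n s])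
qed

lemma cont_tail_stable:
  assumes M: "M \<ge> 2" and s: "Re s > 1 - real n" and nm: "n \<le> m"
  shows "cont_tail M m s = cont_tail M n s"
  using nm
proof (induction rule: dec_induct)
  case (step i)
  have "Re s > 1 - real i" using s step.hyps by simp
  then show ?case using cont_tail_Suc[OF M] step.IH by metis
qed simp

text \<open>The growth of \<open>1 + norm (s + of_nat (Suc j))\<close> costs a factor
  \<open>j + 2\<close>, paid by lowering \<open>fact (Suc (Suc j))\<close> to
  \<open>fact (Suc j)\<close>. What remains is a term of the binomial series in
  \<open>1 / M\<close>.\<close>

lemma cont_tail_term_bound:
  assumes M: "M \<ge> 2" and C: "C \<ge> 0"
    and bd: "\<And>s. Re s \<ge> 2 - real n \<Longrightarrow> norm (cont_tail M n s)
        \<le> C * (1 + norm s) * real M powr (- Re s) * (real M / real (M - 1)) powr (real n * \<bar>Im s\<bar>)"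
    and s: "Re s \<ge> 1 - real n"
  shows "norm (pochhammer (s - 1) (Suc j) / fact (Suc (Suc j)) * cont_tail M n (s + of_nat (Suc j)))
     \<le> (pochhammer (norm (s - 1)) (Suc j) / fact (Suc j) * (1 / real M) ^ Suc j)
        * (C * (1 + norm s) * real M powr (- Re s) * (real M / real (M - 1)) powr (real n * \<bar>Im s\<bar>))"
proof -
  define E where "E = (real M / real (M - 1)) powr (real n * \<bar>Im s\<bar>)"
  define p where "p = pochhammer (norm (s - 1)) (Suc j)"
  have p: "p \<ge> 0" by (simp add: p_def pochhammer_nonneg_real)
  have "norm (cont_tail M n (s + of_nat (Suc j)))
      \<le> C * (1 + norm (s + of_nat (Suc j))) * real M powr (- Re (s + of_nat (Suc j))) * E"
    using bd[of "s + of_nat (Suc j)"] s by (simp add: E_def)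
  also have "real M powr (- Re (s + of_nat (Suc j))) = real M powr (- Re s) * (1 / real M) ^ Suc j"
  proof -
    have "real M powr (- Re (s + of_nat (Suc j))) = real M powr (- Re s) * real M powr (- real (Suc j))"
      using powr_add[of "real M" "- Re s" "- real (Suc j)"] by simp
    also have "real M powr (- real (Suc j)) = (1 / real M) ^ Suc j"
      using M powr_realpow[of "real M" "Suc j"] by (simp only: powr_minus power_one_over inverse_eq_divide)
    finally show ?thesis .
  qed
  also have "C * (1 + norm (s + of_nat (Suc j))) * (real M powr (- Re s) * (1 / real M) ^ Suc j) * E
     \<le> C * ((1 + norm s) * (real j + 2)) * (real M powr (- Re s) * (1 / real M) ^ Suc j) * E"
  proof (intro mult_right_mono mult_left_mono)
    have "norm (s + of_nat (Suc j)) \<le> norm s + real (Suc j)"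
      by (metis norm_of_nat norm_triangle_ineq)
    also have "1 + (norm s + real (Suc j)) \<le> (1 + norm s) * (real j + 2)"
      by (simp add: algebra_simps)
    finally show "1 + norm (s + of_nat (Suc j)) \<le> (1 + norm s) * (real j + 2)" by simp
  qed (use C in \<open>auto simp: E_def\<close>)
  finally have *: "norm (cont_tail M n (s + of_nat (Suc j)))
      \<le> (real j + 2) * (C * (1 + norm s) * real M powr (- Re s) * E * (1 / real M) ^ Suc j)"
    by (simp add: mult_ac)
  have "norm (pochhammer (s - 1) (Suc j) / fact (Suc (Suc j)) * cont_tail M n (s + of_nat (Suc j)))
      = norm (pochhammer (s - 1) (Suc j)) / fact (Suc (Suc j)) * norm (cont_tail M n (s + of_nat (Suc j)))"
    by (simp only: norm_mult norm_divide norm_fact)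
  also have "\<dots> \<le> p / fact (Suc (Suc j)) *
      ((real j + 2) * (C * (1 + norm s) * real M powr (- Re s) * E * (1 / real M) ^ Suc j))"
    using * p by (intro mult_mono divide_right_mono) (auto simp: p_def norm_pochhammer_le simp del: fact_Suc)
  also have "\<dots> = (p / fact (Suc j) * (1 / real M) ^ Suc j) * (C * (1 + norm s) * real M powr (- Re s) * E)"
  proof -
    have "p / fact (Suc (Suc j)) * (real j + 2) = p / fact (Suc j)"
    proof -
      have "p / (a * b) * a = p / b" if "a \<noteq> 0" for a b :: real
        using that by simp
      from this[of "real j + 2" "fact (Suc j)"] show ?thesis
        unfolding fact_Suc[of "Suc j"] by (simp add: add_ac del: fact_Suc)
    qed
    then show ?thesis by (simp only: mult.assoc[symmetric]) (simp only: mult_ac)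
  qed
  finally show ?thesis by (simp only: E_def p_def)
qed

text \<open>Only a strip of width 1 is new in each step. There \<open>norm (s - 1)\<close> is at
  most \<open>n + 1 + \<bar>Im s\<bar>\<close>, so the binomial series adds one factor
  \<open>q powr \<bar>Im s\<bar>\<close> with \<open>q = M / (M - 1)\<close>.\<close>

lemma cont_tail_bound:
  assumes M: "M \<ge> 2"
  shows "\<exists>C\<ge>0. \<forall>s. Re s \<ge> 2 - real n \<longrightarrow> norm (cont_tail M n s)
        \<le> C * (1 + norm s) * real M powr (- Re s) * (real M / real (M - 1)) powr (real n * \<bar>Im s\<bar>)"
proof (induction n)
  case 0
  define C where "C = real M powr 2 * (\<Sum>k. real (M + k) powr (- 2))"
  have C: "C \<ge> 0"
    unfolding C_def by (intro mult_nonneg_nonneg suminf_nonneg summable_shifted_powr) auto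
  have "norm (cont_tail M 0 s) \<le> C * (1 + norm s) * real M powr (- Re s) *
      (real M / real (M - 1)) powr (real 0 * \<bar>Im s\<bar>)" if "Re s \<ge> 2" for s
  proof -
    have "norm (cont_tail M 0 s) \<le> (1 + norm s) * (C * real M powr (- Re s))"
      unfolding cont_tail.simps norm_mult C_def
      using norm_triangle_ineq4[of s 1] M that
      by (intro mult_mono norm_zeta_tail_series_le) auto
    then show ?thesis using M by (simp add: mult_ac)
  qed
  with C show ?case by (intro exI[of _ C]) simp
next
  case (Suc n)
  then obtain C where C: "C \<ge> 0" and bd: "\<And>s. Re s \<ge> 2 - real n \<Longrightarrow> norm (cont_tail M n s)
        \<le> C * (1 + norm s) * real M powr (- Re s) * (real M / real (M - 1)) powr (real n * \<bar>Im s\<bar>)"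
    by blast
  define q where "q = real M / real (M - 1)"
  have q: "q \<ge> 1" using M by (simp add: q_def)
  \<comment> \<open>\<open>real M powr 2\<close> covers the boundary term;
    \<open>q powr (real n + 1)\<close> is the share of the real part in
    \<open>q powr norm (s - 1)\<close>.\<close>
  define C' where "C' = real M powr 2 + C * q powr (real n + 1)"
  have "C' \<ge> C"
  proof -
    have "C * 1 \<le> C * q powr (real n + 1)"
      using q C by (intro mult_left_mono ge_one_powr_ge_zero) auto
    then show ?thesis by (simp add: C'_def add_increasing)
  qed
  have "norm (cont_tail M (Suc n) s) \<le> C' * (1 + norm s) * real M powr (- Re s) * q powr (real (Suc n) * \<bar>Im s\<bar>)"
    if s: "Re s \<ge> 2 - real (Suc n)" for s
  proof (cases "Re s \<ge> 2 - real n")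
    case True
    have "norm (cont_tail M (Suc n) s) = norm (cont_tail M n s)"
      using True by (subst cont_tail_Suc[OF M]) auto
    also have "\<dots> \<le> C * (1 + norm s) * real M powr (- Re s) * q powr (real n * \<bar>Im s\<bar>)"
      using bd[OF True] by (simp add: q_def)
    also have "\<dots> \<le> C' * (1 + norm s) * real M powr (- Re s) * q powr (real (Suc n) * \<bar>Im s\<bar>)"
      using \<open>C' \<ge> C\<close> C q by (intro mult_mono mult_right_mono powr_mono) auto
    finally show ?thesis .
  next
    case False
    define R where "R = norm (s - 1)"
    define B where "B = C * (1 + norm s) * real M powr (- Re s) * q powr (real n * \<bar>Im s\<bar>)"
    have B: "B \<ge> 0" using C by (simp add: B_def)
    have s1: "Re s \<ge> 1 - real n" using s by simp
    have "norm (\<Sum>j. pochhammer (s - 1) (Suc j) / fact (Suc (Suc j)) * cont_tail M n (s + of_nat (Suc j)))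
        \<le> (\<Sum>j. (pochhammer R (Suc j) / fact (Suc j) * (1 / real M) ^ Suc j) * B)"
      unfolding B_def R_def q_def
      by (intro norm_suminf_le cont_tail_term_bound[OF M C bd s1] summable_mult2 sums_pochhammer_pow(1)[OF M]) auto
    also have "\<dots> = (\<Sum>j. pochhammer R (Suc j) / fact (Suc j) * (1 / real M) ^ Suc j) * B"
      by (rule suminf_mult2[symmetric], rule sums_pochhammer_pow(1)[OF M]) (simp add: R_def)
    also have "\<dots> \<le> q powr R * B"
      using sums_pochhammer_pow(2)[OF M, of R] B by (intro mult_right_mono) (auto simp: q_def R_def)
    also have "\<dots> \<le> q powr (real n + 1 + \<bar>Im s\<bar>) * B"
    proof -
      have "R \<le> \<bar>Re (s - 1)\<bar> + \<bar>Im (s - 1)\<bar>"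
        unfolding R_def by (rule cmod_le)
      also have "\<bar>Re (s - 1)\<bar> \<le> real n + 1" using False s1 by auto
      finally have "R \<le> real n + 1 + \<bar>Im s\<bar>" by simp
      then show ?thesis using q B by (intro mult_right_mono powr_mono) auto
    qed
    also have "\<dots> = C * q powr (real n + 1) * (1 + norm s) * real M powr (- Re s) * q powr (real (Suc n) * \<bar>Im s\<bar>)"
    proof -
      have "q powr (real n + 1 + \<bar>Im s\<bar>) * q powr (real n * \<bar>Im s\<bar>) = q powr (real n + 1) * q powr (real (Suc n) * \<bar>Im s\<bar>)"
        by (simp add: algebra_simps flip: powr_add)
      then have "C * (1 + norm s) * real M powr (- Re s) * (q powr (real n + 1 + \<bar>Im s\<bar>) * q powr (real n * \<bar>Im s\<bar>))
          = C * (1 + norm s) * real M powr (- Re s) * (q powr (real n + 1) * q powr (real (Suc n) * \<bar>Im s\<bar>))"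
        by (simp only:)
      then show ?thesis unfolding B_def by (simp only: mult_ac)
    qed
    finally have 1: "norm (\<Sum>j. pochhammer (s - 1) (Suc j) / fact (Suc (Suc j)) * cont_tail M n (s + of_nat (Suc j)))
      \<le> C * q powr (real n + 1) * (1 + norm s) * real M powr (- Re s) * q powr (real (Suc n) * \<bar>Im s\<bar>)" .
    have 2: "norm (of_nat (M - 1) powr (1 - s) :: complex) \<le>
        real M powr 2 * (1 + norm s) * real M powr (- Re s) * q powr (real (Suc n) * \<bar>Im s\<bar>)"
    proof -
      have "norm (of_nat (M - 1) powr (1 - s) :: complex) = real (M - 1) powr (1 - Re s)"
        unfolding norm_of_nat_powr by simp
      also have "\<dots> \<le> real (M - 1) powr (2 - Re s)"
        using M by (intro powr_mono) auto
      also have "\<dots> \<le> real M powr (2 - Re s)"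
        using M False by (intro powr_mono2) auto
      also have "\<dots> = real M powr 2 * 1 * real M powr (- Re s) * 1"
        using powr_add[of "real M" 2 "- Re s"] by simp
      also have "\<dots> \<le> real M powr 2 * (1 + norm s) * real M powr (- Re s) * q powr (real (Suc n) * \<bar>Im s\<bar>)"
        using q by (intro mult_mono ge_one_powr_ge_zero) auto
      finally show ?thesis .
    qed
    have "norm (cont_tail M (Suc n) s) \<le>
      real M powr 2 * (1 + norm s) * real M powr (- Re s) * q powr (real (Suc n) * \<bar>Im s\<bar>)
      + C * q powr (real n + 1) * (1 + norm s) * real M powr (- Re s) * q powr (real (Suc n) * \<bar>Im s\<bar>)"
      unfolding cont_tail.simps by (rule order_trans[OF norm_triangle_ineq4 add_mono[OF 2 1]])
    then show ?thesis by (simp only: C'_def distrib_right)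
  qed
  moreover have "C' \<ge> 0" using \<open>C' \<ge> C\<close> C by simp
  ultimately show ?case unfolding q_def by blast
qed

lemma holomorphic_cont_tail:
  assumes M: "M \<ge> 2"
  shows "cont_tail M n holomorphic_on {s. Re s > 2 - real n}"
proof (induction n)
  case 0
  have "(\<lambda>s. (s - 1) * zeta_tail_series M s) holomorphic_on {s. Re s > 2}"
    by (intro holomorphic_intros holomorphic_on_subset[OF holomorphic_zeta_tail_series]) (use M in auto)
  then show ?case by (simp add: cont_tail.simps[abs_def])
next
  case (Suc n)
  obtain C where C: "C \<ge> 0" and bd: "\<And>s. Re s \<ge> 2 - real n \<Longrightarrow> norm (cont_tail M n s)
        \<le> C * (1 + norm s) * real M powr (- Re s) * (real M / real (M - 1)) powr (real n * \<bar>Im s\<bar>)"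
    using cont_tail_bound[OF M] by blast
  define q where "q = real M / real (M - 1)"
  have q: "q \<ge> 1" using M by (simp add: q_def)
  let ?f = "\<lambda>j s. pochhammer (s - 1) (Suc j) / fact (Suc (Suc j)) * cont_tail M n (s + of_nat (Suc j))"
  let ?S = "{s :: complex. Re s > 1 - real n}"
  have "(\<lambda>s. \<Sum>j. ?f j s) holomorphic_on ?S"
  proof (rule holomorphic_on_suminf)
    show S: "open ?S" by (rule open_halfspace_Re_gt)
    fix j
    have "(cont_tail M n \<circ> (\<lambda>s. s + of_nat (Suc j))) holomorphic_on ?S"
      by (rule holomorphic_on_compose_gen[OF _ Suc.IH]) (auto intro!: holomorphic_intros)
    then have "(\<lambda>s. cont_tail M n (s + of_nat (Suc j))) holomorphic_on ?S"
      by (simp only: o_def)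
    then show "?f j holomorphic_on ?S"
      by (intro holomorphic_intros) (auto simp: pochhammer_prod intro!: holomorphic_intros)
  next
    fix x assume "x \<in> ?S"
    then obtain d where d: "d > 0" "cball x d \<subseteq> ?S"
      using open_contains_cball open_halfspace_Re_gt by blast
    define \<rho> where "\<rho> = norm x + d"
    define B where "B = C * (1 + \<rho>) * real M powr \<rho> * q powr (real n * \<rho>)"
    define K where "K = (\<lambda>j. (pochhammer (\<rho> + 1) (Suc j) / fact (Suc j) * (1 / real M) ^ Suc j) * B)"
    have "norm (?f j z) \<le> K j" if z: "z \<in> cball x d" for j z
    proof -
      have \<rho>: "norm z \<le> \<rho>"
        using z norm_triangle_ineq[of x "z - x"] by (simp add: \<rho>_def dist_norm norm_minus_commute)
      have \<rho>0: "\<rho> \<ge> 0" using \<rho> norm_ge_zero order_trans by blast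
      then have p0: "pochhammer (\<rho> + 1) (Suc j) \<ge> 0" by (intro pochhammer_nonneg_real) simp
      have re: "Re z \<ge> 1 - real n" using z d by force
      have "norm (?f j z) \<le> (pochhammer (norm (z - 1)) (Suc j) / fact (Suc j) * (1 / real M) ^ Suc j)
        * (C * (1 + norm z) * real M powr (- Re z) * q powr (real n * \<bar>Im z\<bar>))"
        unfolding q_def by (rule cont_tail_term_bound[OF M C bd re])
      also have "\<dots> \<le> K j"
        unfolding K_def B_def
      proof (intro mult_mono divide_right_mono pochhammer_mono_real powr_mono mult_left_mono)
        show "norm (z - 1) \<le> \<rho> + 1" using norm_triangle_ineq4[of z 1] \<rho> by simp
        show "- Re z \<le> \<rho>" using abs_Re_le_cmod[of z] \<rho> by simp
        show "\<bar>Im z\<bar> \<le> \<rho>" using abs_Im_le_cmod[of z] \<rho> by simp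
      qed (use \<rho> \<rho>0 p0 C q M in \<open>auto simp: pochhammer_nonneg_real\<close>)
      finally show ?thesis .
    qed
    moreover have "summable K"
      unfolding K_def using d(1)
      by (intro summable_mult2 sums_pochhammer_pow(1)[OF M]) (simp add: \<rho>_def)
    ultimately show "\<exists>d>0. \<exists>K. cball x d \<subseteq> ?S \<and> summable K \<and> (\<forall>n. \<forall>z\<in>cball x d. norm (?f n z) \<le> K n)"
      using d by (intro exI[of _ d] exI[of _ K] conjI) auto
  qed
  then have "(\<lambda>s. of_nat (M - 1) powr (1 - s) - (\<Sum>j. ?f j s)) holomorphic_on ?S"
    using M by (intro holomorphic_intros) auto
  moreover have "?S = {s. Re s > 2 - real (Suc n)}" by auto
  ultimately show ?case
    by (simp only: cont_tail.simps[abs_def])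
qed

section \<open>The entire tails and the entire function (s - 1) zeta(s)\<close>

definition zeta_tail :: "nat \<Rightarrow> complex \<Rightarrow> complex" where
  "zeta_tail M s = cont_tail M (nat \<lceil>2 - Re s\<rceil> + 1) s"

text \<open>The depth of recursion in \<open>zeta_tail\<close> varies with \<open>s\<close>. By
  stability any depth that reaches \<open>s\<close> gives the same value, so one depth serves a
  whole half-plane.\<close>

lemma zeta_tail_eq_cont_tail:
  assumes M: "M \<ge> 2" and s: "Re s > 1 - real n"
  shows "zeta_tail M s = cont_tail M n s"
proof -
  define n0 where "n0 = nat \<lceil>2 - Re s\<rceil> + 1"
  have s0: "Re s > 1 - real n0"
    unfolding n0_def by linarith
  show ?thesis
    using cont_tail_stable[OF M s0, of n] cont_tail_stable[OF M s, of n0] nat_le_linear[of n n0]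
    by (auto simp: zeta_tail_def n0_def)
qed

lemma zeta_tail_eq_series:
  assumes "M \<ge> 2" "Re s > 1"
  shows "zeta_tail M s = (s - 1) * zeta_tail_series M s"
  using zeta_tail_eq_cont_tail[of M 0 s] assms by simp

lemma holomorphic_zeta_tail:
  assumes M: "M \<ge> 2"
  shows "zeta_tail M holomorphic_on UNIV"
proof -
  have "zeta_tail M holomorphic_on (\<Union>n\<in>UNIV. {s. Re s > 2 - real n})"
  proof (rule holomorphic_on_UN_open)
    fix n
    show "zeta_tail M holomorphic_on {s. Re s > 2 - real n}"
      by (rule holomorphic_transform[OF holomorphic_cont_tail[OF M, of n]])
         (simp add: zeta_tail_eq_cont_tail[OF M, of n])
    show "open {s. Re s > 2 - real n}" by (rule open_halfspace_Re_gt)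
  qed
  moreover have "(\<Union>n\<in>UNIV. {s :: complex. Re s > 2 - real n}) = UNIV"
  proof (intro equalityI subsetI)
    fix s :: complex
    obtain n where "real n > 2 - Re s" using reals_Archimedean2 by blast
    then show "s \<in> (\<Union>n\<in>UNIV. {s. Re s > 2 - real n})" by (auto intro!: exI[of _ n])
  qed auto
  ultimately show ?thesis by simp
qed

lemma zeta_tail_bound:
  assumes M: "M \<ge> 2"
  shows "\<exists>C\<ge>0. \<forall>s. Re s \<ge> 2 - real n \<longrightarrow> norm (zeta_tail M s)
        \<le> C * (1 + norm s) * real M powr (- Re s) * (real M / real (M - 1)) powr (real n * \<bar>Im s\<bar>)"
proof -
  have "zeta_tail M s = cont_tail M n s" if "Re s \<ge> 2 - real n" for s
    using that by (intro zeta_tail_eq_cont_tail[OF M]) simp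
  then show ?thesis using cont_tail_bound[OF M, of n] by auto
qed

text \<open>The last factor \<open>w + j\<close> of the Pochhammer symbol has gone into the
  regularisation of the tail at \<open>w + j + 1\<close>. In this pole-free form the relation holds
  for every \<open>w\<close>; later uses are \<open>w = 0\<close> and
  \<open>Re w < 0\<close>.\<close>

lemma zeta_tail_functional:
  assumes M: "M \<ge> 2"
  shows "(\<lambda>j. pochhammer w j / fact (Suc j) * zeta_tail M (w + of_nat (Suc j)))
           sums (of_nat (M - 1) powr (- w))"
proof -
  define s where "s = w + 1"
  obtain n where n: "real n > 2 - Re s" using reals_Archimedean2 by blast
  let ?f = "\<lambda>j. pochhammer (s - 1) (Suc j) / fact (Suc (Suc j)) * cont_tail M n (s + of_nat (Suc j))"
  let ?g = "\<lambda>j. pochhammer w j / fact (Suc j) * zeta_tail M (w + of_nat (Suc j))"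
  obtain C where C: "C \<ge> 0" and bd: "\<And>s. Re s \<ge> 2 - real n \<Longrightarrow> norm (cont_tail M n s)
        \<le> C * (1 + norm s) * real M powr (- Re s) * (real M / real (M - 1)) powr (real n * \<bar>Im s\<bar>)"
    using cont_tail_bound[OF M] by blast
  have "summable ?f"
    by (rule summable_comparison_test'[OF summable_mult2[OF sums_pochhammer_pow(1)[OF M]]
          cont_tail_term_bound[OF M C bd]]) (use n in auto)
  then have fs: "?f sums (\<Sum>j. ?f j)" by (rule summable_sums)
  have fg: "?f = (\<lambda>j. ?g (Suc j))"
  proof
    fix j
    have "cont_tail M n (s + of_nat (Suc j)) = zeta_tail M (s + of_nat (Suc j))"
      by (rule zeta_tail_eq_cont_tail[OF M, symmetric]) (use n in simp)
    then show "?f j = ?g (Suc j)"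
      by (simp add: s_def add_ac del: fact_Suc)
  qed
  have 1: "?g sums ((\<Sum>j. ?f j) + ?g 0)"
    by (rule sums_Suc) (use fs in \<open>simp only: fg[symmetric]\<close>)
  have "?g 0 = zeta_tail M s" by (simp add: s_def)
  also have "\<dots> = cont_tail M (Suc n) s"
    by (rule zeta_tail_eq_cont_tail[OF M]) (use n in simp)
  also have "\<dots> = of_nat (M - 1) powr (1 - s) - (\<Sum>j. ?f j)" by simp
  finally show ?thesis using 1 by (simp add: s_def)
qed

text \<open>\<open>zeta_reg s = (s - 1) \<zeta>(s)\<close> is entire, with value 1 at the pole of \<open>\<zeta>\<close>.\<close>

definition zeta_reg :: "complex \<Rightarrow> complex" where
  "zeta_reg s = (s - 1) + zeta_tail 2 s"

lemma holomorphic_zeta_reg: "zeta_reg holomorphic_on A"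
proof -
  have "(\<lambda>s. (s - 1) + zeta_tail 2 s) holomorphic_on UNIV"
    by (intro holomorphic_intros holomorphic_zeta_tail) simp
  then show ?thesis
    unfolding zeta_reg_def[abs_def] by (rule holomorphic_on_subset) simp
qed

lemma sums_zeta_reg:
  assumes s: "Re s > 1"
  shows "(\<lambda>n. 1 / of_nat (Suc n) powr s) sums (zeta_reg s / (s - 1))"
proof -
  have "(\<lambda>n. of_nat (2 + n) powr (- s)) sums zeta_tail_series 2 s"
    unfolding zeta_tail_series_def by (rule summable_sums[OF summable_zeta_tail[OF s]])
  then have "(\<lambda>n. 1 / of_nat (Suc (Suc n)) powr s) sums zeta_tail_series 2 s"
    by (simp add: powr_minus field_simps)
  from sums_Suc[OF this] have "(\<lambda>n. 1 / of_nat (Suc n) powr s) sums (zeta_tail_series 2 s + 1)"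
    by simp
  moreover have "s \<noteq> 1" using s by auto
  then have "zeta_tail_series 2 s + 1 = zeta_reg s / (s - 1)"
    using s by (auto simp: zeta_reg_def zeta_tail_eq_series field_simps)
  ultimately show ?thesis by simp
qed

text \<open>At \<open>w = 0\<close> the Pochhammer symbol leaves only \<open>j = 0\<close> in the
  functional relation. The value is the residue of zeta at its pole.\<close>

lemma zeta_reg_one: "zeta_reg 1 = 1"
proof -
  have "(\<lambda>j. pochhammer 0 j / fact (Suc j) * zeta_tail 2 (0 + of_nat (Suc j))) sums 1"
    using zeta_tail_functional[of 2 0] by simp
  moreover have "(\<lambda>j. pochhammer 0 j / fact (Suc j) * zeta_tail 2 (0 + of_nat (Suc j))) sums zeta_tail 2 1"
    using sums_single[of 0 "\<lambda>j. zeta_tail 2 1"]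
    by (rule sums_cong[THEN iffD1, rotated]) (simp add: pochhammer_0_left)
  ultimately have "zeta_tail 2 1 = 1"
    using sums_unique2 by blast
  then show ?thesis by (simp add: zeta_reg_def)
qed

text \<open>Existence for the definite description, which together with uniqueness replaces
  \<open>zeta\<close> by a formula. The case \<open>s = 1\<close> reproduces the value prescribed at
  the pole.\<close>

lemma zeta_eq_zeta_reg: "zeta = (\<lambda>s. if s = 1 then 0 else zeta_reg s / (s - 1))"
proof -
  have "is_zeta (\<lambda>s. if s = 1 then 0 else zeta_reg s / (s - 1))"
    unfolding is_zeta_def
  proof (intro conjI allI impI)
    have "(\<lambda>s. zeta_reg s / (s - 1)) holomorphic_on - {1}"
      by (intro holomorphic_intros holomorphic_zeta_reg) auto
    then show "(\<lambda>s. if s = 1 then 0 else zeta_reg s / (s - 1)) holomorphic_on - {1}"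
      by (rule holomorphic_transform) auto
    show "(\<lambda>n. 1 / of_nat (Suc n) powr s) sums (if s = 1 then 0 else zeta_reg s / (s - 1))"
      if "Re s > 1" for s
      using sums_zeta_reg[OF that] that by (auto simp del: of_nat_Suc)
  qed simp
  then show ?thesis
    unfolding zeta_def by (intro the_equality) (auto intro: is_zeta_unique)
qed

lemma zeta_eq: "s \<noteq> 1 \<Longrightarrow> zeta s = zeta_reg s / (s - 1)"
  by (simp add: zeta_eq_zeta_reg)

lemma holomorphic_zeta: "1 \<notin> A \<Longrightarrow> zeta holomorphic_on A"
proof -
  assume "1 \<notin> A"
  then have "(\<lambda>s. zeta_reg s / (s - 1)) holomorphic_on A"
    by (intro holomorphic_intros holomorphic_zeta_reg) auto
  then show ?thesis
    by (rule holomorphic_transform) (metis \<open>1 \<notin> A\<close> zeta_eq)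
qed

text \<open>Both sides are entire and agree where the Dirichlet series converges. The freedom in
  \<open>M\<close> is what makes the growth rate adjustable.\<close>

lemma zeta_reg_eq_zeta_tail:
  assumes M: "M \<ge> 2"
  shows "zeta_reg s = (s - 1) * (\<Sum>n=1..<M. of_nat n powr (- s)) + zeta_tail M s"
proof (rule analytic_continuation_open[of "{s. Re s > 1}" UNIV zeta_reg
      "\<lambda>s. (s - 1) * (\<Sum>n=1..<M. of_nat n powr (- s)) + zeta_tail M s"])
  show "open {s. Re s > 1}" by (rule open_halfspace_Re_gt)
  show "{s. Re s > 1} \<noteq> {}" by (auto intro!: exI[of _ 2])
  show "zeta_reg holomorphic_on UNIV" by (rule holomorphic_zeta_reg)
  show "(\<lambda>s. (s - 1) * (\<Sum>n=1..<M. of_nat n powr (- s)) + zeta_tail M s) holomorphic_on UNIV"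
    by (intro holomorphic_intros holomorphic_zeta_tail M) auto
  fix s :: complex assume "s \<in> {s. Re s > 1}"
  then have s: "Re s > 1" by simp
  have "(\<lambda>n. of_nat (Suc n) powr (- s)) sums (zeta_reg s / (s - 1))"
    using sums_zeta_reg[OF s] by (simp add: powr_minus divide_inverse)
  then have "(\<lambda>n. of_nat (Suc (n + (M - 1))) powr (- s)) sums
      (zeta_reg s / (s - 1) - (\<Sum>n<M-1. of_nat (Suc n) powr (- s)))"
    by (rule sums_split_initial_segment)
  then have "zeta_tail_series M s = zeta_reg s / (s - 1) - (\<Sum>n<M-1. of_nat (Suc n) powr (- s))"
    unfolding zeta_tail_series_def using M by (simp add: sums_iff add.commute del: of_nat_Suc)
  moreover have "(\<Sum>n<M-1. of_nat (Suc n) powr (- s)) = (\<Sum>n=1..<M. (of_nat n :: complex) powr (- s))"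
    using M by (intro sum.reindex_bij_witness[of _ "\<lambda>n. n - 1" Suc]) auto
  ultimately have "zeta_reg s / (s - 1) = (\<Sum>n=1..<M. of_nat n powr (- s)) + zeta_tail_series M s"
    by simp
  moreover have "zeta_reg s = (s - 1) * (zeta_reg s / (s - 1))"
    using s by auto
  ultimately show "zeta_reg s = (s - 1) * (\<Sum>n=1..<M. of_nat n powr (- s)) + zeta_tail M s"
    by (simp add: zeta_tail_eq_series[OF M s] algebra_simps)
qed auto

text \<open>The half-plane fixes the depth \<open>n\<close>; then \<open>M\<close> is taken so large
  that \<open>n * ln (M / (M - 1)) \<le> n / (M - 1) \<le> \<delta>\<close>. The finitely many terms
  split off are bounded on the half-plane.\<close>

lemma zeta_reg_bound:
  assumes \<delta>: "\<delta> > 0"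
  shows "\<exists>C\<ge>0. \<forall>s. Re s \<ge> - r \<longrightarrow> norm (zeta_reg s) \<le> C * (1 + norm s) * exp (\<delta> * \<bar>Im s\<bar>)"
proof -
  obtain n where n: "real n \<ge> max r 0 + 2" using real_arch_simple by blast
  obtain M where M: "real M \<ge> max 2 (real n / \<delta> + 1)" using real_arch_simple by blast
  have M2: "M \<ge> 2" using M by simp
  define q where "q = real M / real (M - 1)"
  have qpos: "q \<ge> 1" using M2 by (simp add: q_def)
  have "ln q \<le> q - 1" using qpos by (intro ln_le_minus_one) auto
  also have "q - 1 = 1 / (real M - 1)"
    using M2 by (simp add: q_def of_nat_diff field_simps)
  also have "\<dots> \<le> \<delta> / real n"
    using M n \<delta> by (simp add: field_simps)
  finally have "real n * ln q \<le> \<delta>"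
    using n by (simp add: field_simps)
  then have q: "q powr (real n * t) \<le> exp (\<delta> * t)" if "t \<ge> 0" for t
    using qpos that by (auto simp: powr_def mult_ac intro!: mult_left_mono) (metis mult.assoc mult.commute mult_left_mono)
  obtain C where C: "C \<ge> 0" and bd: "\<And>s. Re s \<ge> 2 - real n \<Longrightarrow> norm (zeta_tail M s)
        \<le> C * (1 + norm s) * real M powr (- Re s) * q powr (real n * \<bar>Im s\<bar>)"
    using zeta_tail_bound[OF M2, of n] unfolding q_def by blast
  define C' where "C' = (\<Sum>k=1..<M. real k powr r) + C * real M powr r"
  have C': "C' \<ge> 0" using C by (auto simp: C'_def intro!: add_nonneg_nonneg sum_nonneg)
  have "norm (zeta_reg s) \<le> C' * (1 + norm s) * exp (\<delta> * \<bar>Im s\<bar>)" if s: "Re s \<ge> - r" for s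
  proof -
    have "norm (\<Sum>k=1..<M. (of_nat k :: complex) powr (- s)) \<le> (\<Sum>k=1..<M. real k powr r)"
      using s by (intro sum_norm_le) (auto simp: norm_of_nat_powr intro!: powr_mono)
    then have "norm ((s - 1) * (\<Sum>k=1..<M. of_nat k powr (- s))) \<le> (1 + norm s) * (\<Sum>k=1..<M. real k powr r) * 1"
      unfolding norm_mult mult_1_right using norm_triangle_ineq4[of s 1] by (intro mult_mono) auto
    also have "\<dots> \<le> (1 + norm s) * (\<Sum>k=1..<M. real k powr r) * exp (\<delta> * \<bar>Im s\<bar>)"
      using \<delta> by (intro mult_left_mono mult_nonneg_nonneg sum_nonneg) auto
    finally have 1: "norm ((s - 1) * (\<Sum>k=1..<M. of_nat k powr (- s))) \<le> \<dots>" .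
    have "norm (zeta_tail M s) \<le> C * (1 + norm s) * real M powr (- Re s) * q powr (real n * \<bar>Im s\<bar>)"
      using n s by (intro bd) auto
    also have "\<dots> \<le> C * (1 + norm s) * real M powr r * exp (\<delta> * \<bar>Im s\<bar>)"
      using C M2 s by (intro mult_mono q mult_left_mono powr_mono) auto
    finally show ?thesis
      using 1 norm_triangle_ineq[of "(s - 1) * (\<Sum>k=1..<M. of_nat k powr (- s))" "zeta_tail M s"]
      unfolding zeta_reg_eq_zeta_tail[OF M2, of s] C'_def by (simp add: algebra_simps)
  qed
  with C' show ?thesis by blast
qed

section \<open>Growth of the coefficients\<close>

lemma sinh_real_le: "sinh x \<le> x * exp (x::real)"
proof -
  have "1 + (- 2 * x) \<le> exp (- 2 * x)" by (rule exp_ge_add_one_self)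
  then have "exp x * (1 - 2 * x) \<le> exp x * exp (- 2 * x)"
    by (intro mult_left_mono) auto
  also have "\<dots> = exp (- x)" by (simp flip: exp_add)
  finally show ?thesis by (simp add: sinh_def algebra_simps)
qed

text \<open>By Euler's product for the sine at an imaginary point, the partial products increase to
  \<open>sinh (pi * \<bar>t\<bar>) / (pi * \<bar>t\<bar>)\<close>.\<close>

lemma prod_one_plus_squares_le:
  fixes t :: real
  shows "(\<Prod>k=1..n. 1 + t\<^sup>2 / (real k)\<^sup>2) \<le> exp (pi * \<bar>t\<bar>)"
proof (cases "t = 0")
  case False
  define P where "P = (\<lambda>n. \<Prod>k=1..n. 1 + t\<^sup>2 / (real k)\<^sup>2)"
  have "(\<lambda>n. of_real pi * (\<i> * of_real \<bar>t\<bar>) * (\<Prod>k=1..n. 1 - (\<i> * of_real \<bar>t\<bar>)^2 / of_nat k^2))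
      \<longlonglongrightarrow> sin (of_real pi * (\<i> * of_real \<bar>t\<bar>))"
    by (rule sin_product_formula_complex)
  moreover have "(\<Prod>k=1..n. 1 - (\<i> * of_real \<bar>t\<bar>)^2 / of_nat k^2) = complex_of_real (P n)" for n
  proof -
    have "1 - (\<i> * of_real \<bar>t\<bar>)^2 / of_nat k^2 = complex_of_real (1 + t\<^sup>2 / (real k)\<^sup>2)" for k :: nat
    proof -
      have "(complex_of_real \<bar>t\<bar>)\<^sup>2 = (complex_of_real t)\<^sup>2"
        by (metis of_real_power power2_abs)
      then show ?thesis by (simp add: power_mult_distrib)
    qed
    then show ?thesis by (simp only: P_def of_real_prod)
  qed
  moreover have "sin (of_real pi * (\<i> * of_real \<bar>t\<bar>)) = \<i> * complex_of_real (sinh (pi * \<bar>t\<bar>))"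
  proof -
    have "\<i> * (of_real pi * (\<i> * of_real \<bar>t\<bar>)) = complex_of_real (- (pi * \<bar>t\<bar>))"
      by (simp add: algebra_simps)
    then have "sin (of_real pi * (\<i> * of_real \<bar>t\<bar>)) =
        (of_real (exp (- (pi * \<bar>t\<bar>))) - of_real (exp (pi * \<bar>t\<bar>))) / (2 * \<i>)"
      by (simp only: sin_exp_eq mult_minus_left exp_of_real flip: of_real_minus) simp
    moreover have "(x - y) / (2 * \<i>) = \<i> * ((y - x) / 2)" for x y :: complex
      by (simp add: field_simps)
    ultimately show ?thesis by (simp add: sinh_def)
  qed
  ultimately have "(\<lambda>n. of_real pi * (\<i> * of_real \<bar>t\<bar>) * complex_of_real (P n)) \<longlonglongrightarrow> \<i> * complex_of_real (sinh (pi * \<bar>t\<bar>))"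
    by simp
  then have "(\<lambda>n. Im (of_real pi * (\<i> * of_real \<bar>t\<bar>) * complex_of_real (P n))) \<longlonglongrightarrow> Im (\<i> * complex_of_real (sinh (pi * \<bar>t\<bar>)))"
    by (rule tendsto_Im)
  then have lim: "(\<lambda>n. pi * \<bar>t\<bar> * P n) \<longlonglongrightarrow> sinh (pi * \<bar>t\<bar>)"
    by simp
  have "incseq P"
  proof (rule incseq_SucI)
    fix n
    have "P n \<ge> 0" unfolding P_def by (intro prod_nonneg) auto
    then have "P n * 1 \<le> P n * (1 + t\<^sup>2 / (real (Suc n))\<^sup>2)" by (intro mult_left_mono) auto
    then show "P n \<le> P (Suc n)" by (simp add: P_def)
  qed
  then have "incseq (\<lambda>n. pi * \<bar>t\<bar> * P n)"
    by (auto simp: incseq_def intro!: mult_left_mono)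
  from incseq_le[OF this lim, of n] have "pi * \<bar>t\<bar> * P n \<le> pi * \<bar>t\<bar> * exp (pi * \<bar>t\<bar>)"
    using sinh_real_le[of "pi * \<bar>t\<bar>"] by linarith
  then show ?thesis using False by (simp add: P_def)
qed simp

lemma bernoulli_powr:
  fixes x y :: real
  assumes x: "x \<ge> 1" and y: "y \<ge> 0"
  shows "1 + x * y \<le> (1 + y) powr x"
proof -
  define f where "f = (\<lambda>y. (1 + y) powr x - (1 + x * y))"
  have "f 0 \<le> f y"
  proof (rule DERIV_nonneg_imp_nondecreasing[OF y])
    fix z assume z: "0 \<le> z" "z \<le> y"
    have "(f has_real_derivative (x * (1 + z) powr (x - 1) - x)) (at z)"
      unfolding f_def using z by (auto intro!: derivative_eq_intros simp: powr_diff field_simps)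
    moreover have "x * 1 \<le> x * (1 + z) powr (x - 1)"
      using x z by (intro mult_left_mono ge_one_powr_ge_zero) auto
    ultimately show "\<exists>d. (f has_real_derivative d) (at z) \<and> 0 \<le> d" by auto
  qed
  then show ?thesis by (simp add: f_def)
qed

text \<open>Consecutive values have ratio \<open>1 + (x - 1) / (j + 1)\<close>, at most
  \<open>(1 + 1 / (j + 1)) powr (x - 1)\<close> by Bernoulli, which asks for
  \<open>x - 1 \<ge> 1\<close>. The product of these bounds telescopes.\<close>

lemma pochhammer_over_fact_le:
  fixes x :: real
  assumes "x \<ge> 2"
  shows "pochhammer x j / fact j \<le> real (Suc j) powr (x - 1)"
proof (induction j)
  case (Suc j)
  have "pochhammer x (Suc j) / fact (Suc j) = (pochhammer x j / fact j) * (1 + (x - 1) * (1 / real (Suc j)))"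
    by (simp add: pochhammer_Suc field_simps)
  also have "\<dots> \<le> real (Suc j) powr (x - 1) * (1 + 1 / real (Suc j)) powr (x - 1)"
    using assms Suc by (intro mult_mono bernoulli_powr) (auto intro!: add_nonneg_nonneg)
  also have "\<dots> = (real (Suc j) * (1 + 1 / real (Suc j))) powr (x - 1)"
    by (subst powr_mult) auto
  also have "real (Suc j) * (1 + 1 / real (Suc j)) = real (Suc (Suc j))"
    by (simp add: field_simps)
  finally show ?case .
qed auto

text \<open>Squared, each factor is \<open>(Re a + i)\<^sup>2\<close> times
  \<open>1 + (Im a)\<^sup>2 / (Re a + i)\<^sup>2\<close>, and \<open>Re a \<ge> 1\<close> compares
  the latter with the sine product. The square root halves \<open>pi\<close>, so two Pochhammer
  symbols together have rate \<open>pi\<close>, well below \<open>2 * pi\<close>.\<close>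

lemma norm_pochhammer_le_exp:
  fixes a :: complex
  assumes a: "Re a \<ge> 1"
  shows "norm (pochhammer a j) \<le> pochhammer (Re a) j * exp (pi / 2 * \<bar>Im a\<bar>)"
proof -
  have "(norm (pochhammer a j))\<^sup>2 = (\<Prod>i<j. (norm (a + of_nat i))\<^sup>2)"
    by (simp only: pochhammer_prod prod_norm[symmetric] prod_power_distrib atLeast0LessThan)
  also have "\<dots> \<le> (\<Prod>i<j. (Re a + real i)\<^sup>2 * (1 + (Im a)\<^sup>2 / (real (Suc i))\<^sup>2))"
  proof (intro prod_mono conjI)
    fix i
    have "(Im a)\<^sup>2 / (Re a + real i)\<^sup>2 \<le> (Im a)\<^sup>2 / (real (Suc i))\<^sup>2"
      using a by (intro divide_left_mono power_mono) auto
    moreover have "(norm (a + of_nat i))\<^sup>2 = (Re a + real i)\<^sup>2 * (1 + (Im a)\<^sup>2 / (Re a + real i)\<^sup>2)"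
      using a by (simp add: cmod_power2 algebra_simps)
    ultimately show "(norm (a + of_nat i))\<^sup>2 \<le> (Re a + real i)\<^sup>2 * (1 + (Im a)\<^sup>2 / (real (Suc i))\<^sup>2)"
      by (simp add: mult_left_mono)
  qed auto
  also have "\<dots> = (pochhammer (Re a) j)\<^sup>2 * (\<Prod>k=1..j. 1 + (Im a)\<^sup>2 / (real k)\<^sup>2)"
  proof -
    have "(\<Prod>i<j. 1 + (Im a)\<^sup>2 / (real (Suc i))\<^sup>2) = (\<Prod>k=1..j. 1 + (Im a)\<^sup>2 / (real k)\<^sup>2)"
      by (rule prod.reindex_bij_witness[of _ "\<lambda>k. k - 1" Suc]) auto
    then show ?thesis
      by (simp add: prod.distrib pochhammer_prod prod_power_distrib atLeast0LessThan)
  qed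
  also have "\<dots> \<le> (pochhammer (Re a) j)\<^sup>2 * exp (pi * \<bar>Im a\<bar>)"
    by (intro mult_left_mono prod_one_plus_squares_le) auto
  also have "\<dots> = (pochhammer (Re a) j * exp (pi / 2 * \<bar>Im a\<bar>))\<^sup>2"
    by (simp add: power_mult_distrib flip: exp_double)
  finally show ?thesis
    by (rule power2_le_imp_le) (use a in \<open>auto intro!: mult_nonneg_nonneg pochhammer_nonneg_real\<close>)
qed

lemma powr_Suc_le:
  assumes x: "x \<ge> - real r"
  shows "real (Suc i) powr x \<le> 2 ^ r * real (Suc (Suc i)) powr x"
proof -
  have "real (Suc i) powr x = (real (Suc (Suc i)) / real (Suc i)) powr (- x) * real (Suc (Suc i)) powr x"
    by (simp add: powr_divide powr_minus field_simps)
  also have "\<dots> \<le> (2 ^ r) * real (Suc (Suc i)) powr x"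
  proof (intro mult_right_mono)
    have "(real (Suc (Suc i)) / real (Suc i)) powr (- x) \<le> (real (Suc (Suc i)) / real (Suc i)) powr real r"
      using x by (intro powr_mono) auto
    also have "\<dots> \<le> 2 powr real r"
      by (intro powr_mono2) (auto simp: field_simps)
    finally show "(real (Suc (Suc i)) / real (Suc i)) powr (- x) \<le> 2 ^ r"
      by (simp add: powr_realpow)
  qed auto
  finally show ?thesis .
qed

text \<open>\<open>(a)\<^sub>i\<^sub>+\<^sub>1 = a (a + 1)\<^sub>i\<close> moves the bound one unit
  to the left at the price of a factor \<open>1 + norm a\<close>; the exponential rate is
  unaffected.\<close>

lemma pochhammer_growth:
  "\<exists>C\<ge>1. \<forall>a j. Re a \<ge> 2 - real r \<longrightarrow> norm (pochhammer a j / fact j)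
     \<le> C * (1 + norm a) ^ r * exp (pi / 2 * \<bar>Im a\<bar>) * real (Suc j) powr (Re a - 1)"
proof (induction r)
  case 0
  have "norm (pochhammer a j / fact j) \<le> exp (pi / 2 * \<bar>Im a\<bar>) * real (Suc j) powr (Re a - 1)"
    if "Re a \<ge> 2" for a :: complex and j
  proof -
    have "norm (pochhammer a j / fact j) \<le> pochhammer (Re a) j * exp (pi / 2 * \<bar>Im a\<bar>) / fact j"
      unfolding norm_divide norm_fact using that by (intro divide_right_mono norm_pochhammer_le_exp) auto
    also have "\<dots> = exp (pi / 2 * \<bar>Im a\<bar>) * (pochhammer (Re a) j / fact j)" by simp
    also have "\<dots> \<le> exp (pi / 2 * \<bar>Im a\<bar>) * real (Suc j) powr (Re a - 1)"
      using that by (intro mult_left_mono pochhammer_over_fact_le) auto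
    finally show ?thesis .
  qed
  then show ?case by (intro exI[of _ 1]) auto
next
  case (Suc r)
  then obtain C where C: "C \<ge> 1" and bd: "\<And>a j. Re a \<ge> 2 - real r \<Longrightarrow> norm (pochhammer a j / fact j)
     \<le> C * (1 + norm a) ^ r * exp (pi / 2 * \<bar>Im a\<bar>) * real (Suc j) powr (Re a - 1)"
    by blast
  \<comment> \<open>One factor \<open>2 ^ r\<close> will come from
    \<open>1 + norm (a + 1) \<le> 2 * (1 + norm a)\<close>, the other from the shift of the index
    under the power.\<close>
  have C4: "C \<le> 4 ^ r * C" using C by simp
  then have C1: "1 \<le> 4 ^ r * C" using C by linarith
  have "norm (pochhammer a j / fact j)
     \<le> (4 ^ r * C) * (1 + norm a) ^ Suc r * exp (pi / 2 * \<bar>Im a\<bar>) * real (Suc j) powr (Re a - 1)"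
    if a: "Re a \<ge> 2 - real (Suc r)" for a j
  proof (cases "Re a \<ge> 2 - real r")
    case True
    have "norm (pochhammer a j / fact j)
     \<le> C * (1 + norm a) ^ r * exp (pi / 2 * \<bar>Im a\<bar>) * real (Suc j) powr (Re a - 1)"
      by (rule bd[OF True])
    also have "\<dots> \<le> (4 ^ r * C) * (1 + norm a) ^ Suc r * exp (pi / 2 * \<bar>Im a\<bar>) * real (Suc j) powr (Re a - 1)"
      using C C4 by (intro mult_right_mono mult_mono power_increasing) auto
    finally show ?thesis .
  next
    case False
    show ?thesis
    proof (cases j)
      case 0
      have "1 * 1 * 1 \<le> (4 ^ r * C) * (1 + norm a) ^ Suc r * exp (pi / 2 * \<bar>Im a\<bar>)"
        using C1 by (intro mult_mono one_le_power) auto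
      then show ?thesis using 0 by simp
    next
      case (Suc i)
      have "norm (pochhammer a j / fact j) = norm a / real (Suc i) * norm (pochhammer (a + 1) i / fact i)"
        unfolding Suc by (simp add: pochhammer_rec norm_mult norm_divide del: of_nat_Suc)
      also have "\<dots> \<le> norm a / real (Suc i) *
          (C * (1 + norm (a + 1)) ^ r * exp (pi / 2 * \<bar>Im (a + 1)\<bar>) * real (Suc i) powr (Re (a + 1) - 1))"
        using a by (intro mult_left_mono bd) auto
      also have "\<dots> = norm a * C * (1 + norm (a + 1)) ^ r * exp (pi / 2 * \<bar>Im a\<bar>) * real (Suc i) powr (Re a - 1)"
        by (simp add: powr_diff field_simps)
      also have "\<dots> \<le> (1 + norm a) * C * (2 ^ r * (1 + norm a) ^ r) * exp (pi / 2 * \<bar>Im a\<bar>) *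
          (2 ^ r * real (Suc j) powr (Re a - 1))"
      proof (intro mult_mono)
        show "real (Suc i) powr (Re a - 1) \<le> 2 ^ r * real (Suc j) powr (Re a - 1)"
          unfolding Suc by (rule powr_Suc_le) (use a in simp)
        have "norm (a + 1) \<le> norm a + 1"
          using norm_triangle_ineq[of a 1] by simp
        also have "1 + (norm a + 1) \<le> 2 * (1 + norm a)"
          by simp
        finally have "(1 + norm (a + 1)) ^ r \<le> (2 * (1 + norm a)) ^ r"
          by (intro power_mono) auto
        then show "(1 + norm (a + 1)) ^ r \<le> 2 ^ r * (1 + norm a) ^ r"
          by (simp only: power_mult_distrib)
      qed (use C a in auto)
      also have "\<dots> = (4 ^ r * C) * (1 + norm a) ^ Suc r * exp (pi / 2 * \<bar>Im a\<bar>) * real (Suc j) powr (Re a - 1)"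
      proof -
        have "(4::real) ^ r = 2 ^ r * 2 ^ r" by (simp flip: power_mult_distrib)
        then show ?thesis by simp
      qed
      finally show ?thesis .
    qed
  qed
  with C1 show ?case by blast
qed

section \<open>Taylor coefficients of the Hurwitz zeta function\<close>

lemma holomorphic_zeta_reg_compose:
  assumes "f holomorphic_on A"
  shows "(\<lambda>s. zeta_reg (f s)) holomorphic_on A"
  using holomorphic_on_compose[OF assms holomorphic_zeta_reg] by (simp add: o_def)

text \<open>The factor \<open>a + j - 1\<close> of \<open>(a)\<^sub>j\<close> is moved into
  \<open>zeta_reg (a + j)\<close>. For \<open>j \<ge> 1\<close> this makes the coefficient entire in
  \<open>a\<close>, with the limiting values at the non-positive integers built in.\<close>

definition zcoeff :: "complex \<Rightarrow> nat \<Rightarrow> complex" where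
  "zcoeff a j = (if j = 0 then zeta a else pochhammer a (j - 1) / fact j * zeta_reg (a + of_nat j))"

lemma zcoeff_0: "zcoeff a 0 = zeta a"
  and zcoeff_Suc: "zcoeff a (Suc j) = pochhammer a j / fact (Suc j) * zeta_reg (a + of_nat (Suc j))"
  by (simp_all add: zcoeff_def)

lemma poch_zeta_Suc_eq:
  assumes "z + of_nat (Suc j) \<noteq> 1"
  shows "pochhammer z (Suc j) * zeta (z + of_nat (Suc j)) = pochhammer z j * zeta_reg (z + of_nat (Suc j))"
proof -
  have "pochhammer z (Suc j) = pochhammer z j * (z + of_nat (Suc j) - 1)"
    by (simp add: pochhammer_Suc)
  then show ?thesis using assms by (simp add: zeta_eq)
qed

text \<open>For \<open>j \<ge> 1\<close> the product agrees off the single point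
  \<open>1 - j\<close> with an entire function, whose value is therefore the limit; for
  \<open>j = 0\<close> a non-positive integer avoids the pole.\<close>

lemma poch_zeta_eq: "poch_zeta a j = zcoeff a j * fact j"
proof (cases "a \<in> \<int>\<^sub>\<le>\<^sub>0")
  case True
  have "((\<lambda>z. pochhammer z j * zeta (z + of_nat j)) \<longlongrightarrow> zcoeff a j * fact j) (at a)"
  proof (cases j)
    case 0
    have "a \<noteq> 1" using True by auto
    then have "isCont zeta a"
      using holomorphic_zeta[of "- {1}"] continuous_on_interior[of "- {1}" zeta a]
      by (auto simp: interior_open open_Compl dest: holomorphic_on_imp_continuous_on)
    then show ?thesis using 0 by (simp add: zcoeff_def isCont_def)
  next
    case (Suc i)
    have "continuous_on UNIV (\<lambda>z. pochhammer z i * zeta_reg (z + of_nat (Suc i)))"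
      by (intro holomorphic_on_imp_continuous_on holomorphic_intros holomorphic_zeta_reg_compose)
    then have "((\<lambda>z. pochhammer z i * zeta_reg (z + of_nat (Suc i)))
        \<longlongrightarrow> pochhammer a i * zeta_reg (a + of_nat (Suc i))) (at a)"
      by (simp add: continuous_on_eq_continuous_at isCont_def)
    moreover have "\<forall>\<^sub>F z in at a. pochhammer z i * zeta_reg (z + of_nat (Suc i))
        = pochhammer z (Suc i) * zeta (z + of_nat (Suc i))"
    proof -
      have "\<forall>\<^sub>F z in at a. z \<noteq> 1 - of_nat (Suc i)"
        by (rule eventually_neq_at_within)
      then show ?thesis
        by eventually_elim (rule poch_zeta_Suc_eq[symmetric], metis add_diff_cancel_right')
    qed
    ultimately have "((\<lambda>z. pochhammer z (Suc i) * zeta (z + of_nat (Suc i)))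
        \<longlongrightarrow> pochhammer a i * zeta_reg (a + of_nat (Suc i))) (at a)"
      by (rule Lim_transform_eventually)
    then show ?thesis unfolding Suc zcoeff_Suc by (simp del: fact_Suc of_nat_Suc)
  qed
  then have "Lim (at a) (\<lambda>z. pochhammer z j * zeta (z + of_nat j)) = zcoeff a j * fact j"
    by (intro tendsto_Lim) auto
  then show ?thesis using True by (simp add: poch_zeta_def)
next
  case False
  show ?thesis
  proof (cases j)
    case (Suc i)
    have "a + of_nat (Suc i) \<noteq> 1"
    proof
      assume "a + of_nat (Suc i) = 1"
      then have "a = - of_nat i" by (simp add: algebra_simps eq_neg_iff_add_eq_0)
      with False show False by simp
    qed
    then show ?thesis
      unfolding Suc zcoeff_Suc using False poch_zeta_Suc_eq[of a i]
      by (simp add: poch_zeta_def del: fact_Suc of_nat_Suc)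
  qed (use False in \<open>simp add: poch_zeta_def zcoeff_def\<close>)
qed

lemma S2_term_eq: "S2_term a b j k = zcoeff a j * zcoeff b k / of_nat (Suc (j + k))"
  by (simp add: S2_term_def poch_zeta_eq)

lemma holomorphic_zcoeff:
  assumes "1 \<notin> A"
  shows "(\<lambda>a. zcoeff a j) holomorphic_on A"
proof (cases j)
  case 0
  then show ?thesis using holomorphic_zeta[OF assms] by (simp add: zcoeff_def)
next
  case (Suc i)
  then show ?thesis
    unfolding Suc zcoeff_Suc by (intro holomorphic_intros holomorphic_zeta_reg_compose) auto
qed

text \<open>The coefficient form of \<open>d/dx \<zeta>(a, 1 - x) = a \<zeta>(a + 1, 1 - x)\<close>.
  At \<open>a = 0\<close> it fails for \<open>j = 0\<close>: \<open>zcoeff 0 1\<close> is 1, while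
  the right side would contain the conventional value \<open>zeta 1 = 0\<close>.\<close>

lemma zcoeff_shift:
  assumes "a \<noteq> 0"
  shows "of_nat (Suc j) * zcoeff a (Suc j) = a * zcoeff (a + 1) j"
proof (cases j)
  case 0
  have "zcoeff a (Suc 0) = zeta_reg (a + 1)"
    by (simp add: zcoeff_def)
  also have "\<dots> = a * zeta (a + 1)"
    using assms by (subst zeta_eq) auto
  finally show ?thesis
    using 0 by (simp add: zcoeff_0)
next
  case (Suc i)
  have "(of_nat (Suc j) :: complex) \<noteq> 0"
    by (simp only: of_nat_eq_0_iff)
  then have "of_nat (Suc j) * zcoeff a (Suc j) = pochhammer a j / fact j * zeta_reg (a + of_nat (Suc j))"
    unfolding zcoeff_Suc fact_Suc by (simp del: of_nat_Suc)
  also have "\<dots> = a * zcoeff (a + 1) j"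
  proof -
    have "a + of_nat (Suc (Suc i)) = a + 1 + of_nat (Suc i)"
      by simp
    then show ?thesis
      unfolding Suc zcoeff_Suc pochhammer_rec[of a i] by (simp only: times_divide_eq_right times_divide_eq_left mult.assoc)
  qed
  finally show ?thesis .
qed

lemma power_le_fact_exp:
  fixes x :: real
  assumes x: "x \<ge> 0"
  shows "x ^ p \<le> fact p * exp x"
proof -
  have s: "(\<lambda>n. x ^ n /\<^sub>R fact n) sums exp x" by (rule exp_converges)
  have "(\<Sum>n\<in>{p}. x ^ n /\<^sub>R fact n) \<le> (\<Sum>n. x ^ n /\<^sub>R fact n)"
    by (rule sum_le_suminf) (use s x in \<open>auto simp: sums_iff\<close>)
  then have "x ^ p / fact p \<le> exp x" using s by (simp add: sums_iff divide_inverse mult.commute)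
  then show ?thesis by (simp add: pos_divide_le_eq mult.commute)
qed

lemma exp_absorbs_power:
  fixes A :: real
  assumes A: "A \<ge> 0"
  shows "\<exists>K\<ge>0. \<forall>t\<ge>0. (A + t) ^ p \<le> K * exp (t / 2)"
proof -
  have "(A + t) ^ p \<le> (2 ^ p * fact p * exp (A / 2)) * exp (t / 2)" if t: "t \<ge> 0" for t
  proof -
    have "(A + t) ^ p = 2 ^ p * ((A + t) / 2) ^ p"
      by (simp add: power_divide)
    also have "\<dots> \<le> 2 ^ p * (fact p * exp ((A + t) / 2))"
      using A t by (intro mult_left_mono power_le_fact_exp) auto
    also have "exp ((A + t) / 2) = exp (A / 2) * exp (t / 2)"
      by (simp add: add_divide_distrib exp_add)
    finally show ?thesis by (simp only: mult.assoc)
  qed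
  then show ?thesis
    by (intro exI[of _ "2 ^ p * fact p * exp (A / 2)"]) simp
qed

text \<open>The rate 3 collects \<open>pi / 2 < 2\<close> from the Pochhammer symbol,
  \<open>1 / 2\<close> from \<open>zeta_reg\<close> and \<open>1 / 2\<close> for the powers of
  \<open>1 + norm a\<close>. The linear growth of \<open>zeta_reg (a + of_nat j)\<close> in
  \<open>j\<close> is cancelled by the extra \<open>1 / j\<close> in the factorial;
  \<open>d < 1\<close> keeps \<open>zeta a\<close> away from its pole.\<close>

lemma zcoeff_bound:
  assumes d: "d < 1"
  shows "\<exists>C\<ge>0. \<forall>a j. - real r \<le> Re a \<longrightarrow> Re a \<le> d \<longrightarrow>
     norm (zcoeff a j) \<le> C * exp (3 * \<bar>Im a\<bar>) * real (Suc j) powr (Re a - 1)"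
proof -
  obtain C1 where C1: "C1 \<ge> 0" and Z: "\<And>s. Re s \<ge> - real r \<Longrightarrow>
      norm (zeta_reg s) \<le> C1 * (1 + norm s) * exp (1 / 2 * \<bar>Im s\<bar>)"
    using zeta_reg_bound[of "1 / 2" "real r"] by auto
  \<comment> \<open>Then \<open>2 - real p = - real r\<close>, the left edge of the strip.\<close>
  define p where "p = r + 2"
  obtain C2 where C2: "C2 \<ge> 1" and P: "\<And>a j. Re a \<ge> 2 - real p \<Longrightarrow> norm (pochhammer a j / fact j)
     \<le> C2 * (1 + norm a) ^ p * exp (pi / 2 * \<bar>Im a\<bar>) * real (Suc j) powr (Re a - 1)"
    using pochhammer_growth[of p] by blast
  define A where "A = 2 + real r"
  obtain K where K: "K \<ge> 0" and abs: "\<And>t. t \<ge> 0 \<Longrightarrow> (A + t) ^ (p + 1) \<le> K * exp (t / 2)"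
    using exp_absorbs_power[of A "p + 1"] by (auto simp: A_def)
  have abs': "(1 + norm a) ^ (p + 1) \<le> K * exp (\<bar>Im a\<bar> / 2)" if "- real r \<le> Re a" "Re a \<le> d" for a
  proof -
    have "norm a \<le> \<bar>Re a\<bar> + \<bar>Im a\<bar>" by (rule cmod_le)
    then have "1 + norm a \<le> A + \<bar>Im a\<bar>" using that d unfolding A_def by linarith
    then have "(1 + norm a) ^ (p + 1) \<le> (A + \<bar>Im a\<bar>) ^ (p + 1)" by (intro power_mono) auto
    also have "\<dots> \<le> K * exp (\<bar>Im a\<bar> / 2)" by (rule abs) simp
    finally show ?thesis .
  qed
  have pi: "exp (pi / 2 * t) * exp (1 / 2 * t) * exp (t / 2) \<le> exp (3 * t)" if "t \<ge> 0" for t :: real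
  proof -
    have "pi / 2 * t \<le> 2 * t" using that pi_less_4 by (intro mult_right_mono) auto
    then have "pi / 2 * t + 1 / 2 * t + t / 2 \<le> 3 * t" using that by linarith
    then show ?thesis by (simp flip: exp_add)
  qed
  define C where "C = C1 * K / (1 - d) + 2 ^ (r + 1) * (2 * C1 * C2 * K)"
  have nn: "C1 * K / (1 - d) \<ge> 0" "2 ^ (r + 1) * (2 * C1 * C2 * K) \<ge> 0"
    using C1 K C2 d by auto
  have "norm (zcoeff a j) \<le> C * exp (3 * \<bar>Im a\<bar>) * real (Suc j) powr (Re a - 1)"
    if a: "- real r \<le> Re a" "Re a \<le> d" for a j
  proof (cases j)
    case 0
    have "1 - d \<le> norm (a - 1)"
      using a abs_Re_le_cmod[of "a - 1"] by simp
    have "norm (zcoeff a j) = norm (zeta_reg a) / norm (a - 1)"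
      using a d 0 by (subst 0, subst zcoeff_0, subst zeta_eq) (auto simp: norm_divide)
    also have "\<dots> \<le> (C1 * (1 + norm a) * exp (1 / 2 * \<bar>Im a\<bar>)) / (1 - d)"
      using Z[OF a(1)] \<open>1 - d \<le> norm (a - 1)\<close> d C1 by (intro frac_le) auto
    also have "\<dots> \<le> (C1 * (K * exp (\<bar>Im a\<bar> / 2)) * exp (1 / 2 * \<bar>Im a\<bar>)) / (1 - d)"
    proof -
      have "(1 + norm a) ^ 1 \<le> (1 + norm a) ^ (p + 1)" by (rule power_increasing) auto
      then have "1 + norm a \<le> K * exp (\<bar>Im a\<bar> / 2)" using abs'[OF a] by simp
      then show ?thesis using C1 d by (intro divide_right_mono mult_right_mono mult_left_mono) auto
    qed
    also have "\<dots> = C1 * K / (1 - d) * (1 * exp (1 / 2 * \<bar>Im a\<bar>) * exp (\<bar>Im a\<bar> / 2))" by simp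
    also have "\<dots> \<le> C1 * K / (1 - d) * (exp (pi / 2 * \<bar>Im a\<bar>) * exp (1 / 2 * \<bar>Im a\<bar>) * exp (\<bar>Im a\<bar> / 2))"
      using nn by (intro mult_left_mono mult_right_mono) auto
    also have "\<dots> \<le> C * exp (3 * \<bar>Im a\<bar>)"
      using nn pi[of "\<bar>Im a\<bar>"] by (intro mult_mono) (auto simp: C_def)
    finally show ?thesis using 0 by simp
  next
    case (Suc i)
    have "norm (zcoeff a j) = norm (pochhammer a i / fact i) * (norm (zeta_reg (a + of_nat (Suc i))) / real (Suc i))"
      unfolding Suc zcoeff_Suc by (simp add: norm_mult norm_divide del: of_nat_Suc)
    also have "\<dots> \<le> (C2 * (1 + norm a) ^ p * exp (pi / 2 * \<bar>Im a\<bar>) * real (Suc i) powr (Re a - 1)) *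
        (2 * C1 * (1 + norm a) * exp (1 / 2 * \<bar>Im a\<bar>))"
    proof (intro mult_mono P)
      have "norm (zeta_reg (a + of_nat (Suc i))) \<le> C1 * (1 + norm (a + of_nat (Suc i))) * exp (1 / 2 * \<bar>Im a\<bar>)"
        using Z[of "a + of_nat (Suc i)"] a by simp
      also have "\<dots> \<le> C1 * (2 * (1 + norm a) * real (Suc i)) * exp (1 / 2 * \<bar>Im a\<bar>)"
      proof (intro mult_right_mono mult_left_mono C1)
        have "norm (a + of_nat (Suc i)) \<le> norm a + real (Suc i)"
          by (metis norm_of_nat norm_triangle_ineq)
        also have "1 + (norm a + real (Suc i)) \<le> 2 * (1 + norm a) * real (Suc i)"
          by (simp add: algebra_simps)
        finally show "1 + norm (a + of_nat (Suc i)) \<le> 2 * (1 + norm a) * real (Suc i)" by simp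
      qed auto
      finally show "norm (zeta_reg (a + of_nat (Suc i))) / real (Suc i) \<le> 2 * C1 * (1 + norm a) * exp (1 / 2 * \<bar>Im a\<bar>)"
        by (simp add: pos_divide_le_eq mult_ac del: of_nat_Suc)
    qed (use a C2 in \<open>auto simp: p_def\<close>)
    also have "\<dots> = (2 * C1 * C2) * (exp (pi / 2 * \<bar>Im a\<bar>) * exp (1 / 2 * \<bar>Im a\<bar>)) * (1 + norm a) ^ (p + 1) * real (Suc i) powr (Re a - 1)"
      by simp
    also have "\<dots> \<le> (2 * C1 * C2) * (exp (pi / 2 * \<bar>Im a\<bar>) * exp (1 / 2 * \<bar>Im a\<bar>)) * (K * exp (\<bar>Im a\<bar> / 2)) *
        (2 ^ (r + 1) * real (Suc j) powr (Re a - 1))"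
      using C1 C2 K a unfolding Suc
      by (intro mult_mono abs'[OF a] powr_Suc_le) auto
    also have "\<dots> = (2 ^ (r + 1) * (2 * C1 * C2 * K)) * (exp (pi / 2 * \<bar>Im a\<bar>) * exp (1 / 2 * \<bar>Im a\<bar>) * exp (\<bar>Im a\<bar> / 2)) *
        real (Suc j) powr (Re a - 1)"
      by simp
    also have "\<dots> \<le> C * exp (3 * \<bar>Im a\<bar>) * real (Suc j) powr (Re a - 1)"
      using nn pi[of "\<bar>Im a\<bar>"] by (intro mult_right_mono mult_mono) (auto simp: C_def)
    finally show ?thesis .
  qed
  moreover have "C \<ge> 0" using nn by (simp add: C_def)
  ultimately show ?thesis by blast
qed

section \<open>The double series\<close>

lemma tendsto_Suc_powr_neg:
  assumes "x < 0"
  shows "(\<lambda>n. real (Suc n) powr x) \<longlonglongrightarrow> 0"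
  using assms
  by (intro LIMSEQ_Suc[where f = "\<lambda>n. real n powr x"] tendsto_neg_powr filterlim_real_sequentially)

lemma summable_Suc_powr:
  assumes "x < - 1"
  shows "summable (\<lambda>n. real (Suc n) powr x)"
  using summable_shifted_powr[of "- x" 1] assms by simp

text \<open>The binomial series at the boundary point 1. Its partial sums have the closed form
  \<open>(s + 1)\<^sub>n / n! - 1\<close>, and the quotient is of order at most
  \<open>n powr Re s\<close>.\<close>

lemma sums_pochhammer_boundary:
  fixes s :: complex
  assumes s: "Re s < 0"
  shows "(\<lambda>j. pochhammer s (Suc j) / fact (Suc j)) sums (- 1)"
proof -
  have partial: "(\<Sum>j<n. pochhammer s (Suc j) / fact (Suc j)) = pochhammer (s + 1) n / fact n - 1" for n
  proof (induction n)
    case (Suc n)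
    have "pochhammer (s + 1) n / fact n + pochhammer s (Suc n) / fact (Suc n) = pochhammer (s + 1) (Suc n) / fact (Suc n)"
    proof -
      define X where "X = pochhammer (s + 1) n"
      have "(of_nat (Suc n) :: complex) \<noteq> 0" by (simp only: of_nat_eq_0_iff)
      then have "X / F + s * X / (of_nat (Suc n) * F) = X * (s + 1 + of_nat n) / (of_nat (Suc n) * F)" if "F \<noteq> 0" for F
        using that by (simp add: divide_simps) (simp add: algebra_simps)
      from this[of "fact n"] show ?thesis
        unfolding pochhammer_rec[of s n] pochhammer_Suc[of "s + 1" n] fact_Suc X_def by simp
    qed
    then show ?case using Suc by simp
  qed simp
  obtain r where r: "real r \<ge> 2 - Re (s + 1)" using real_arch_simple by blast
  obtain C where C: "\<And>a j. Re a \<ge> 2 - real r \<Longrightarrow> norm (pochhammer a j / fact j)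
     \<le> C * (1 + norm a) ^ r * exp (pi / 2 * \<bar>Im a\<bar>) * real (Suc j) powr (Re a - 1)"
    using pochhammer_growth by blast
  have "(\<lambda>n. pochhammer (s + 1) n / fact n) \<longlonglongrightarrow> 0"
  proof (rule Lim_null_comparison)
    show "\<forall>\<^sub>F n in sequentially. norm (pochhammer (s + 1) n / fact n) \<le>
       C * (1 + norm (s + 1)) ^ r * exp (pi / 2 * \<bar>Im (s + 1)\<bar>) * real (Suc n) powr (Re (s + 1) - 1)"
      using r by (intro always_eventually allI C) simp
    show "(\<lambda>n. C * (1 + norm (s + 1)) ^ r * exp (pi / 2 * \<bar>Im (s + 1)\<bar>) * real (Suc n) powr (Re (s + 1) - 1)) \<longlonglongrightarrow> 0"
      by (intro tendsto_mult_right_zero tendsto_Suc_powr_neg) (use s in simp)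
  qed
  from tendsto_diff[OF this tendsto_const[of 1]] show ?thesis
    unfolding sums_def partial by simp
qed

lemma summable_norm_zcoeff:
  assumes s: "Re s < 0"
  shows "summable (\<lambda>j. norm (zcoeff s j))"
proof -
  obtain r where r: "real r \<ge> - Re s" using real_arch_simple by blast
  obtain C where C: "\<And>a j. - real r \<le> Re a \<Longrightarrow> Re a \<le> 0 \<Longrightarrow>
     norm (zcoeff a j) \<le> C * exp (3 * \<bar>Im a\<bar>) * real (Suc j) powr (Re a - 1)"
    using zcoeff_bound[of 0 r] by auto
  show ?thesis
  proof (rule summable_comparison_test')
    show "summable (\<lambda>j. C * exp (3 * \<bar>Im s\<bar>) * real (Suc j) powr (Re s - 1))"
      by (intro summable_mult summable_Suc_powr) (use s in simp)
    show "norm (norm (zcoeff s j)) \<le> C * exp (3 * \<bar>Im s\<bar>) * real (Suc j) powr (Re s - 1)" for j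
      using C[of s j] r s by simp
  qed
qed

text \<open>Within \<open>zeta_reg\<close> the summand \<open>s - 1\<close> contributes the boundary
  value \<open>- 1\<close> of the binomial series, and the tail contributes \<open>1\<close> by its
  functional relation. In Hurwitz terms: \<open>\<zeta>(s, 0) = \<zeta>(s, 1)\<close>.\<close>

lemma sums_zcoeff_Suc:
  assumes s: "Re s < 0"
  shows "(\<lambda>j. zcoeff s (Suc j)) sums 0"
proof -
  have "(\<lambda>j. pochhammer s (Suc j) / fact (Suc j) + pochhammer s j / fact (Suc j) * zeta_tail 2 (s + of_nat (Suc j))) sums (- 1 + of_nat (2 - 1) powr (- s))"
    by (intro sums_add sums_pochhammer_boundary[OF s] zeta_tail_functional) simp
  moreover have "pochhammer s (Suc j) / fact (Suc j) + pochhammer s j / fact (Suc j) * zeta_tail 2 (s + of_nat (Suc j)) = zcoeff s (Suc j)" for j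
  proof -
    have "x * y / F + x / F * W = x / F * (y + W)" for x y F W :: complex
      by (simp add: distrib_left)
    moreover have "s + of_nat (Suc j) - 1 = s + of_nat j" by simp
    ultimately show ?thesis
      unfolding zcoeff_Suc zeta_reg_def pochhammer_Suc[of s j] by (simp only:)
  qed
  ultimately show ?thesis by simp
qed

lemma sums_zcoeff:
  assumes "Re s < 0"
  shows "zcoeff s sums zeta s"
  using sums_Suc[OF sums_zcoeff_Suc[OF assms]] by (simp add: zcoeff_0)

text \<open>The mean of \<open>\<zeta>(b, 1 - x)\<close> over \<open>[0, 1]\<close>: the total
  increment of its antiderivative, which belongs to \<open>b - 1\<close> and has equal values at
  both ends.\<close>

lemma sums_zcoeff_mean:
  assumes b: "Re b < 1"
  shows "(\<lambda>k. zcoeff b k / of_nat (Suc k)) sums 0"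
proof -
  have nz: "b - 1 \<noteq> 0" using b by auto
  have "(\<lambda>k. 1 / (b - 1) * zcoeff (b - 1) (Suc k)) sums (1 / (b - 1) * 0)"
    using b by (intro sums_mult sums_zcoeff_Suc) simp
  moreover have "1 / (b - 1) * zcoeff (b - 1) (Suc k) = zcoeff b k / of_nat (Suc k)" for k
    using zcoeff_shift[OF nz, of k] nz by (simp add: field_simps del: of_nat_Suc)
  ultimately show ?thesis by simp
qed

text \<open>The first moment of \<open>\<zeta>(b, 1 - x)\<close>, by parts: with
  \<open>c = b - 1\<close>, the splitting \<open>(k + 1) / (k + 2) = 1 - 1 / (k + 2)\<close> reduces
  it to the two preceding sums for \<open>c\<close>.\<close>

lemma sums_zcoeff_moment:
  assumes b: "Re b < 1"
  shows "(\<lambda>k. zcoeff b k / of_nat (Suc (Suc k))) sums (zeta (b - 1) / (b - 1))"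
proof -
  define c where "c = b - 1"
  have nz: "c \<noteq> 0" and c: "Re c < 0" using b by (auto simp: c_def)
  have "(\<lambda>k. zcoeff c k / of_nat (Suc k)) sums 0"
    using c by (intro sums_zcoeff_mean) simp
  then have "(\<lambda>k. zcoeff c (Suc k) / of_nat (Suc (Suc k))) sums (- zeta c)"
    by (subst sums_Suc_iff) (simp add: zcoeff_0)
  then have "(\<lambda>k. 1 / c * (zcoeff c (Suc k) - zcoeff c (Suc k) / of_nat (Suc (Suc k)))) sums (1 / c * (0 - (- zeta c)))"
    by (intro sums_mult sums_diff sums_zcoeff_Suc c)
  moreover have "1 / c * (zcoeff c (Suc k) - zcoeff c (Suc k) / of_nat (Suc (Suc k))) = zcoeff b k / of_nat (Suc (Suc k))" for k
  proof -
    have "x - x / of_nat (Suc (Suc k)) = of_nat (Suc k) * x / (of_nat (Suc (Suc k)) :: complex)" for x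
    proof -
      have "(of_nat (Suc (Suc k)) :: complex) = of_nat (Suc k) + 1" by simp
      moreover have "(of_nat (Suc (Suc k)) :: complex) \<noteq> 0" by (simp only: of_nat_eq_0_iff)
      ultimately show ?thesis by (simp add: field_simps del: of_nat_Suc)
    qed
    from this[of "zcoeff c (Suc k)"] have "zcoeff c (Suc k) - zcoeff c (Suc k) / of_nat (Suc (Suc k)) = c * zcoeff b k / of_nat (Suc (Suc k))"
      using zcoeff_shift[OF nz, of k] by (simp add: c_def del: of_nat_Suc)
    then show ?thesis using nz by simp
  qed
  ultimately show ?thesis by (simp add: c_def del: of_nat_Suc)
qed

section \<open>Absolute convergence and holomorphy of the double series\<close>

lemma powr_interpolation_le:
  assumes "0 \<le> \<theta>" "\<theta> \<le> 1"
  shows "real (Suc j) powr \<theta> * real (Suc k) powr (1 - \<theta>) \<le> real (Suc (j + k))"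
proof -
  have "real (Suc j) powr \<theta> * real (Suc k) powr (1 - \<theta>) \<le> real (Suc (j + k)) powr \<theta> * real (Suc (j + k)) powr (1 - \<theta>)"
    using assms by (intro mult_mono powr_mono2) auto
  also have "\<dots> = real (Suc (j + k))" by (simp flip: powr_add)
  finally show ?thesis .
qed

lemma norm_S2_term_le:
  assumes \<theta>: "0 \<le> \<theta>" "\<theta> \<le> 1"
    and a: "norm (zcoeff a j) \<le> A * real (Suc j) powr x"
    and b: "norm (zcoeff b k) \<le> B * real (Suc k) powr y"
  shows "norm (S2_term a b j k) \<le> (A * real (Suc j) powr (x - \<theta>)) * (B * real (Suc k) powr (y - (1 - \<theta>)))"
proof -
  have A: "A * real (Suc j) powr x \<ge> 0" using a norm_ge_zero order_trans by blast
  have B: "B * real (Suc k) powr y \<ge> 0" using b norm_ge_zero order_trans by blast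
  have "norm (S2_term a b j k) = norm (zcoeff a j) * norm (zcoeff b k) / real (Suc (j + k))"
    unfolding S2_term_eq norm_divide norm_mult norm_of_nat ..
  also have "\<dots> \<le> (A * real (Suc j) powr x) * (B * real (Suc k) powr y) / (real (Suc j) powr \<theta> * real (Suc k) powr (1 - \<theta>))"
    using A B by (intro frac_le mult_mono a b powr_interpolation_le \<theta>) auto
  also have "\<dots> = (A * real (Suc j) powr (x - \<theta>)) * (B * real (Suc k) powr (y - (1 - \<theta>)))"
    unfolding powr_diff by simp
  finally show ?thesis .
qed

text \<open>The condition for a weight \<open>\<theta>\<close> in \<open>[0, 1]\<close> with
  \<open>Re a < \<theta> < 1 - Re b\<close> to exist. Bounding \<open>j + k + 1\<close> below by
  \<open>(j + 1) powr \<theta> * (k + 1) powr (1 - \<theta>)\<close> then leaves both exponents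
  below \<open>- 1\<close>.\<close>

definition S2_domain :: "complex \<Rightarrow> complex \<Rightarrow> bool" where
  "S2_domain a b \<longleftrightarrow> Re a < 1 \<and> Re b < 1 \<and> Re a + Re b < 1"

lemma S2_term_local_bound:
  assumes "S2_domain a0 b0"
  obtains \<rho> C \<eta> where "\<rho> > 0" "C \<ge> 0" "\<eta> > 0"
    "\<And>a b j k. a \<in> cball a0 \<rho> \<Longrightarrow> b \<in> cball b0 \<rho> \<Longrightarrow>
       norm (S2_term a b j k) \<le> (C * real (Suc j) powr (- 1 - \<eta>)) * (C * real (Suc k) powr (- 1 - \<eta>))"
proof -
  define lo hi where "lo = max (Re a0) 0" and "hi = min (1 - Re b0) 1"
  have "lo < hi" using assms by (auto simp: lo_def hi_def S2_domain_def)
  \<comment> \<open>The midpoint of the admissible interval and a quarter of its length. On either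
    side one \<open>\<eta>\<close> pays for moving \<open>a\<close> and \<open>b\<close> within the
    ball, the other is the gain in the exponent \<open>- 1 - \<eta>\<close>.\<close>
  define \<theta> \<eta> where "\<theta> = (lo + hi) / 2" and "\<eta> = (hi - lo) / 4"
  have \<eta>: "\<eta> > 0" using \<open>lo < hi\<close> by (simp add: \<eta>_def)
  have th: "\<theta> = lo + 2 * \<eta>" "\<theta> = hi - 2 * \<eta>" by (auto simp: \<theta>_def \<eta>_def field_simps)
  have lo: "lo \<ge> Re a0" "lo \<ge> 0" and hi: "hi \<le> 1 - Re b0" "hi \<le> 1" by (auto simp: lo_def hi_def)
  have \<theta>: "0 \<le> \<theta>" "\<theta> \<le> 1" using th lo hi \<eta> by linarith+
  obtain r where r: "real r \<ge> max (\<eta> - Re a0) (\<eta> - Re b0)" using real_arch_simple by blast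
  obtain C where C: "C \<ge> 0" and bd: "\<And>a j. - real r \<le> Re a \<Longrightarrow> Re a \<le> 1 - \<eta> \<Longrightarrow>
     norm (zcoeff a j) \<le> C * exp (3 * \<bar>Im a\<bar>) * real (Suc j) powr (Re a - 1)"
    using zcoeff_bound[of "1 - \<eta>" r] \<eta> by auto
  define T where "T = norm a0 + norm b0 + \<eta>"
  define C' where "C' = C * exp (3 * T)"
  have bd': "norm (zcoeff a j) \<le> C' * real (Suc j) powr (x - 1)"
    if "- real r \<le> Re a" "Re a \<le> 1 - \<eta>" "\<bar>Im a\<bar> \<le> T" "Re a \<le> x" for a j x
  proof -
    have "norm (zcoeff a j) \<le> C * exp (3 * \<bar>Im a\<bar>) * real (Suc j) powr (Re a - 1)"
      by (rule bd[OF that(1,2)])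
    also have "\<dots> \<le> C * exp (3 * T) * real (Suc j) powr (x - 1)"
      using that C by (intro mult_mono mult_left_mono powr_mono) auto
    finally show ?thesis by (simp add: C'_def)
  qed
  have near: "Re z \<le> Re z0 + \<eta>" "Re z \<ge> Re z0 - \<eta>" "\<bar>Im z\<bar> \<le> norm z0 + \<eta>" if "z \<in> cball z0 \<eta>" for z z0 :: complex
  proof -
    have n: "norm (z - z0) \<le> \<eta>" using that by (simp add: dist_norm norm_minus_commute)
    then show "Re z \<le> Re z0 + \<eta>" "Re z \<ge> Re z0 - \<eta>"
      using abs_Re_le_cmod[of "z - z0"] by auto
    show "\<bar>Im z\<bar> \<le> norm z0 + \<eta>"
      using n abs_Im_le_cmod[of "z - z0"] abs_Im_le_cmod[of z0] by simp
  qed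
  show thesis
  proof (rule that)
    show "\<eta> > 0" by (rule \<eta>)
    then show "\<eta> > 0" .
    show "C' \<ge> 0" using C by (simp add: C'_def)
    fix a b j k assume a: "a \<in> cball a0 \<eta>" and b: "b \<in> cball b0 \<eta>"
    have e: "(\<theta> - \<eta>) - 1 - \<theta> = - 1 - \<eta>" "(1 - \<theta> - \<eta>) - 1 - (1 - \<theta>) = - 1 - \<eta>"
      by simp_all
    have "norm (zcoeff a j) \<le> C' * real (Suc j) powr ((\<theta> - \<eta>) - 1)"
      using near[OF a] r th lo hi \<eta> by (intro bd') (auto simp: T_def intro: order_trans[OF near(3)[OF a]])
    moreover have "norm (zcoeff b k) \<le> C' * real (Suc k) powr ((1 - \<theta> - \<eta>) - 1)"
      using near[OF b] r th lo hi \<eta> by (intro bd') (auto simp: T_def intro: order_trans[OF near(3)[OF b]])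
    ultimately have "norm (S2_term a b j k) \<le>
        (C' * real (Suc j) powr ((\<theta> - \<eta>) - 1 - \<theta>)) * (C' * real (Suc k) powr ((1 - \<theta> - \<eta>) - 1 - (1 - \<theta>)))"
      by (rule norm_S2_term_le[OF \<theta>])
    then show "norm (S2_term a b j k) \<le> (C' * real (Suc j) powr (- 1 - \<eta>)) * (C' * real (Suc k) powr (- 1 - \<eta>))"
      by (simp only: e)
  qed
qed

lemma S2_product_bounded:
  assumes "\<eta> > 0" "C \<ge> 0"
    and "\<And>j k. norm (S2_term a b j k) \<le> (C * real (Suc j) powr (- 1 - \<eta>)) * (C * real (Suc k) powr (- 1 - \<eta>))"
  shows "product_bounded_double_series (S2_term a b) (\<lambda>j. C * real (Suc j) powr (- 1 - \<eta>)) (\<lambda>j. C * real (Suc j) powr (- 1 - \<eta>))"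
  using assms by unfold_locales (auto intro!: summable_mult summable_Suc_powr simp del: of_nat_Suc)

lemma S2_product_bounded_ex:
  assumes "S2_domain a b"
  shows "\<exists>u v. product_bounded_double_series (S2_term a b) u v"
proof -
  obtain \<rho> C \<eta> where *: "\<rho> > 0" "C \<ge> 0" "\<eta> > 0"
    "\<And>x y j k. x \<in> cball a \<rho> \<Longrightarrow> y \<in> cball b \<rho> \<Longrightarrow>
       norm (S2_term x y j k) \<le> (C * real (Suc j) powr (- 1 - \<eta>)) * (C * real (Suc k) powr (- 1 - \<eta>))"
    using S2_term_local_bound[OF assms] by blast
  have "norm (S2_term a b j k) \<le> (C * real (Suc j) powr (- 1 - \<eta>)) * (C * real (Suc k) powr (- 1 - \<eta>))" for j k
    using *(1) by (intro *(4)) auto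
  from S2_product_bounded[OF *(3,2) this] show ?thesis by blast
qed

lemma S2_convergent_domain:
  assumes "S2_domain a b"
  shows "S2_convergent a b"
proof -
  obtain u v where "product_bounded_double_series (S2_term a b) u v"
    using S2_product_bounded_ex[OF assms] by blast
  then interpret product_bounded_double_series "S2_term a b" u v .
  show ?thesis
    unfolding S2_convergent_def using summable_inner summable_outer by simp
qed

lemma S2_term_commute: "S2_term a b j k = S2_term b a k j"
  by (simp add: S2_term_eq add.commute mult.commute)

lemma S2_commute:
  assumes "S2_domain a b"
  shows "S2 a b = S2 b a"
proof -
  obtain u v where "product_bounded_double_series (S2_term a b) u v"
    using S2_product_bounded_ex[OF assms] by blast
  then interpret product_bounded_double_series "S2_term a b" u v .
  show ?thesis
    unfolding S2_def suminf_swap by (subst S2_term_commute) (rule refl)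
qed

lemma S2_has_sum:
  assumes "S2_domain a b"
  shows "((\<lambda>(j,k). S2_term a b j k) has_sum S2 a b) UNIV"
proof -
  obtain u v where "product_bounded_double_series (S2_term a b) u v"
    using S2_product_bounded_ex[OF assms] by blast
  then interpret product_bounded_double_series "S2_term a b" u v .
  show ?thesis unfolding S2_def by (rule has_sum)
qed

lemma S2_locally_bounded:
  assumes "S2_domain a0 b0"
  obtains \<rho> B where "\<rho> > 0" "\<And>a b. a \<in> cball a0 \<rho> \<Longrightarrow> b \<in> cball b0 \<rho> \<Longrightarrow> norm (S2 a b) \<le> B"
proof -
  obtain \<rho> C \<eta> where *: "\<rho> > 0" "C \<ge> 0" "\<eta> > 0"
    "\<And>x y j k. x \<in> cball a0 \<rho> \<Longrightarrow> y \<in> cball b0 \<rho> \<Longrightarrow>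
       norm (S2_term x y j k) \<le> (C * real (Suc j) powr (- 1 - \<eta>)) * (C * real (Suc k) powr (- 1 - \<eta>))"
    using S2_term_local_bound[OF assms] by blast
  show thesis
  proof (rule that[OF *(1)])
    fix a b assume "a \<in> cball a0 \<rho>" "b \<in> cball b0 \<rho>"
    then interpret product_bounded_double_series "S2_term a b"
      "\<lambda>j. C * real (Suc j) powr (- 1 - \<eta>)" "\<lambda>j. C * real (Suc j) powr (- 1 - \<eta>)"
      by (intro S2_product_bounded *)
    show "norm (S2 a b) \<le> (\<Sum>j. C * real (Suc j) powr (- 1 - \<eta>)) * (\<Sum>j. C * real (Suc j) powr (- 1 - \<eta>))"
      unfolding S2_def by (rule norm_le)
  qed
qed

text \<open>Two holomorphic arguments cover both the line \<open>b = - N - a\<close> and the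
  restrictions to one variable. The local product majorant serves the inner and the outer series
  alike.\<close>

lemma holomorphic_S2:
  assumes U: "open U" and hol: "\<phi> holomorphic_on U" "\<psi> holomorphic_on U"
    and dom: "\<And>z. z \<in> U \<Longrightarrow> S2_domain (\<phi> z) (\<psi> z)"
  shows "(\<lambda>z. S2 (\<phi> z) (\<psi> z)) holomorphic_on U"
proof -
  have loc: "\<exists>d>0. \<exists>C\<ge>0. \<exists>\<eta>>0. cball x d \<subseteq> U \<and> (\<forall>z\<in>cball x d. \<forall>j k. norm (S2_term (\<phi> z) (\<psi> z) j k)
      \<le> (C * real (Suc j) powr (- 1 - \<eta>)) * (C * real (Suc k) powr (- 1 - \<eta>)))" if x: "x \<in> U" for x
  proof -
    obtain \<rho> C \<eta> where *: "\<rho> > 0" "C \<ge> 0" "\<eta> > 0"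
      "\<And>a b j k. a \<in> cball (\<phi> x) \<rho> \<Longrightarrow> b \<in> cball (\<psi> x) \<rho> \<Longrightarrow>
         norm (S2_term a b j k) \<le> (C * real (Suc j) powr (- 1 - \<eta>)) * (C * real (Suc k) powr (- 1 - \<eta>))"
      using S2_term_local_bound[OF dom[OF x]] by blast
    have "isCont \<phi> x" "isCont \<psi> x"
      using hol U x holomorphic_on_imp_continuous_on continuous_on_eq_continuous_at by blast+
    then obtain d1 d2 where d: "d1 > 0" "\<And>z. dist z x < d1 \<Longrightarrow> dist (\<phi> z) (\<phi> x) < \<rho>"
       "d2 > 0" "\<And>z. dist z x < d2 \<Longrightarrow> dist (\<psi> z) (\<psi> x) < \<rho>"
      using *(1) unfolding continuous_at_eps_delta by metis
    obtain d3 where d3: "d3 > 0" "cball x d3 \<subseteq> U"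
      using U x open_contains_cball by blast
    define d where "d = min (min (d1 / 2) (d2 / 2)) d3"
    have "d > 0" using d d3 by (simp add: d_def)
    moreover have "cball x d \<subseteq> U" using d3 by (auto simp: d_def)
    moreover have "norm (S2_term (\<phi> z) (\<psi> z) j k)
      \<le> (C * real (Suc j) powr (- 1 - \<eta>)) * (C * real (Suc k) powr (- 1 - \<eta>))" if "z \<in> cball x d" for z j k
    proof (rule *(4))
      have "dist z x \<le> d" using that by (simp add: dist_commute)
      moreover have "d < d1" "d < d2" using d by (auto simp: d_def)
      ultimately have "dist z x < d1" "dist z x < d2" by auto
      from d(2)[OF this(1)] d(4)[OF this(2)]
      show "\<phi> z \<in> cball (\<phi> x) \<rho>" "\<psi> z \<in> cball (\<psi> x) \<rho>" by (auto simp: dist_commute)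
    qed
    ultimately show ?thesis using *(2,3) by blast
  qed
  have sm: "summable (\<lambda>n. C * real (Suc n) powr (- 1 - \<eta>))" if "\<eta> > 0" for C \<eta>
    using that by (intro summable_mult summable_Suc_powr) auto
  have inner: "(\<lambda>z. \<Sum>k. S2_term (\<phi> z) (\<psi> z) j k) holomorphic_on U" for j
  proof (rule holomorphic_on_suminf[OF U])
    fix k
    have 1: "1 \<notin> \<phi> ` U" "1 \<notin> \<psi> ` U" using dom by (force simp: S2_domain_def)+
    have "((\<lambda>a. zcoeff a j) \<circ> \<phi>) holomorphic_on U" "((\<lambda>a. zcoeff a k) \<circ> \<psi>) holomorphic_on U"
      by (intro holomorphic_on_compose holomorphic_zcoeff 1 hol)+
    then show "(\<lambda>z. S2_term (\<phi> z) (\<psi> z) j k) holomorphic_on U"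
      unfolding S2_term_eq o_def by (intro holomorphic_intros) (auto simp del: of_nat_Suc)
  next
    fix x assume "x \<in> U"
    from loc[OF this] obtain d C \<eta> where l: "d > 0" "C \<ge> 0" "\<eta> > 0" "cball x d \<subseteq> U"
      "\<And>z j k. z \<in> cball x d \<Longrightarrow> norm (S2_term (\<phi> z) (\<psi> z) j k)
      \<le> (C * real (Suc j) powr (- 1 - \<eta>)) * (C * real (Suc k) powr (- 1 - \<eta>))"
      by blast
    show "\<exists>d>0. \<exists>M. cball x d \<subseteq> U \<and> summable M \<and> (\<forall>n. \<forall>z\<in>cball x d. norm (S2_term (\<phi> z) (\<psi> z) j n) \<le> M n)"
      by (rule exI[of _ d], intro conjI exI[of _ "\<lambda>k. (C * real (Suc j) powr (- 1 - \<eta>)) * (C * real (Suc k) powr (- 1 - \<eta>))"]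
           allI ballI l summable_mult[OF sm])
  qed
  have "(\<lambda>z. \<Sum>j. \<Sum>k. S2_term (\<phi> z) (\<psi> z) j k) holomorphic_on U"
  proof (rule holomorphic_on_suminf[OF U inner])
    fix x assume "x \<in> U"
    from loc[OF this] obtain d C \<eta> where l: "d > 0" "C \<ge> 0" "\<eta> > 0" "cball x d \<subseteq> U"
      "\<And>z j k. z \<in> cball x d \<Longrightarrow> norm (S2_term (\<phi> z) (\<psi> z) j k)
      \<le> (C * real (Suc j) powr (- 1 - \<eta>)) * (C * real (Suc k) powr (- 1 - \<eta>))"
      by blast
    let ?u = "\<lambda>j. C * real (Suc j) powr (- 1 - \<eta>)"
    have "norm (\<Sum>k. S2_term (\<phi> z) (\<psi> z) j k) \<le> ?u j * suminf ?u" if "z \<in> cball x d" for z j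
    proof -
      interpret product_bounded_double_series "S2_term (\<phi> z) (\<psi> z)" ?u ?u
        by (intro S2_product_bounded l that)
      show ?thesis by (rule norm_inner_le)
    qed
    then show "\<exists>d>0. \<exists>M. cball x d \<subseteq> U \<and> summable M \<and> (\<forall>j. \<forall>z\<in>cball x d. norm (\<Sum>k. S2_term (\<phi> z) (\<psi> z) j k) \<le> M j)"
      by (intro exI[of _ d] conjI exI[of _ "\<lambda>j. ?u j * suminf ?u"] allI ballI l summable_mult2[OF sm])
  qed
  then show ?thesis by (simp add: S2_def)
qed

text \<open>With \<open>p = zcoeff a\<close> and \<open>q = zcoeff b\<close>, the two terms are the double sums of
  \<open>j p\<^sub>j q\<^sub>k / (j + k)\<close> and \<open>k p\<^sub>j q\<^sub>k / (j + k)\<close> over \<open>(j, k) \<noteq> (0, 0)\<close>; they add up to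
  the product of the two simple series without its first term, which is zero. (For the Hurwitz
  zeta function this is integration by parts.)\<close>

lemma S2_recurrence:
  assumes a: "Re a < 0" and b: "Re b < 0"
  shows "a * S2 (a + 1) b + b * S2 a (b + 1) = 0"
proof -
  define p where "p = zcoeff a"
  define q where "q = zcoeff b"
  define F where "F = (\<lambda>(j,k). of_nat j * (p j * q k) / of_nat (j + k))"
  define G where "G = (\<lambda>(j,k). of_nat k * (p j * q k) / of_nat (j + k))"
  define H where "H = (\<lambda>(j,k). p j * q k)"
  have nz: "a \<noteq> 0" "b \<noteq> 0" using a b by auto
  have dom: "S2_domain (a + 1) b" "S2_domain a (b + 1)"
    using a b by (auto simp: S2_domain_def)
  have F: "(F has_sum (a * S2 (a + 1) b)) UNIV"
  proof -
    have "((\<lambda>x. a * (case x of (j,k) \<Rightarrow> S2_term (a + 1) b j k)) has_sum (a * S2 (a + 1) b)) UNIV"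
      by (intro has_sum_cmult_right S2_has_sum dom)
    also have "(\<lambda>x. a * (case x of (j,k) \<Rightarrow> S2_term (a + 1) b j k)) = F \<circ> map_prod Suc id"
    proof
      fix x :: "nat \<times> nat"
      obtain j k where x: "x = (j, k)" by (cases x)
      have "a * (zcoeff (a + 1) j * zcoeff b k) = of_nat (Suc j) * (zcoeff a (Suc j) * zcoeff b k)"
        using zcoeff_shift[OF nz(1), of j] by (metis mult.assoc)
      then show "a * (case x of (j,k) \<Rightarrow> S2_term (a + 1) b j k) = (F \<circ> map_prod Suc id) x"
        by (simp add: x F_def p_def q_def S2_term_eq del: of_nat_Suc of_nat_add)
    qed
    finally have "(F has_sum (a * S2 (a + 1) b)) (range (map_prod Suc id))"
      by (subst has_sum_reindex) (auto simp: inj_on_def o_def)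
    also have "?this \<longleftrightarrow> ?thesis"
    proof (rule has_sum_cong_neutral)
      fix x assume "x \<in> UNIV - range (map_prod Suc id :: nat \<times> nat \<Rightarrow> nat \<times> nat)"
      moreover have "(Suc i, k) = map_prod Suc id (i, k)" for i k :: nat by simp
      ultimately have "fst x = 0"
        by (cases x, cases "fst x") (metis DiffD2 fst_conv rangeI)+
      then show "F x = 0" by (cases x) (simp add: F_def)
    qed auto
    finally show ?thesis .
  qed
  have G: "(G has_sum (b * S2 a (b + 1))) UNIV"
  proof -
    have "((\<lambda>x. b * (case x of (j,k) \<Rightarrow> S2_term a (b + 1) j k)) has_sum (b * S2 a (b + 1))) UNIV"
      by (intro has_sum_cmult_right S2_has_sum dom)
    also have "(\<lambda>x. b * (case x of (j,k) \<Rightarrow> S2_term a (b + 1) j k)) = G \<circ> map_prod id Suc"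
    proof
      fix x :: "nat \<times> nat"
      obtain j k where x: "x = (j, k)" by (cases x)
      have "b * (zcoeff a j * zcoeff (b + 1) k) = of_nat (Suc k) * (zcoeff a j * zcoeff b (Suc k))"
        using zcoeff_shift[OF nz(2), of k] by (metis mult.left_commute)
      then show "b * (case x of (j,k) \<Rightarrow> S2_term a (b + 1) j k) = (G \<circ> map_prod id Suc) x"
        by (simp add: x G_def p_def q_def S2_term_eq del: of_nat_Suc of_nat_add)
    qed
    finally have "(G has_sum (b * S2 a (b + 1))) (range (map_prod id Suc))"
      by (subst has_sum_reindex) (auto simp: inj_on_def o_def)
    also have "?this \<longleftrightarrow> ?thesis"
    proof (rule has_sum_cong_neutral)
      fix x assume "x \<in> UNIV - range (map_prod id Suc :: nat \<times> nat \<Rightarrow> nat \<times> nat)"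
      moreover have "(i, Suc k) = map_prod id Suc (i, k)" for i k :: nat by simp
      ultimately have "snd x = 0"
        by (cases x, cases "snd x") (metis DiffD2 snd_conv rangeI)+
      then show "G x = 0" by (cases x) (simp add: G_def)
    qed auto
    finally show ?thesis .
  qed
  have H: "(H has_sum (zeta a * zeta b)) UNIV"
  proof -
    interpret product_bounded_double_series "\<lambda>j k. p j * q k" "\<lambda>j. norm (p j)" "\<lambda>k. norm (q k)"
      by unfold_locales (auto simp: norm_mult p_def q_def intro!: summable_norm_zcoeff a b)
    have "(\<Sum>j. \<Sum>k. p j * q k) = (\<Sum>j. p j * zeta b)"
      using sums_zcoeff[OF b] by (simp add: q_def suminf_mult sums_iff)
    also have "\<dots> = zeta a * zeta b"
      using sums_zcoeff[OF a] by (simp add: p_def suminf_mult2[symmetric] sums_iff)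
    finally show ?thesis using has_sum by (simp add: H_def)
  qed
  \<comment> \<open>\<open>F\<close> and \<open>G\<close> are 0 at the origin, where their
    denominator is 0, so the term \<open>p 0 * q 0\<close> of \<open>H\<close> is restored
    separately. It equals \<open>zeta a * zeta b\<close>, which is also the full sum of
    \<open>H\<close>.\<close>
  have "((\<lambda>x. if x = (0, 0) then p 0 * q 0 else 0) has_sum (p 0 * q 0)) {(0::nat, 0::nat)}"
    by (rule has_sum_finiteI) auto
  then have "((\<lambda>x. if x = (0, 0) then p 0 * q 0 else 0) has_sum (p 0 * q 0)) (UNIV :: (nat \<times> nat) set)"
    by (rule has_sum_cong_neutral[THEN iffD1, rotated -1]) auto
  from has_sum_add[OF has_sum_add[OF F G] this]
  have "((\<lambda>x. F x + G x + (if x = (0, 0) then p 0 * q 0 else 0))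
      has_sum (a * S2 (a + 1) b + b * S2 a (b + 1) + zeta a * zeta b)) UNIV"
    by (simp add: p_def q_def zcoeff_0)
  also have "(\<lambda>x. F x + G x + (if x = (0, 0) then p 0 * q 0 else 0)) = H"
  proof
    fix x :: "nat \<times> nat"
    obtain j k where x: "x = (j, k)" by (cases x)
    show "F x + G x + (if x = (0, 0) then p 0 * q 0 else 0) = H x"
    proof (cases "j + k = 0")
      case False
      then have "(of_nat j + of_nat k :: complex) \<noteq> 0"
        by (metis of_nat_0_eq_iff of_nat_add)
      then show ?thesis using False
        by (auto simp: x F_def G_def H_def simp flip: add_divide_distrib distrib_right)
    qed (simp add: x F_def G_def H_def)
  qed
  finally show ?thesis
    using has_sum_unique[OF H] by fastforce
qed

text \<open>\<open>\<zeta>(0, 1 - x) = \<zeta>(0) + x\<close> is a polynomial: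
  \<open>(0)\<^sub>j\<close> removes \<open>j \<ge> 2\<close>, and the limiting convention gives the
  coefficient \<open>zeta_reg 1 = 1\<close> at \<open>j = 1\<close>. The constant part meets the
  vanishing mean; the first moment remains.\<close>

lemma S2_zero_left:
  assumes b: "Re b < 1"
  shows "S2 0 b = zeta (b - 1) / (b - 1)"
proof -
  have c: "zcoeff 0 j = 0" if "j \<notin> {0, Suc 0}" for j
    using that by (cases j) (auto simp: zcoeff_Suc pochhammer_0_left)
  have "S2 0 b = (\<Sum>j\<in>{0, Suc 0}. \<Sum>k. S2_term 0 b j k)"
    unfolding S2_def
  proof (rule suminf_finite)
    fix j :: nat assume "j \<notin> {0, Suc 0}"
    then have "S2_term 0 b j k = 0" for k by (simp add: S2_term_eq c)
    then show "(\<Sum>k. S2_term 0 b j k) = 0" by simp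
  qed simp
  also have "\<dots> = (\<Sum>k. zeta 0 * (zcoeff b k / of_nat (Suc k))) + (\<Sum>k. zcoeff b k / of_nat (Suc (Suc k)))"
    by (simp add: S2_term_eq zcoeff_0 zcoeff_Suc zeta_reg_one)
  also have "(\<Sum>k. zeta 0 * (zcoeff b k / of_nat (Suc k))) = 0"
    using sums_mult[OF sums_zcoeff_mean[OF b], of "zeta 0"] by (simp add: sums_iff)
  also have "(\<Sum>k. zcoeff b k / of_nat (Suc (Suc k))) = zeta (b - 1) / (b - 1)"
    using sums_zcoeff_moment[OF b] by (simp only: sums_iff)
  finally show ?thesis by simp
qed

section \<open>Periodic functions of small exponential growth\<close>

text \<open>Liouville leaves a polynomial of degree at most 1, whose slope must vanish by comparison
  along the positive integers.\<close>

lemma entire_sublinear_constant: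
  fixes Q :: "complex \<Rightarrow> complex"
  assumes hol: "Q holomorphic_on UNIV" and \<gamma>: "\<gamma> < 1"
    and bound: "\<And>z. norm z \<ge> R \<Longrightarrow> norm (Q z) \<le> C * norm z powr \<gamma>"
  shows "Q z = Q 0"
proof -
  define a where "a = deriv Q 0"
  have eq: "Q z = Q 0 + a * z" for z
  proof -
    have "Q z = (\<Sum>k\<le>1. (deriv ^^ k) Q 0 / fact k * z ^ k)"
    proof (rule Liouville_polynomial[OF hol])
      fix z :: complex assume z: "max R 1 \<le> norm z"
      then have C: "C \<ge> 0"
      proof -
        have "0 \<le> C * norm z powr \<gamma>"
          by (rule order_trans[OF norm_ge_zero bound]) (use z in simp)
        moreover have "norm z > 0" using z by linarith
        then have "norm z powr \<gamma> > 0" by simp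
        ultimately show ?thesis by (simp only: zero_le_mult_iff) linarith
      qed
      have "norm (Q z) \<le> C * norm z powr \<gamma>" using z by (intro bound) simp
      also have "\<dots> \<le> C * norm z powr 1" using C z \<gamma> by (intro mult_left_mono powr_mono) auto
      finally show "norm (Q z) \<le> C * norm z ^ 1" using z by simp
    qed
    then show ?thesis by (simp add: a_def)
  qed
  have "norm a \<le> 0"
  proof (rule LIMSEQ_le_const)
    have "(\<lambda>n. C * real n powr (\<gamma> - 1) + norm (Q 0) * real n powr (- 1)) \<longlonglongrightarrow> C * 0 + norm (Q 0) * 0"
      by (intro tendsto_add tendsto_mult_left tendsto_neg_powr filterlim_real_sequentially) (use \<gamma> in simp_all)
    then show "(\<lambda>n. C * real n powr (\<gamma> - 1) + norm (Q 0) * real n powr (- 1)) \<longlonglongrightarrow> 0" by simp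
    obtain n0 where n0: "real n0 \<ge> max R 1" using real_arch_simple by blast
    have "norm a \<le> C * real n powr (\<gamma> - 1) + norm (Q 0) * real n powr (- 1)" if "n \<ge> n0" for n
    proof -
      have n: "real n \<ge> R" "real n \<ge> 1" using that n0 by linarith+
      have "norm a * real n = norm (Q (of_nat n) - Q 0)" by (simp add: eq[of "of_nat n"] norm_mult)
      also have "\<dots> \<le> C * real n powr \<gamma> + norm (Q 0)"
        using norm_triangle_ineq4[of "Q (of_nat n)" "Q 0"] bound[of "of_nat n"] n by simp
      finally have "norm a \<le> (C * real n powr \<gamma> + norm (Q 0)) / real n"
        using n by (simp add: pos_le_divide_eq)
      then show ?thesis using n by (simp add: powr_diff powr_minus divide_inverse distrib_right mult.assoc)
    qed
    then show "\<exists>n0. \<forall>n\<ge>n0. norm a \<le> C * real n powr (\<gamma> - 1) + norm (Q 0) * real n powr (- 1)" by blast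
  qed
  then show ?thesis using eq[of z] by simp
qed

text \<open>In the variable \<open>q = exp(2 \<pi> \<i> z)\<close> the growth becomes
  \<open>norm q\<close> to the power \<open>- \<gamma>\<close> near 0 and \<open>\<gamma>\<close>
  near infinity, with \<open>\<gamma> = c / (2 \<pi>) < 1\<close>. So the singularity at 0 is
  removable and the extension is sublinear. The strip is twice as wide as the period to leave room
  for branches of the logarithm.\<close>

lemma periodic_strip_constant:
  fixes K :: "complex \<Rightarrow> complex"
  assumes hol: "K holomorphic_on {z. \<bar>Re z\<bar> < 1}"
    and per: "\<And>z. 0 < Re z \<Longrightarrow> Re z < 1 \<Longrightarrow> K z = K (z - 1)"
    and c: "c < 2 * pi"
    and growth: "\<And>z. \<bar>Re z\<bar> \<le> 1 / 2 \<Longrightarrow> \<bar>Im z\<bar> \<ge> 1 \<Longrightarrow> norm (K z) \<le> C * exp (c * \<bar>Im z\<bar>)"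
  shows "\<exists>B. \<forall>z. \<bar>Re z\<bar> < 1 \<longrightarrow> K z = B"
proof -
  define e where "e = complex_of_real (2 * pi) * \<i>"
  have e: "e \<noteq> 0" by (simp add: e_def)
  define P where "P = (\<lambda>q. K (Ln q / e))"
  have div_e: "Re (z / e) = Im z / (2 * pi)" "Im (z / e) = - Re z / (2 * pi)" for z
  proof -
    have "z / e = - \<i> * z / of_real (2 * pi)" by (simp add: e_def field_simps)
    then show "Re (z / e) = Im z / (2 * pi)" "Im (z / e) = - Re z / (2 * pi)"
      by (simp_all only: Re_divide_of_real Im_divide_of_real) simp_all
  qed
  have Ln_strip: "- 1 / 2 < Re (Ln q / e)" "Re (Ln q / e) \<le> 1 / 2" if "q \<noteq> 0" for q
    using mpi_less_Im_Ln[OF that] Im_Ln_le_pi[OF that] unfolding div_e by (simp_all add: field_simps)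
  have Ln_Im: "Im (Ln q / e) = - ln (norm q) / (2 * pi)" if "q \<noteq> 0" for q
    using that unfolding div_e by (simp add: Re_Ln)
  \<comment> \<open>One point lies in the fundamental strip and the other in the strip of width 2,
    so they differ by 0, 1 or -1 and periodicity is applied at most once.\<close>
  have same: "K w = K h" if w: "- 1 / 2 < Re w" "Re w \<le> 1 / 2" and h: "\<bar>Re h\<bar> < 1" and eq: "exp (e * w) = exp (e * h)" for w h
  proof -
    obtain n :: int where n: "e * w = e * h + of_int (2 * n) * of_real pi * \<i>"
      using eq unfolding exp_eq by auto
    then have "e * w = e * (h + of_int n)" by (simp add: e_def algebra_simps)
    then have wh: "w = h + of_int n" using e by simp
    then have "Re w = Re h + real_of_int n" by simp
    then have "real_of_int n < 2" "real_of_int n > - 2" using w h by linarith+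
    then have "n < 2" "n > - 2" by linarith+
    then consider "n = 0" | "n = 1" | "n = - 1" by linarith
    then show ?thesis
    proof cases
      case 2
      then show ?thesis using per[of w] wh w h by simp
    next
      case 3
      then show ?thesis using per[of h] wh w h by simp
    qed (use wh in simp)
  qed
  have "P analytic_on - {0}"
    unfolding analytic_on_def
  proof
    fix q0 :: complex assume "q0 \<in> - {0}"
    then have q0: "q0 \<noteq> 0" by simp
    \<comment> \<open>\<open>Ln\<close> jumps across the negative axis. Near \<open>q0\<close> this
      branch is holomorphic and stays in the wide strip, and by periodicity \<open>K\<close> takes
      the same values along either branch.\<close>
    define h where "h = (\<lambda>q. (Ln (q / q0) + Ln q0) / e)"
    have half: "q / q0 \<notin> \<real>\<^sub>\<le>\<^sub>0" if "q \<in> ball q0 (norm q0)" for q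
    proof
      assume "q / q0 \<in> \<real>\<^sub>\<le>\<^sub>0"
      then have "Re (q / q0) \<le> 0" by (auto simp: complex_nonpos_Reals_iff)
      have "norm (1 - q / q0) = norm (q0 - q) / norm q0"
        using q0 by (simp add: norm_divide[symmetric] diff_divide_distrib)
      also have "\<dots> < 1" using that q0 by (simp add: dist_norm)
      finally have "norm (1 - q / q0) < 1" .
      then have "Re (1 - q / q0) < 1" using complex_Re_le_cmod order.strict_trans1 by blast
      with \<open>Re (q / q0) \<le> 0\<close> show False by simp
    qed
    have hol_h: "h holomorphic_on ball q0 (norm q0)"
      unfolding h_def using half q0 e by (intro holomorphic_intros) auto
    have "isCont h q0"
      using holomorphic_on_imp_continuous_on[OF hol_h] q0 by (simp add: continuous_on_eq_continuous_at)
    then obtain d where d: "d > 0" "\<And>q. dist q q0 < d \<Longrightarrow> dist (h q) (h q0) < 1 / 4"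
      unfolding continuous_at_eps_delta by (elim allE[of _ "1 / 4"]) auto
    define r where "r = min d (norm q0)"
    have r: "r > 0" using d q0 by (simp add: r_def)
    have h_strip: "\<bar>Re (h q)\<bar> < 1" if "q \<in> ball q0 r" for q
    proof -
      have "norm (h q - h q0) < 1 / 4"
        using that d(2)[of q] by (simp add: r_def dist_norm norm_minus_commute)
      then have "\<bar>Re (h q) - Re (h q0)\<bar> < 1 / 4"
        using abs_Re_le_cmod[of "h q - h q0"] by simp
      moreover have "h q0 = Ln q0 / e" using q0 by (simp add: h_def)
      ultimately have "\<bar>Re (h q) - Re (Ln q0 / e)\<bar> < 1 / 4" by simp
      then show ?thesis using Ln_strip[OF q0] by linarith
    qed
    have "(K \<circ> h) holomorphic_on ball q0 r"
      by (rule holomorphic_on_compose_gen[OF _ hol])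
         (use h_strip in \<open>auto intro!: holomorphic_on_subset[OF hol_h] simp: r_def\<close>)
    moreover have "(K \<circ> h) q = P q" if q: "q \<in> ball q0 r" for q
    proof -
      have nz: "q \<noteq> 0" using q by (auto simp: r_def)
      have "exp (e * (Ln q / e)) = q" using nz e by simp
      moreover have "exp (e * h q) = q" using nz q0 e by (simp add: h_def exp_add)
      ultimately show ?thesis
        unfolding P_def o_def using nz by (intro same[symmetric] Ln_strip h_strip q) simp_all
    qed
    ultimately have "P holomorphic_on ball q0 r" by (rule holomorphic_transform)
    with r show "\<exists>r>0. P holomorphic_on ball q0 r" by blast
  qed
  then have hol_P: "P holomorphic_on UNIV - {0}"
    by (simp add: analytic_imp_holomorphic Compl_eq_Diff_UNIV)
  define \<gamma> where "\<gamma> = c / (2 * pi)"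
  have \<gamma>: "\<gamma> < 1" using c by (simp add: \<gamma>_def)
  \<comment> \<open>\<open>\<bar>Im z\<bar> \<ge> 1\<close> becomes
    \<open>\<bar>ln (norm q)\<bar> \<ge> 2 * pi\<close>; hence the radii
    \<open>exp (- 2 * pi)\<close> and \<open>exp (2 * pi)\<close> below.\<close>
  have P_bound: "norm (P q) \<le> C * exp (\<gamma> * \<bar>ln (norm q)\<bar>)" if q: "q \<noteq> 0" "\<bar>ln (norm q)\<bar> \<ge> 2 * pi" for q
  proof -
    have im: "\<bar>Im (Ln q / e)\<bar> = \<bar>ln (norm q)\<bar> / (2 * pi)" unfolding Ln_Im[OF q(1)] by simp
    have "norm (P q) \<le> C * exp (c * \<bar>Im (Ln q / e)\<bar>)"
      unfolding P_def
    proof (rule growth)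
      show "\<bar>Re (Ln q / e)\<bar> \<le> 1 / 2" using Ln_strip[OF q(1)] by linarith
      show "\<bar>Im (Ln q / e)\<bar> \<ge> 1" unfolding im using q(2) by (simp add: field_simps)
    qed
    then show ?thesis unfolding im by (simp add: \<gamma>_def)
  qed
  have "\<exists>Q. Q holomorphic_on UNIV \<and> (\<forall>z\<in>UNIV - {0}. Q z = P z)"
  proof (subst holomorphic_on_extend_lim[OF hol_P])
    show "((\<lambda>z. (z - 0) * P z) \<longlongrightarrow> 0) (at 0)"
    proof (rule Lim_null_comparison)
      show "((\<lambda>z. C * norm z powr (1 - \<gamma>)) \<longlongrightarrow> 0) (at (0::complex))"
        using \<gamma> by (auto intro!: tendsto_eq_intros)
      have "\<forall>\<^sub>F z in at (0::complex). norm z < exp (- 2 * pi)"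
        by (rule eventually_at_to_0[THEN iffD2]) (auto simp: eventually_at intro!: exI[of _ "exp (- 2 * pi)"])
      moreover have "\<forall>\<^sub>F z in at (0::complex). z \<noteq> 0" by (rule eventually_neq_at_within)
      ultimately show "\<forall>\<^sub>F z in at 0. norm ((z - 0) * P z) \<le> C * norm z powr (1 - \<gamma>)"
      proof eventually_elim
        case (elim z)
        then have "ln (norm z) < - 2 * pi" using ln_less_cancel_iff[of "norm z" "exp (- 2 * pi)"] by simp
        then have abs: "\<bar>ln (norm z)\<bar> = - ln (norm z)" "\<bar>ln (norm z)\<bar> \<ge> 2 * pi"
      using pi_gt_zero by linarith+
        have "norm ((z - 0) * P z) = norm (P z) * norm z" by (simp add: norm_mult)
        also have "\<dots> \<le> C * exp (\<gamma> * \<bar>ln (norm z)\<bar>) * norm z"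
          using P_bound[OF elim(2) abs(2)] by (intro mult_right_mono) auto
        also have "exp (\<gamma> * \<bar>ln (norm z)\<bar>) = norm z powr (- \<gamma>)"
          unfolding abs using elim by (simp add: powr_def)
        also have "C * norm z powr (- \<gamma>) * norm z = C * norm z powr (1 - \<gamma>)"
          using elim by (simp add: powr_diff powr_minus field_simps)
        finally show ?case .
      qed
    qed
  qed simp
  then obtain Q where Q: "Q holomorphic_on UNIV" "\<And>z. z \<noteq> 0 \<Longrightarrow> Q z = P z" by auto
  have Q_const: "Q z = Q 0" for z
  proof (rule entire_sublinear_constant[OF Q(1) \<gamma>])
    fix z :: complex assume z: "norm z \<ge> exp (2 * pi)"
    then have nz: "z \<noteq> 0" using exp_gt_zero[of "2 * pi"] by auto
    have "ln (norm z) \<ge> 2 * pi" using z nz by (subst ln_ge_iff) auto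
    then have abs: "\<bar>ln (norm z)\<bar> = ln (norm z)" "\<bar>ln (norm z)\<bar> \<ge> 2 * pi"
      using pi_gt_zero by linarith+
    show "norm (Q z) \<le> C * norm z powr \<gamma>"
      using P_bound[OF nz abs(2)] nz unfolding abs(1) by (simp add: Q(2) powr_def)
  qed
  have "K z = Q 0" if z: "\<bar>Re z\<bar> < 1" for z
  proof -
    define q where "q = exp (e * z)"
    have nz: "q \<noteq> 0" by (simp add: q_def)
    have "exp (e * (Ln q / e)) = exp (e * z)" using nz e by (simp add: q_def)
    then have "P q = K z" unfolding P_def by (intro same Ln_strip nz z)
    then show ?thesis using Q(2)[OF nz] Q_const[of q] by simp
  qed
  then show ?thesis by blast
qed

section \<open>The line \<open>a + b = -N\<close>\<close>

lemma norm_sin_ge_1: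
  assumes "\<bar>Im z\<bar> \<ge> 3"
  shows "norm (sin z) \<ge> 1"
proof -
  have sin: "norm (sin z) = norm (exp (\<i> * z) - exp (- (\<i> * z))) / 2"
    by (simp add: sin_exp_eq norm_divide norm_mult)
  have n: "norm (exp (\<i> * z)) = exp (- Im z)" "norm (exp (- (\<i> * z))) = exp (Im z)"
    by simp_all
  have "exp \<bar>Im z\<bar> \<ge> 1 + \<bar>Im z\<bar>" by (rule exp_ge_add_one_self)
  moreover have "exp (- \<bar>Im z\<bar>) \<le> 1" by simp
  ultimately have "exp \<bar>Im z\<bar> - exp (- \<bar>Im z\<bar>) \<ge> 2" using assms by linarith
  also have "exp \<bar>Im z\<bar> - exp (- \<bar>Im z\<bar>) \<le> norm (exp (\<i> * z) - exp (- (\<i> * z)))"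
    using norm_triangle_ineq2[of "exp (\<i> * z)" "exp (- (\<i> * z))"]
      norm_triangle_ineq3[of "exp (\<i> * z)" "exp (- (\<i> * z))"] unfolding n
    by (cases "Im z \<ge> 0") auto
  finally show ?thesis unfolding sin by simp
qed

lemma norm_cos_le_exp: "norm (cos z) \<le> exp \<bar>Im z\<bar>"
proof -
  have "norm (cos z) \<le> (norm (exp (\<i> * z)) + norm (exp (- (\<i> * z)))) / 2"
    using norm_triangle_ineq[of "exp (\<i> * z)" "exp (- (\<i> * z))"] by (simp add: cos_exp_eq norm_divide)
  also have "\<dots> \<le> (exp \<bar>Im z\<bar> + exp \<bar>Im z\<bar>) / 2"
    by (intro divide_right_mono add_mono) auto
  finally show ?thesis by simp
qed

lemma Re_pos_not_nonpos_Int: "Re z > 0 \<Longrightarrow> z \<notin> \<int>\<^sub>\<le>\<^sub>0"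
  by (auto elim!: nonpos_Ints_cases')

section \<open>The function g(a) on its strip\<close>

definition S2_line :: "nat \<Rightarrow> complex \<Rightarrow> complex" where
  "S2_line N a = S2 a (- of_nat N - a)"

definition S2_strip :: "nat \<Rightarrow> complex set" where
  "S2_strip N = {a. - real N - 1 < Re a \<and> Re a < 1}"

lemma S2_domain_line: "a \<in> S2_strip N \<Longrightarrow> S2_domain a (- of_nat N - a)"
  by (auto simp: S2_strip_def S2_domain_def)

lemma open_S2_strip: "open (S2_strip N)"
  and connected_S2_strip: "connected (S2_strip N)"
proof -
  have eq: "S2_strip N = {a. Re a > - real N - 1} \<inter> {a. Re a < 1}"
    by (auto simp: S2_strip_def)
  show "open (S2_strip N)"
    unfolding eq by (intro open_Int open_halfspace_Re_gt open_halfspace_Re_lt)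
  show "connected (S2_strip N)"
    unfolding eq by (intro convex_connected convex_Int convex_halfspace_Re_gt convex_halfspace_Re_lt)
qed

lemma holomorphic_S2_line: "S2_line N holomorphic_on S2_strip N"
  unfolding S2_line_def
  by (intro holomorphic_S2 open_S2_strip holomorphic_intros S2_domain_line)

lemma S2_line_reflect:
  assumes "a \<in> S2_strip N"
  shows "S2_line N (- of_nat N - a) = S2_line N a"
  using S2_commute[OF S2_domain_line[OF assms]] by (simp add: S2_line_def)

lemma S2_line_shift:
  assumes "- real N - 1 < Re a" "Re a < 0"
  shows "a * S2_line N (a + 1) = (of_nat (Suc N) + a) * S2_line N a"
proof -
  have b: "- of_nat (Suc N) - a = - of_nat N - (a + 1)" "- of_nat (Suc N) - a + 1 = - of_nat N - a"
    by simp_all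
  have "a * S2 (a + 1) (- of_nat (Suc N) - a) + (- of_nat (Suc N) - a) * S2 a (- of_nat (Suc N) - a + 1) = 0"
    using assms by (intro S2_recurrence) auto
  moreover have "S2_line N (a + 1) = S2 (a + 1) (- of_nat (Suc N) - a)"
    by (simp only: S2_line_def b(1))
  moreover have "S2_line N a = S2 a (- of_nat (Suc N) - a + 1)"
    by (simp only: S2_line_def b(2))
  ultimately have "a * S2_line N (a + 1) + (- of_nat (Suc N) - a) * S2_line N a = 0"
    by simp
  then show ?thesis by (simp add: algebra_simps del: of_nat_Suc)
qed

lemma S2_line_zero: "S2_line N 0 = - zeta (- of_nat (Suc N)) / of_nat (Suc N)"
proof -
  have "S2_line N 0 = zeta (- of_nat N - 1) / (- of_nat N - 1)"
    unfolding S2_line_def by (subst S2_zero_left[symmetric]) auto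
  also have "- of_nat N - 1 = - (of_nat (Suc N) :: complex)" by simp
  finally show ?thesis by (simp del: of_nat_Suc)
qed

text \<open>For \<open>\<bar>Re a\<bar> \<le> 1 / 2\<close> the weight
  \<open>\<theta> = Re a + 1 / 2\<close> is admissible and makes both exponents
  \<open>- 3 / 2\<close>, uniformly in \<open>a\<close>. The rate is \<open>3 + 3\<close> because
  \<open>a\<close> and \<open>- N - a\<close> have imaginary parts of equal size.\<close>

lemma S2_line_growth:
  "\<exists>C\<ge>0. \<forall>a. \<bar>Re a\<bar> \<le> 1 / 2 \<longrightarrow> norm (S2_line N a) \<le> C * exp (6 * \<bar>Im a\<bar>)"
proof -
  obtain C where C: "C \<ge> 0" and bd: "\<And>a j. - real (Suc N) \<le> Re a \<Longrightarrow> Re a \<le> 1 / 2 \<Longrightarrow>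
     norm (zcoeff a j) \<le> C * exp (3 * \<bar>Im a\<bar>) * real (Suc j) powr (Re a - 1)"
    using zcoeff_bound[of "1 / 2" "Suc N"] by auto
  let ?s = "\<Sum>j. real (Suc j) powr (- 1 - 1 / 2)"
  have "norm (S2_line N a) \<le> (C * ?s)\<^sup>2 * exp (6 * \<bar>Im a\<bar>)" if a: "\<bar>Re a\<bar> \<le> 1 / 2" for a
  proof -
    define D where "D = C * exp (3 * \<bar>Im a\<bar>)"
    define b where "b = - of_nat N - a"
    have aR: "- 1 / 2 \<le> Re a" "Re a \<le> 1 / 2" using a by linarith+
    have "norm (S2_term a b j k) \<le> (D * real (Suc j) powr (- 1 - 1 / 2)) * (D * real (Suc k) powr (- 1 - 1 / 2))" for j k
    proof -
      have "norm (zcoeff a j) \<le> D * real (Suc j) powr (Re a - 1)"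
        unfolding D_def using aR by (intro bd) auto
      moreover have "norm (zcoeff b k) \<le> D * real (Suc k) powr (- Re a - 1)"
      proof -
        have "norm (zcoeff b k) \<le> C * exp (3 * \<bar>Im b\<bar>) * real (Suc k) powr (Re b - 1)"
          using aR by (intro bd) (auto simp: b_def)
        also have "\<dots> \<le> D * real (Suc k) powr (- Re a - 1)"
          unfolding D_def using C by (intro mult_mono powr_mono mult_left_mono) (auto simp: b_def)
        finally show ?thesis .
      qed
      ultimately have "norm (S2_term a b j k) \<le> (D * real (Suc j) powr (Re a - 1 - (Re a + 1 / 2))) *
          (D * real (Suc k) powr (- Re a - 1 - (1 - (Re a + 1 / 2))))"
        using aR by (intro norm_S2_term_le) auto
      moreover have "Re a - 1 - (Re a + 1 / 2) = - 1 - 1 / 2" "- Re a - 1 - (1 - (Re a + 1 / 2)) = - 1 - 1 / 2"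
        by simp_all
      ultimately show ?thesis by (simp only:)
    qed
    then interpret product_bounded_double_series "S2_term a b"
      "\<lambda>j. D * real (Suc j) powr (- 1 - 1 / 2)" "\<lambda>j. D * real (Suc j) powr (- 1 - 1 / 2)"
      using C by (intro S2_product_bounded) (auto simp: D_def)
    have "norm (S2_line N a) \<le> (\<Sum>j. D * real (Suc j) powr (- 1 - 1 / 2)) * (\<Sum>j. D * real (Suc j) powr (- 1 - 1 / 2))"
      using norm_le unfolding S2_line_def S2_def b_def .
    also have "(\<Sum>j. D * real (Suc j) powr (- 1 - 1 / 2)) = D * ?s"
      by (rule suminf_mult) (rule summable_Suc_powr, simp)
    also have "(D * ?s) * (D * ?s) = (C * ?s)\<^sup>2 * (exp (3 * \<bar>Im a\<bar>) * exp (3 * \<bar>Im a\<bar>))"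
      by (simp only: D_def power2_eq_square mult_ac)
    also have "exp (3 * \<bar>Im a\<bar>) * exp (3 * \<bar>Im a\<bar>) = exp (6 * \<bar>Im a\<bar>)" by (simp flip: exp_add)
    finally show ?thesis .
  qed
  then show ?thesis by (intro exI[of _ "(C * ?s)\<^sup>2"]) auto
qed

section \<open>The comparison function T(a)\<close>

definition S2_main :: "nat \<Rightarrow> complex \<Rightarrow> complex" where
  "S2_main N a = S2_line N 0 / fact N * (Gamma (1 - a) * Gamma (of_nat (Suc N) + a)) * cos (of_real pi * a)"

lemma holomorphic_S2_main: "S2_main N holomorphic_on S2_strip N"
proof -
  have "1 - a \<notin> \<int>\<^sub>\<le>\<^sub>0" "of_nat (Suc N) + a \<notin> \<int>\<^sub>\<le>\<^sub>0" if "a \<in> S2_strip N" for a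
    using that by (auto simp: S2_strip_def intro!: Re_pos_not_nonpos_Int)
  then show ?thesis
    unfolding S2_main_def by (intro holomorphic_intros) auto
qed

lemma S2_main_zero: "S2_main N 0 = S2_line N 0"
  by (simp add: S2_main_def Gamma_fact)

lemma S2_main_shift:
  assumes "- real N - 1 < Re a" "Re a < 0"
  shows "a * S2_main N (a + 1) = (of_nat (Suc N) + a) * S2_main N a"
proof -
  have 1: "Gamma (1 - a) = - a * Gamma (1 - (a + 1))"
    using Gamma_plus1[OF Re_pos_not_nonpos_Int, of "- a"] assms by (simp add: add.commute)
  have 2: "Gamma (of_nat (Suc N) + (a + 1)) = (of_nat (Suc N) + a) * Gamma (of_nat (Suc N) + a)"
    using Gamma_plus1[OF Re_pos_not_nonpos_Int, of "of_nat (Suc N) + a"] assms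
    by (simp add: add_ac)
  have 3: "cos (of_real pi * (a + 1)) = - cos (of_real pi * a)"
    by (simp add: distrib_left cos_add)
  show ?thesis unfolding S2_main_def 1 2 3 by (simp only: mult_ac mult_minus_left mult_minus_right)
qed

text \<open>The reflection formula for Gamma turns the quotient into a multiple of
  \<open>\<pi> cot(\<pi> a)\<close>, which can be estimated directly for large
  \<open>\<bar>Im a\<bar>\<close>.\<close>

lemma S2_main_over_pochhammer:
  assumes "a \<notin> \<int>"
  shows "S2_main N a / pochhammer a (Suc N) = S2_line N 0 / fact N * (of_real pi * cos (of_real pi * a) / sin (of_real pi * a))"
proof -
  have a: "a \<notin> \<int>\<^sub>\<le>\<^sub>0" using assms nonpos_Ints_Int by blast
  have "pochhammer a (Suc N) = Gamma (of_nat (Suc N) + a) / Gamma a"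
    using pochhammer_Gamma[OF a, of "Suc N"] by (simp add: add.commute)
  moreover have "Gamma (of_nat (Suc N) + a) \<noteq> 0"
  proof -
    have "of_nat (Suc N) + a \<notin> \<int>\<^sub>\<le>\<^sub>0"
    proof
      assume "of_nat (Suc N) + a \<in> \<int>\<^sub>\<le>\<^sub>0"
      then have "of_nat (Suc N) + a - of_nat (Suc N) \<in> \<int>"
        by (intro Ints_diff Ints_of_nat nonpos_Ints_Int)
      then show False using assms by simp
    qed
    then show ?thesis by (simp add: Gamma_eq_zero_iff)
  qed
  moreover have "Gamma a \<noteq> 0" using a by (simp add: Gamma_eq_zero_iff)
  ultimately have p: "Gamma (of_nat (Suc N) + a) = pochhammer a (Suc N) * Gamma a" "pochhammer a (Suc N) \<noteq> 0"
    by auto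
  have "S2_main N a / pochhammer a (Suc N) = S2_line N 0 / fact N * (Gamma a * Gamma (1 - a)) * cos (of_real pi * a)"
    unfolding S2_main_def p(1) using p(2) by simp
  then show ?thesis by (simp add: Gamma_reflection_complex)
qed

lemma norm_pochhammer_ge_1:
  fixes a :: complex
  assumes "\<bar>Im a\<bar> \<ge> 1"
  shows "norm (pochhammer a n) \<ge> 1"
proof -
  have "1 \<le> norm (a + of_nat i)" for i :: nat
    using assms abs_Im_le_cmod[of "a + of_nat i"] by simp
  then have "1 \<le> (\<Prod>i<n. norm (a + of_nat i))"
    by (intro prod_ge_1) auto
  then show ?thesis
    by (simp only: pochhammer_prod prod_norm[symmetric] atLeast0LessThan)
qed

lemma pochhammer_nonzero_off_Ints: "(a :: complex) \<notin> \<int> \<Longrightarrow> pochhammer a n \<noteq> 0"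
  using pochhammer_eq_0_iff[of a n] by auto

text \<open>\<open>D\<close> vanishes at 0 because \<open>S2_main N 0 = S2_line N 0\<close>, which
  cancels the factor \<open>a\<close> of \<open>(a)\<^sub>N\<^sub>+\<^sub>1\<close>; its other zeros
  \<open>-1, ..., -N\<close> lie outside \<open>\<bar>Re a\<bar> < 1\<close>. The identity found on
  that strip continues to all of \<open>S2_strip N\<close>.\<close>

lemma S2_line_structure:
  "\<exists>B. \<forall>a\<in>S2_strip N. S2_line N a = S2_main N a + B * pochhammer a (Suc N)"
proof -
  define D where "D = (\<lambda>a. S2_line N a - S2_main N a)"
  define D1 where "D1 = (\<lambda>z. if z = 0 then deriv D 0 else (D z - D 0) / (z - 0))"
  define K where "K = (\<lambda>a. D1 a / pochhammer (a + 1) N)"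
  let ?U = "{z :: complex. \<bar>Re z\<bar> < 1}"
  have sub: "?U \<subseteq> S2_strip N" by (auto simp: S2_strip_def)
  have hol_D: "D holomorphic_on S2_strip N"
    unfolding D_def by (intro holomorphic_intros holomorphic_S2_line holomorphic_S2_main)
  have D0: "D 0 = 0" by (simp add: D_def S2_main_zero)
  have shift: "a * D (a + 1) = (of_nat (Suc N) + a) * D a" if "- real N - 1 < Re a" "Re a < 0" for a
    unfolding D_def right_diff_distrib S2_line_shift[OF that] S2_main_shift[OF that] ..
  have K_eq: "K a = D a / pochhammer a (Suc N)" if "a \<noteq> 0" for a
    using that by (simp add: K_def D1_def D0 pochhammer_rec)
  have nz1: "pochhammer (a + 1) N \<noteq> 0" if "\<bar>Re a\<bar> < 1" for a
  proof
    assume "pochhammer (a + 1) N = 0"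
    then obtain k where "a + 1 = - of_nat k" by (auto simp: pochhammer_eq_0_iff)
    then have "Re (a + 1) = - real k" by simp
    with that show False by simp
  qed
  have "\<exists>B. \<forall>z. \<bar>Re z\<bar> < 1 \<longrightarrow> K z = B"
  proof -
    obtain C where C: "C \<ge> 0" and g: "\<And>a. \<bar>Re a\<bar> \<le> 1 / 2 \<Longrightarrow> norm (S2_line N a) \<le> C * exp (6 * \<bar>Im a\<bar>)"
      using S2_line_growth by blast
    define A where "A = norm (S2_line N 0 / fact N)"
    show ?thesis
    proof (rule periodic_strip_constant)
      have "D1 holomorphic_on S2_strip N"
        unfolding D1_def by (rule pole_lemma_open[OF hol_D open_S2_strip])
      then show "K holomorphic_on ?U"
        unfolding K_def using nz1 by (intro holomorphic_intros holomorphic_on_subset[OF _ sub]) auto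
      show "6 < 2 * pi" using pi_gt3 by simp
      show "K z = K (z - 1)" if z: "0 < Re z" "Re z < 1" for z
      proof -
        define a where "a = z - 1"
        have nz: "a \<noteq> 0" "z \<noteq> 0" "of_nat (Suc N) + a \<noteq> 0"
          using z by (auto simp: a_def complex_eq_iff)
        have "pochhammer a (Suc (Suc N)) = a * pochhammer z (Suc N)"
          unfolding pochhammer_rec[of a "Suc N"] by (simp add: a_def)
        then have p: "pochhammer a (Suc N) * (of_nat (Suc N) + a) = a * pochhammer z (Suc N)"
          unfolding pochhammer_rec'[of a "Suc N"] by (simp add: mult.commute add.commute)
        have "pochhammer z (Suc N) \<noteq> 0" "pochhammer a (Suc N) \<noteq> 0"
        proof -
          have "z \<notin> \<int>"
          proof
            assume "z \<in> \<int>"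
            then obtain n where "z = of_int n" by (elim Ints_cases)
            with z have "0 < real_of_int n" "real_of_int n < 1" by auto
            then show False by simp
          qed
          then have "a \<notin> \<int>" unfolding a_def by (metis Ints_1 Ints_add diff_add_cancel)
          show "pochhammer z (Suc N) \<noteq> 0"
            by (rule pochhammer_nonzero_off_Ints[OF \<open>z \<notin> \<int>\<close>])
          show "pochhammer a (Suc N) \<noteq> 0"
            by (rule pochhammer_nonzero_off_Ints[OF \<open>a \<notin> \<int>\<close>])
        qed
        have D: "a * D z = (of_nat (Suc N) + a) * D a"
          using shift[of a] z by (simp add: a_def)
        have "a * (D z * pochhammer a (Suc N)) = D a * (pochhammer a (Suc N) * (of_nat (Suc N) + a))"
          unfolding mult.assoc[symmetric] D by (simp only: mult_ac)
        also have "\<dots> = a * (D a * pochhammer z (Suc N))"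
          unfolding p by (simp only: mult_ac)
        finally have "D z * pochhammer a (Suc N) = D a * pochhammer z (Suc N)"
          using nz(1) by (simp only: mult_cancel_left) simp
        then have "D z / pochhammer z (Suc N) = D a / pochhammer a (Suc N)"
          using \<open>pochhammer z (Suc N) \<noteq> 0\<close> \<open>pochhammer a (Suc N) \<noteq> 0\<close> by (simp add: frac_eq_eq)
        then show ?thesis using K_eq[OF nz(1)] K_eq[OF nz(2)] by (simp add: a_def)
      qed
      show "norm (K z) \<le> (C + A * pi) * exp (6 * \<bar>Im z\<bar>)" if z: "\<bar>Re z\<bar> \<le> 1 / 2" "1 \<le> \<bar>Im z\<bar>" for z
      proof -
        have "z \<notin> \<int>" using z by (auto elim!: Ints_cases)
        then have "z \<noteq> 0" by auto
        have im: "\<bar>Im (of_real pi * z)\<bar> = pi * \<bar>Im z\<bar>" by (simp add: abs_mult)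
        have "pi * 1 \<le> pi * \<bar>Im z\<bar>" using z by (intro mult_left_mono) auto
        then have "3 \<le> \<bar>Im (of_real pi * z)\<bar>"
          unfolding im using pi_gt3 by linarith
        then have sin: "norm (sin (of_real pi * z)) \<ge> 1"
          by (rule norm_sin_ge_1)
        have cos: "norm (cos (of_real pi * z)) \<le> exp (6 * \<bar>Im z\<bar>)"
        proof (rule order_trans[OF norm_cos_le_exp])
          have "pi * \<bar>Im z\<bar> \<le> 6 * \<bar>Im z\<bar>" using pi_less_4 by (intro mult_right_mono) auto
          then show "exp \<bar>Im (of_real pi * z)\<bar> \<le> exp (6 * \<bar>Im z\<bar>)" unfolding im by simp
        qed
        have 1: "norm (S2_line N z / pochhammer z (Suc N)) \<le> C * exp (6 * \<bar>Im z\<bar>)"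
        proof -
          have "norm (S2_line N z / pochhammer z (Suc N)) \<le> (C * exp (6 * \<bar>Im z\<bar>)) / 1"
            unfolding norm_divide using g[OF z(1)] norm_pochhammer_ge_1[OF z(2)] C
            by (intro frac_le) auto
          then show ?thesis by simp
        qed
        have 2: "norm (S2_main N z / pochhammer z (Suc N)) \<le> A * pi * exp (6 * \<bar>Im z\<bar>)"
        proof -
          have "norm (S2_main N z / pochhammer z (Suc N)) = A * (pi * norm (cos (of_real pi * z)) / norm (sin (of_real pi * z)))"
            unfolding S2_main_over_pochhammer[OF \<open>z \<notin> \<int>\<close>] by (simp add: A_def norm_mult norm_divide)
          also have "\<dots> \<le> A * (pi * exp (6 * \<bar>Im z\<bar>) / 1)"
            using sin cos by (intro mult_left_mono frac_le) (auto simp: A_def)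
          finally show ?thesis by (simp add: mult_ac)
        qed
        have "norm (K z) \<le> norm (S2_line N z / pochhammer z (Suc N)) + norm (S2_main N z / pochhammer z (Suc N))"
          unfolding K_eq[OF \<open>z \<noteq> 0\<close>] D_def diff_divide_distrib by (rule norm_triangle_ineq4)
        with 1 2 show ?thesis by (simp add: distrib_right)
      qed
    qed
  qed
  then obtain B where B: "\<And>z. \<bar>Re z\<bar> < 1 \<Longrightarrow> K z = B" by blast
  have strip1: "D z = B * pochhammer z (Suc N)" if "z \<in> ?U" for z
  proof (cases "z = 0")
    case True
    then show ?thesis using D0 by (simp add: pochhammer_rec)
  next
    case False
    have "pochhammer z (Suc N) \<noteq> 0"
      using nz1[of z] that False by (simp add: pochhammer_rec)
    then show ?thesis using K_eq[OF False] B[of z] that by (simp add: field_simps)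
  qed
  have "D z = B * pochhammer z (Suc N)" if "z \<in> S2_strip N" for z
  proof (rule analytic_continuation_open[of ?U "S2_strip N" D "\<lambda>z. B * pochhammer z (Suc N)"])
    have "?U = {z. Re z > - 1} \<inter> {z. Re z < 1}" by auto
    then show "open ?U" by (simp add: open_Int open_halfspace_Re_gt open_halfspace_Re_lt)
    show "?U \<noteq> {}" by (auto intro!: exI[of _ 0])
    show "(\<lambda>z. B * pochhammer z (Suc N)) holomorphic_on S2_strip N"
      by (intro holomorphic_intros)
  qed (use sub hol_D open_S2_strip connected_S2_strip strip1 that in auto)
  then show ?thesis by (intro exI[of _ B]) (auto simp: D_def algebra_simps)
qed

text \<open>Schwarz's lemma after rescaling. Dividing by \<open>2 * M\<close> instead of
  \<open>M\<close> secures the strict bound it requires.\<close>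

lemma schwarz_bound:
  assumes hol: "f holomorphic_on ball 0 \<rho>" and f0: "f 0 = 0" and \<rho>: "\<rho> > 0"
    and bd: "\<And>z. norm z < \<rho> \<Longrightarrow> norm (f z) \<le> M" and z: "norm z < \<rho>"
  shows "norm (f z) \<le> 2 * M / \<rho> * norm z"
proof (cases "M = 0")
  case True
  then show ?thesis using bd[OF z] by simp
next
  case False
  have "M \<ge> 0" using bd[of 0] \<rho> f0 by simp
  with False have M: "M > 0" by simp
  define h where "h = (\<lambda>w. f (of_real \<rho> * w) / of_real (2 * M))"
  have "norm (h (z / of_real \<rho>)) \<le> norm (z / of_real \<rho>)"
  proof (rule Schwarz_Lemma(1))
    have "(f \<circ> (\<lambda>w. of_real \<rho> * w)) holomorphic_on ball 0 1"
      by (rule holomorphic_on_compose_gen[OF _ hol]) (use \<rho> in \<open>auto intro!: holomorphic_intros simp: norm_mult\<close>)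
    then show "h holomorphic_on ball 0 1"
      unfolding h_def o_def using M by (intro holomorphic_intros) auto
    show "h 0 = 0" by (simp add: h_def f0)
    show "norm (h w) < 1" if "norm w < 1" for w
    proof -
      have "norm (f (of_real \<rho> * w)) \<le> M" using that \<rho> by (intro bd) (simp add: norm_mult)
      then show ?thesis using M by (simp add: h_def norm_divide norm_mult)
    qed
    show "norm (z / of_real \<rho>) < 1" using z \<rho> by (simp add: norm_divide)
  qed
  then have "norm (f z) / (2 * M) \<le> norm z / \<rho>"
    using \<rho> M by (simp add: h_def norm_divide norm_mult)
  then show ?thesis using \<rho> M by (simp add: field_simps)
qed

text \<open>The mixed difference vanishes on both axes, so the one-variable bound applies in
  \<open>u\<close> and then in \<open>v\<close>; 16 is four terms times a factor 2 for each use. On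
  \<open>v = - u\<close> the bound is quadratic, which stands in for joint
  differentiability.\<close>

lemma cross_difference_bound:
  fixes F :: "complex \<Rightarrow> complex \<Rightarrow> complex"
  assumes \<rho>: "\<rho> > 0"
    and hol1: "\<And>v. norm v < \<rho> \<Longrightarrow> (\<lambda>u. F u v) holomorphic_on ball 0 \<rho>"
    and hol2: "\<And>u. norm u < \<rho> \<Longrightarrow> F u holomorphic_on ball 0 \<rho>"
    and bd: "\<And>u v. norm u < \<rho> \<Longrightarrow> norm v < \<rho> \<Longrightarrow> norm (F u v) \<le> B"
    and u: "norm u < \<rho>" and v: "norm v < \<rho>"
  shows "norm (F u v - F 0 v - F u 0 + F 0 0) \<le> 16 * B / \<rho>\<^sup>2 * (norm u * norm v)"
proof -
  define E where "E = (\<lambda>u v. F u v - F 0 v - F u 0 + F 0 0)"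
  have E4: "norm (E u v) \<le> 4 * B" if "norm u < \<rho>" "norm v < \<rho>" for u v
  proof -
    have "norm (E u v) \<le> norm (F u v) + norm (F 0 v) + norm (F u 0) + norm (F 0 0)"
      unfolding E_def by (smt (verit) norm_triangle_ineq norm_triangle_ineq4)
    then show ?thesis
      using bd[OF that] bd[of 0 v] bd[of u 0] bd[of 0 0] that \<rho> by simp
  qed
  have E1: "norm (E u v) \<le> 2 * (4 * B) / \<rho> * norm u" if "norm u < \<rho>" "norm v < \<rho>" for u v
  proof (rule schwarz_bound[OF _ _ \<rho> _ that(1)])
    show "(\<lambda>u. E u v) holomorphic_on ball 0 \<rho>"
      unfolding E_def using that \<rho> by (intro holomorphic_intros hol1) auto
    show "E 0 v = 0" by (simp add: E_def)
    show "norm (E u v) \<le> 4 * B" if "norm u < \<rho>" for u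
      by (rule E4[OF that \<open>norm v < \<rho>\<close>])
  qed
  have "norm (E u v) \<le> 2 * (2 * (4 * B) / \<rho> * norm u) / \<rho> * norm v"
  proof (rule schwarz_bound[OF _ _ \<rho> _ v])
    show "E u holomorphic_on ball 0 \<rho>"
      unfolding E_def using u \<rho> by (intro holomorphic_intros hol2) auto
    show "E u 0 = 0" by (simp add: E_def)
    show "norm (E u v) \<le> 2 * (4 * B) / \<rho> * norm u" if "norm v < \<rho>" for v
      by (rule E1[OF u that])
  qed
  then show ?thesis by (simp add: E_def power2_eq_square)
qed

section \<open>Parity and the constant B\<close>

lemma cos_sin_of_nat_pi:
  "cos (of_nat n * of_real pi :: complex) = (- 1) ^ n"
  "sin (of_nat n * of_real pi :: complex) = 0"
proof -
  have eq: "(of_nat n * of_real pi :: complex) = of_real (real n * pi)"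
    by simp
  show "cos (of_nat n * of_real pi :: complex) = (- 1) ^ n"
    unfolding eq cos_of_real cos_npi by simp
  show "sin (of_nat n * of_real pi :: complex) = 0"
    unfolding eq sin_of_real sin_npi by simp
qed

lemma complex_eq_uminus_self: "z = - z \<Longrightarrow> z = (0 :: complex)"
  by (simp add: complex_eq_iff)

text \<open>Like g, T is invariant under \<open>a \<mapsto> - N - a\<close> for even
  \<open>N\<close>, whereas \<open>(a)\<^sub>N\<^sub>+\<^sub>1\<close> has an odd number of factors
  and changes sign. One point decides, and \<open>1 / 2\<close> is a point where the Pochhammer
  symbol is nonzero.\<close>

lemma S2_line_even:
  assumes N: "even N" and a: "a \<in> S2_strip N"
  shows "S2_line N a = S2_main N a"
proof -
  obtain B where B: "\<And>a. a \<in> S2_strip N \<Longrightarrow> S2_line N a = S2_main N a + B * pochhammer a (Suc N)"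
    using S2_line_structure[of N] by blast
  define x :: complex where "x = 1 / 2"
  have x: "x \<in> S2_strip N" "- of_nat N - x \<in> S2_strip N" by (auto simp: x_def S2_strip_def)
  have "cos (of_real pi * (- of_nat N - x)) = cos (of_real pi * x)"
  proof -
    have "of_real pi * (- of_nat N - x) = - (of_real pi * x + of_nat N * of_real pi)"
      by (simp add: algebra_simps)
    then have "cos (of_real pi * (- of_nat N - x)) = cos (of_real pi * x + of_nat N * of_real pi)"
      by (simp only: cos_minus)
    then show ?thesis
      using N by (simp add: cos_add cos_sin_of_nat_pi)
  qed
  moreover have "1 - (- of_nat N - x) = of_nat (Suc N) + x" "of_nat (Suc N) + (- of_nat N - x) = 1 - x"
    by simp_all
  ultimately have "S2_main N (- of_nat N - x) = S2_main N x"
    unfolding S2_main_def by (simp only: mult_ac)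
  moreover have "pochhammer (- of_nat N - x) (Suc N) = - pochhammer x (Suc N)"
    using pochhammer_minus[of "of_nat N + x" "Suc N"] N by simp
  ultimately have "B * pochhammer x (Suc N) = - (B * pochhammer x (Suc N))"
    using B[OF x(1)] B[OF x(2)] S2_line_reflect[OF x(1)] by simp
  then have "B * pochhammer x (Suc N) = 0"
    by (rule complex_eq_uminus_self)
  moreover have "pochhammer x (Suc N) \<noteq> 0"
    by (rule pochhammer_nonzero_off_Ints) (use fraction_not_in_Ints[of 2 1] in \<open>simp add: x_def\<close>)
  ultimately show ?thesis using B[OF a] by simp
qed

text \<open>At \<open>a = - N\<close> the Pochhammer term vanishes and the cosine is
  \<open>- 1\<close>, while the reflection gives \<open>g(- N) = g(0)\<close>. By
  \<open>S2_line_zero\<close> this is the trivial zero of zeta at \<open>- N - 1\<close>.\<close>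

lemma S2_line_zero_odd:
  assumes N: "odd N"
  shows "S2_line N 0 = 0"
proof -
  obtain B where B: "\<And>a. a \<in> S2_strip N \<Longrightarrow> S2_line N a = S2_main N a + B * pochhammer a (Suc N)"
    using S2_line_structure[of N] by blast
  have 0: "0 \<in> S2_strip N" and n: "- of_nat N \<in> S2_strip N" by (auto simp: S2_strip_def)
  have "cos (of_real pi * - of_nat N :: complex) = - 1"
  proof -
    have "of_real pi * - of_nat N = - (of_nat N * of_real pi :: complex)" by simp
    then have "cos (of_real pi * - of_nat N :: complex) = cos (of_nat N * of_real pi)"
      by (simp only: cos_minus)
    then show ?thesis using N by (simp add: cos_sin_of_nat_pi)
  qed
  then have "S2_main N (- of_nat N) = - S2_line N 0"
    by (simp add: S2_main_def Gamma_fact)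
  moreover have "pochhammer (- of_nat N :: complex) (Suc N) = 0"
    by (simp add: pochhammer_eq_0_iff)
  moreover have "S2_line N (- of_nat N) = S2_line N 0"
    using S2_line_reflect[OF 0] by simp
  ultimately have "S2_line N 0 = - S2_line N 0"
    using B[OF n] by simp
  then show ?thesis by (rule complex_eq_uminus_self)
qed

text \<open>Each use of the recurrence raises the second argument by 1 until it is 0, where symmetry
  and \<open>S2_zero_left\<close> give a closed form.\<close>

lemma S2_neg_right:
  assumes "Re s < 1"
  shows "S2 s (- of_nat n) = (- 1) ^ n * fact n / pochhammer (1 - s) n * S2 (s - of_nat n) 0"
  using assms
proof (induction n arbitrary: s)
  case (Suc n)
  have nz: "1 - s \<noteq> 0" using Suc.prems by auto
  have "(s - 1) * S2 (s - 1 + 1) (- of_nat (Suc n)) + (- of_nat (Suc n)) * S2 (s - 1) (- of_nat (Suc n) + 1) = 0"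
    using Suc.prems by (intro S2_recurrence) auto
  then have "(1 - s) * S2 s (- of_nat (Suc n)) = - of_nat (Suc n) * S2 (s - 1) (- of_nat n)"
    by (simp add: algebra_simps)
  then have "S2 s (- of_nat (Suc n)) = - of_nat (Suc n) / (1 - s) * S2 (s - 1) (- of_nat n)"
    using nz by (simp add: field_simps del: of_nat_Suc)
  also have "S2 (s - 1) (- of_nat n) = (- 1) ^ n * fact n / pochhammer (1 - s + 1) n * S2 (s - of_nat (Suc n)) 0"
    using Suc.IH[of "s - 1"] Suc.prems by (simp add: algebra_simps)
  finally show ?case
    unfolding pochhammer_rec[of "1 - s" n] fact_Suc power_Suc by (simp del: of_nat_Suc)
qed simp

text \<open>\<open>X\<close> and \<open>Y\<close> move one argument each and are explicit. The
  remainder \<open>E\<close> is a mixed difference, because \<open>S2 0 (- of_nat N) = 0\<close>,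
  and has derivative 0. \<open>X\<close> and \<open>Y\<close> contribute equally, whence the factor
  2.\<close>

lemma S2_line_odd_derivative:
  assumes N: "odd N"
  shows "(S2_line N has_field_derivative (2 * deriv zeta (- of_nat (Suc N)) / of_nat (Suc N))) (at 0)"
proof -
  define n :: complex where "n = of_nat (Suc N)"
  have n0: "n \<noteq> 0" unfolding n_def by (simp only: of_nat_eq_0_iff)
  \<comment> \<open>A trivial zero, here a consequence of parity. Thanks to it only the zeta factor
    is differentiated in the products below.\<close>
  have zero: "zeta (- n) = 0"
    using S2_line_zero[of N] S2_line_zero_odd[OF N] n0 by (simp add: n_def del: of_nat_Suc)
  have ne: "- n \<noteq> 1" unfolding n_def by (simp add: complex_eq_iff)
  have dz: "(zeta has_field_derivative deriv zeta (- n)) (at (- n))"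
    by (rule holomorphic_derivI[of _ "- {1}"]) (use ne in \<open>auto intro: holomorphic_zeta\<close>)
  have prod: "((\<lambda>u. h u * k u) has_field_derivative h 0 * k') (at 0)"
    if "(h has_field_derivative h') (at 0)" "(k has_field_derivative k') (at 0)" "k 0 = 0" for h k :: "complex \<Rightarrow> complex" and h' k'
    using DERIV_mult[OF that(1,2)] that(3) by (simp add: mult.commute)
  define X where "X = (\<lambda>a. S2 0 (- of_nat N - a))"
  define Y where "Y = (\<lambda>a. S2 a (- of_nat N))"
  define E where "E = (\<lambda>a. S2_line N a - X a - Y a)"
  have X_eq: "X a = 1 / (- n - a) * zeta (- n - a)" if "norm a < 1" for a
  proof -
    have "- of_nat N - a - 1 = - n - a"
      by (simp add: n_def)
    moreover have "X a = zeta (- of_nat N - a - 1) / (- of_nat N - a - 1)"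
      unfolding X_def by (rule S2_zero_left) (use that abs_Re_le_cmod[of a] in auto)
    ultimately show ?thesis by (simp only: times_divide_eq_left mult_1_left)
  qed
  have dX: "(X has_field_derivative deriv zeta (- n) / n) (at 0)"
  proof (rule has_field_derivative_transform_within_open[of _ _ _ "ball 0 1"])
    have "((\<lambda>a. 1 / (- n - a) * zeta (- n - a)) has_field_derivative 1 / (- n - 0) * - deriv zeta (- n)) (at 0)"
    proof (rule prod)
      show "((\<lambda>a. 1 / (- n - a)) has_field_derivative (1 / n\<^sup>2)) (at 0)"
        using n0 by (auto intro!: derivative_eq_intros simp: power2_eq_square)
      have "((\<lambda>a. - n - a) has_field_derivative - 1) (at 0)"
        by (auto intro!: derivative_eq_intros)
      then show "((\<lambda>a. zeta (- n - a)) has_field_derivative - deriv zeta (- n)) (at 0)"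
        using DERIV_chain2[of zeta "deriv zeta (- n)" "\<lambda>a. - n - a" 0 "- 1"] dz by simp
    qed (simp add: zero)
    then show "((\<lambda>a. 1 / (- n - a) * zeta (- n - a)) has_field_derivative deriv zeta (- n) / n) (at 0)"
      by simp
  qed (auto simp: X_eq)
  have Y_eq: "Y a = - fact N / (pochhammer (1 - a) N * (a - n)) * zeta (a - n)" if "norm a < 1" for a
  proof -
    have a: "Re a < 1" using that abs_Re_le_cmod[of a] by linarith
    have dom: "S2_domain (a - of_nat N) 0" using a by (simp add: S2_domain_def)
    have "Y a = - fact N / pochhammer (1 - a) N * S2 (a - of_nat N) 0"
      unfolding Y_def S2_neg_right[OF a] using N by simp
    also have "S2 (a - of_nat N) 0 = zeta (a - of_nat N - 1) / (a - of_nat N - 1)"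
      unfolding S2_commute[OF dom] by (rule S2_zero_left) (use a in simp)
    also have "a - of_nat N - 1 = a - n" by (simp add: n_def)
    finally show ?thesis by simp
  qed
  have dY: "(Y has_field_derivative deriv zeta (- n) / n) (at 0)"
  proof (rule has_field_derivative_transform_within_open[of _ _ _ "ball 0 1"])
    let ?h = "\<lambda>a. - fact N / (pochhammer (1 - a) N * (a - n))"
    have nz: "pochhammer (1 - a) N * (a - n) \<noteq> 0" if "a \<in> ball 0 1" for a
    proof -
      have a: "Re a < 1" "norm a < 1" using that abs_Re_le_cmod[of a] by auto
      have "pochhammer (1 - a) N \<noteq> 0"
      proof
        assume "pochhammer (1 - a) N = 0"
        then obtain k where "1 - a = - of_nat k" by (auto simp: pochhammer_eq_0_iff)
        then have "Re (1 - a) = - real k" by simp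
        with a show False by simp
      qed
      moreover have "a \<noteq> n"
      proof
        assume "a = n"
        then have "Re a = real (Suc N)" by (simp add: n_def)
        with a show False by simp
      qed
      ultimately show ?thesis by simp
    qed
    have "?h holomorphic_on ball 0 1"
      by (intro holomorphic_intros nz)
    then have dh: "(?h has_field_derivative deriv ?h 0) (at 0)"
      by (rule holomorphic_derivI) auto
    have "((\<lambda>a. ?h a * zeta (a - n)) has_field_derivative ?h 0 * deriv zeta (- n)) (at 0)"
    proof (rule prod[OF dh])
      have "((\<lambda>a. a - n) has_field_derivative 1) (at 0)"
        by (auto intro!: derivative_eq_intros)
      then show "((\<lambda>a. zeta (a - n)) has_field_derivative deriv zeta (- n)) (at 0)"
        using DERIV_chain2[of zeta "deriv zeta (- n)" "\<lambda>a. a - n" 0 1] dz by simp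
    qed (simp add: zero)
    moreover have "?h 0 * deriv zeta (- n) = deriv zeta (- n) / n"
      by (simp flip: pochhammer_fact)
    ultimately show "((\<lambda>a. ?h a * zeta (a - n)) has_field_derivative deriv zeta (- n) / n) (at 0)"
      by (simp only:)
  qed (auto simp: Y_eq)
  have dE: "(E has_field_derivative 0) (at 0)"
  proof -
    define F where "F = (\<lambda>u v. S2 u (- of_nat N + v))"
    have F00: "F 0 0 = 0" using S2_line_zero_odd[OF N] by (simp add: F_def S2_line_def)
    have "S2_domain 0 (- of_nat N)" by (cases N) (use N in \<open>auto simp: S2_domain_def\<close>)
    then obtain \<rho>' B where \<rho>': "\<rho>' > 0" and B: "\<And>a b. a \<in> cball 0 \<rho>' \<Longrightarrow> b \<in> cball (- of_nat N) \<rho>' \<Longrightarrow> norm (S2 a b) \<le> B"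
      using S2_locally_bounded by blast
    define \<rho> where "\<rho> = min \<rho>' (1 / 2)"
    have \<rho>: "\<rho> > 0" using \<rho>' by (simp add: \<rho>_def)
    have dom: "S2_domain u (- of_nat N + v)" if "norm u < \<rho>" "norm v < \<rho>" for u v
    proof -
      have "Re u < 1 / 2" "Re v < 1 / 2"
        using that abs_Re_le_cmod[of u] abs_Re_le_cmod[of v] by (auto simp: \<rho>_def)
      then show ?thesis by (auto simp: S2_domain_def)
    qed
    have hol1: "(\<lambda>u. F u v) holomorphic_on ball 0 \<rho>" if "norm v < \<rho>" for v
      unfolding F_def using that by (intro holomorphic_S2 holomorphic_intros dom) auto
    have hol2: "F u holomorphic_on ball 0 \<rho>" if "norm u < \<rho>" for u
      unfolding F_def using that by (intro holomorphic_S2 holomorphic_intros dom) auto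
    have bd: "norm (F u v) \<le> B" if "norm u < \<rho>" "norm v < \<rho>" for u v
      unfolding F_def using that by (intro B) (auto simp: \<rho>_def dist_norm)
    have E_eq: "E a = F a (- a) - F 0 (- a) - F a 0 + F 0 0" for a
      unfolding F00 by (simp only: E_def F_def X_def Y_def S2_line_def add_uminus_conv_diff add_0_right)
    have bound: "norm (E a) \<le> 16 * B / \<rho>\<^sup>2 * (norm a * norm a)" if "norm a < \<rho>" for a
      using cross_difference_bound[OF \<rho> hol1 hol2 bd, of a "- a"] that unfolding E_eq by simp
    have E0: "E 0 = 0" using bound[of 0] \<rho> by simp
    have "(\<lambda>h. (E (0 + h) - E 0) / h) \<midarrow>0\<rightarrow> 0"
    proof (rule Lim_null_comparison)
      have "\<forall>\<^sub>F h in at (0::complex). h \<in> ball 0 \<rho>"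
        by (rule eventually_at_in_open') (use \<rho> in auto)
      moreover have "\<forall>\<^sub>F h in at (0::complex). h \<noteq> 0" by (rule eventually_neq_at_within)
      ultimately show "\<forall>\<^sub>F h in at 0. norm ((E (0 + h) - E 0) / h) \<le> 16 * B / \<rho>\<^sup>2 * norm h"
      proof eventually_elim
        case (elim h)
        then have "norm (E h) \<le> 16 * B / \<rho>\<^sup>2 * norm h * norm h" using bound[of h] by simp
        then show ?case using elim(2) \<rho> by (simp add: E0 norm_divide pos_divide_le_eq)
      qed
      show "(\<lambda>h. 16 * B / \<rho>\<^sup>2 * norm h) \<midarrow>0\<rightarrow> (0::real)"
        by (intro tendsto_mult_right_zero tendsto_norm_zero tendsto_ident_at)
    qed
    then show ?thesis by (simp only: DERIV_def)
  qed
  have "((\<lambda>a. E a + X a + Y a) has_field_derivative (0 + deriv zeta (- n) / n + deriv zeta (- n) / n)) (at 0)"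
    by (intro DERIV_add dE dX dY)
  then show ?thesis by (simp add: E_def n_def del: of_nat_Suc)
qed

text \<open>With \<open>g(0) = 0\<close> the term T disappears, and \<open>B\<close> is read off at
  0, where \<open>(a)\<^sub>N\<^sub>+\<^sub>1 = a (a + 1)\<^sub>N\<close> has slope
  \<open>N!\<close>.\<close>

lemma S2_line_odd:
  assumes N: "odd N" and a: "a \<in> S2_strip N"
  shows "S2_line N a = 2 * pochhammer a (Suc N) / fact (Suc N) * deriv zeta (- of_nat (Suc N))"
proof -
  obtain B where "\<And>a. a \<in> S2_strip N \<Longrightarrow> S2_line N a = S2_main N a + B * pochhammer a (Suc N)"
    using S2_line_structure[of N] by blast
  then have B: "S2_line N a = B * pochhammer a (Suc N)" if "a \<in> S2_strip N" for a
    using that by (simp add: S2_main_def S2_line_zero_odd[OF N])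
  have "((\<lambda>a. B * pochhammer (a + 1) N * a) has_field_derivative
      (B * pochhammer (0 + 1) N * 1 + deriv (\<lambda>a. B * pochhammer (a + 1) N) 0 * 0)) (at 0)"
  proof (rule DERIV_mult')
    have "(\<lambda>a. B * pochhammer (a + 1) N) holomorphic_on UNIV"
      by (intro holomorphic_intros)
    then show "((\<lambda>a. B * pochhammer (a + 1) N) has_field_derivative deriv (\<lambda>a. B * pochhammer (a + 1) N) 0) (at 0)"
      by (rule holomorphic_derivI) auto
  qed (rule DERIV_ident)
  then have "((\<lambda>a. B * pochhammer (a + 1) N * a) has_field_derivative (B * fact N)) (at 0)"
    by (simp add: pochhammer_fact)
  then have "(S2_line N has_field_derivative (B * fact N)) (at 0)"
    by (rule has_field_derivative_transform_within_open[of _ _ _ "S2_strip N"])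
       (auto simp: open_S2_strip B pochhammer_rec, simp add: S2_strip_def)
  from DERIV_unique[OF this S2_line_odd_derivative[OF N]]
  have "B = 2 * deriv zeta (- of_nat (Suc N)) / fact (Suc N)"
    by (simp add: field_simps del: of_nat_Suc)
  then show ?thesis using B[OF a] by simp
qed

theorem theorem4:
  fixes m :: nat and a b :: complex
  shows
    "(a + b = - of_nat (2 * m) \<and> - 2 * real m - 1 < Re a \<and> Re a < 1 \<longrightarrow>
        S2_convergent a b \<and>
        S2 a b = - (Gamma (1 - a) * Gamma (of_nat (2 * m + 1) + a) / fact (2 * m + 1))
                   * cos (of_real pi * a) * zeta (- of_nat (2 * m + 1)))
     \<and>
     (a + b = - of_nat (2 * m + 1) \<and> - 2 * real m - 2 < Re a \<and> Re a < 1 \<longrightarrow>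
        S2_convergent a b \<and>
        S2 a b = 2 * pochhammer a (2 * m + 2) / fact (2 * m + 2)
                   * deriv zeta (- of_nat (2 * m + 2)))"
proof (intro conjI[of "_ \<longrightarrow> _"] impI)
  assume *: "a + b = - of_nat (2 * m) \<and> - 2 * real m - 1 < Re a \<and> Re a < 1"
  define N where "N = 2 * m"
  have b: "b = - of_nat N - a" using * by (metis N_def add_diff_cancel_left')
  have a: "a \<in> S2_strip N" using * by (simp add: S2_strip_def N_def)
  have "S2 a b = S2_line N a" by (simp add: b S2_line_def)
  also have "\<dots> = S2_main N a" by (rule S2_line_even[OF _ a]) (simp add: N_def)
  also have "\<dots> = - zeta (- of_nat (Suc N)) / (of_nat (Suc N) * fact N) * (Gamma (1 - a) * Gamma (of_nat (Suc N) + a)) * cos (of_real pi * a)"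
    unfolding S2_main_def S2_line_zero by (simp del: of_nat_Suc)
  also have "of_nat (Suc N) * fact N = (fact (Suc N) :: complex)" by (rule fact_Suc[symmetric])
  also have "Suc N = 2 * m + 1" by (simp add: N_def)
  finally have "S2 a b = - (Gamma (1 - a) * Gamma (of_nat (2 * m + 1) + a) / fact (2 * m + 1))
                   * cos (of_real pi * a) * zeta (- of_nat (2 * m + 1))"
    by (simp add: mult_ac del: of_nat_add)
  moreover have "S2_convergent a b"
    using S2_convergent_domain[OF S2_domain_line[OF a]] by (simp add: b)
  ultimately show "S2_convergent a b \<and>
        S2 a b = - (Gamma (1 - a) * Gamma (of_nat (2 * m + 1) + a) / fact (2 * m + 1))
                   * cos (of_real pi * a) * zeta (- of_nat (2 * m + 1))" by blast
next
  assume *: "a + b = - of_nat (2 * m + 1) \<and> - 2 * real m - 2 < Re a \<and> Re a < 1"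
  define N where "N = 2 * m + 1"
  have b: "b = - of_nat N - a" using * by (metis N_def add_diff_cancel_left')
  have a: "a \<in> S2_strip N" using * by (simp add: S2_strip_def N_def)
  have N: "Suc N = 2 * m + 2" by (simp add: N_def)
  have "S2 a b = S2_line N a" by (simp add: b S2_line_def)
  also have "\<dots> = 2 * pochhammer a (Suc N) / fact (Suc N) * deriv zeta (- of_nat (Suc N))"
    by (rule S2_line_odd[OF _ a]) (simp add: N_def)
  finally have "S2 a b = 2 * pochhammer a (2 * m + 2) / fact (2 * m + 2) * deriv zeta (- of_nat (2 * m + 2))"
    unfolding N .
  moreover have "S2_convergent a b"
    using S2_convergent_domain[OF S2_domain_line[OF a]] by (simp add: b)
  ultimately show "S2_convergent a b \<and>
        S2 a b = 2 * pochhammer a (2 * m + 2) / fact (2 * m + 2)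
                   * deriv zeta (- of_nat (2 * m + 2))" by blast
qed

end
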